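(* Let $L>0$ and $C>0$. For any $x\in\mathbb R^2$ and any $\beta>1$, $$\limsup_{n\to\infty}\ \sup_{f\in H(\beta,C)\cap B(L)}\Big(\frac{n}{\log n}\Big)^{\frac{2\beta-2}{2\beta+1}}E_f\big[(f^*(x)-f(x))^2\big]<\infty,$$ where $f^*$ is the adaptive estimator defined in the context (whose construction does not use $\beta$).
   Context: **Model.** $B_1=\{x\in\mathbb R^2:\|x\|\le 1\}$. For $L>0$, $B(L)$ is the class of functions $f:\mathbb R^2\to\mathbb R$ supported in $B_1$, continuous a.e., with $|f(x)|\le L$. The Sobolev ball $H(\beta,C)$ is the set of $f$ with $\int_{\mathbb R^2}(1+\|\xi\|^2)^\beta|\widetilde f(\xi)|^2\,d\xi\le C$, $\widetilde f$ being the Fourier transform of $f$. Let $\mathrm S^1$ be the unit circle in $\mathbb R^2$, $Z=\mathrm S^1\times[-1,1]$, $\mu\in\mathbb R$ a fixed constant, and for $\theta\in \mathrm S^1$ let $\theta^\perp$ be the unit vector perpendicular to $\theta$ (with a fixed choice of orientation). The exponential Radon transform of $f\in B(L)$ is $$T_\mu f(\theta,s)=\int_{x\cdot\theta=s}e^{\mu x\cdot\theta^\perp}f(x)\,dx,\qquad(\theta,s)\in Z$$ (integration with respect to arc length on the line). One observes $(\theta_i,s_i,Y_i)$, $i=1,\dots,n$, with $Y_i=T_\mu f(\theta_i,s_i)+\epsilon_i$, where the $(\theta_i,s_i)$ are i.i.d. uniform on $Z$, and the noise variables $\epsilon_i$ are i.i.d. $N(0,\sigma^2)$, $0<\sigma^2<\infty$,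 independent of the design points. $E_f$ and $\mathrm{Var}_f$ denote expectation and variance under the joint law of $(\theta_i,s_i,Y_i)_{i\le n}$. **Estimators.** For $\delta>0$ put $K_\delta(s)=\frac1\pi\int_{|\mu|}^{\sqrt{1/\delta^2+\mu^2}} r\cos(sr)\,dr$ and $$\bar f_\delta(x)=\frac1n\sum_{i=1}^n e^{-\mu x\cdot\theta_i^\perp}K_\delta(x\cdot\theta_i-s_i)Y_i.$$ **Grid and constants.** Fix $a\ge2$; $n$ is such that $a\log n/n\le 1$; $\delta_n^-=\log n/n$; $\Delta_n=\{\delta\in[\delta_n^-,1]:\delta=a^{-j},\ j=0,1,2,\dots\}$. Put $$v^2(\delta)=\frac{c^*\delta^{-3}}{n},\qquad v^2(\delta,\eta)=\frac{c^{**}}{n}\int_{\mathbb R}(K_\delta(u)-K_\eta(u))^2\,du,$$ where $c^*,c^{**}$ are fixed constants (not depending on $f\in B(L)$, $\delta,\eta\in(0,1]$, $n$) for which $\mathrm{Var}_f(\bar f_\delta(x))\le v^2(\delta)$ and $\mathrm{Var}_f(\bar f_\delta(x)-\bar f_\eta(x))\le v^2(\delta,\eta)$. Put $\lambda(\delta)=\max\big(1,\sqrt{D_2\log(1/\delta)}\big)$, where $D_2$ is a fixed, sufficiently large constant (in particular $D_2\ge 20L^2/c^*$). For $\delta>\eta$ put $$\psi(\delta,\eta)=v(\delta)\lambda(\delta)+v(\delta,\eta)\lambda(\eta).$$ **Adaptive bandwidth and estimator.** $$\bar\delta(x)=\max\{\delta\in\Delta_n:\ |\bar f_\delta(x)-\bar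 f_\eta(x)|\le\psi(\delta,\eta)\ \ \forall\,\eta\in\Delta_n,\ \eta\le\delta\}$$ (the condition being trivial for $\eta=\delta$), and $f^*(x)=\bar f_{\bar\delta(x)}(x)$.
   Formalization: The supremum is taken over those f in H(β,C)∩B(L) that are continuous at x; without this the claim fails, e.g. for |x|≤1 and f equal to L at x and 0 elsewhere, whose data law is that of f=0. *)

theory Defs
  imports "HOL-Probability.Probability"
begin

section \<open>Function classes\<close>

text \<open>The discontinuity set of any function is Borel, so continuity a.e. can be stated over
  Lebesgue measure on Borel sets.\<close>

definition bounded_class :: "real \<Rightarrow> ((real^2) \<Rightarrow> real) set" where
  "bounded_class L = {f. (\<forall>x. norm x > 1 \<longrightarrow> f x = 0) \<and> (AE x in lborel. isCont f x) \<and> (\<forall>x. \<bar>f x\<bar> \<le> L)}"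

text \<open>The unnormalised transform with angular frequency. Members of the classes need not be Borel,
  so integrals of them are taken over the completed measure \<^const>\<open>lebesgue\<close>.\<close>

definition fourier :: "((real^2) \<Rightarrow> real) \<Rightarrow> (real^2) \<Rightarrow> complex" where
  "fourier f \<xi> = (\<integral>x. cis (- (x \<bullet> \<xi>)) * complex_of_real (f x) \<partial>lebesgue)"

text \<open>Integrability makes the transform a genuine integral. It is automatic for members of
  \<^const>\<open>bounded_class\<close>, so it does not affect the intersection of the two classes.\<close>

definition sobolev_ball :: "real \<Rightarrow> real \<Rightarrow> ((real^2) \<Rightarrow> real) set" where
  "sobolev_ball \<beta> C = {f. integrable lebesgue f \<and>
     (\<integral>\<^sup>+\<xi>. ennreal ((1 + (norm \<xi>)\<^sup>2) powr \<beta> * (cmod (fourier f \<xi>))\<^sup>2) \<partial>lborel) \<le> ennreal C}"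

section \<open>The observation model\<close>

text \<open>Counterclockwise orientation. The opposite choice amounts to replacing \<open>\<mu>\<close> by \<open>- \<mu>\<close>.\<close>

definition perp :: "real^2 \<Rightarrow> real^2" where
  "perp \<theta> = vector [- (\<theta> $ 2), \<theta> $ 1]"

text \<open>The line \<open>x \<bullet> \<theta> = s\<close> is parametrised by arc length as \<open>x = s \<theta> + t perp \<theta>\<close>, so that
  \<open>x \<bullet> perp \<theta> = t\<close>. For \<open>f\<close> continuous a.e. the integrand is Lebesgue measurable for almost all
  \<open>(\<theta>, s)\<close>; on the remaining null set the integral may take the default value 0.\<close>

definition exp_radon :: "real \<Rightarrow> ((real^2) \<Rightarrow> real) \<Rightarrow> real^2 \<Rightarrow> real \<Rightarrow> real" where
  "exp_radon \<mu> f \<theta> s = (\<integral>t. exp (\<mu> * t) * f (s *\<^sub>R \<theta> + t *\<^sub>R perp \<theta>) \<partial>lebesgue)"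

definition circle_unif :: "(real^2) measure" where
  "circle_unif = distr (uniform_measure lborel {0..2*pi}) borel (\<lambda>\<phi>. vector [cos \<phi>, sin \<phi>])"

definition design :: "((real^2) \<times> real) measure" where
  "design = circle_unif \<Otimes>\<^sub>M uniform_measure lborel {-1..1}"

text \<open>The law of one observation \<open>(\<theta>, s, Y)\<close>. The completion is needed because
  \<^const>\<open>exp_radon\<close> agrees with a Borel function only almost everywhere.\<close>

definition obs_law :: "real \<Rightarrow> real \<Rightarrow> ((real^2) \<Rightarrow> real) \<Rightarrow> ((real^2) \<times> real \<times> real) measure" where
  "obs_law \<mu> \<sigma> f =
     distr (completion (design \<Otimes>\<^sub>M density lborel (\<lambda>e. ennreal (normal_density 0 \<sigma> e)))) borel
       (\<lambda>((\<theta>, s), e). (\<theta>, s, exp_radon \<mu> f \<theta> s + e))"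

definition sample_law ::
  "real \<Rightarrow> real \<Rightarrow> ((real^2) \<Rightarrow> real) \<Rightarrow> nat \<Rightarrow> (nat \<Rightarrow> (real^2) \<times> real \<times> real) measure" where
  "sample_law \<mu> \<sigma> f n = Pi\<^sub>M {1..n} (\<lambda>_. obs_law \<mu> \<sigma> f)"

section \<open>The estimators\<close>

definition kern :: "real \<Rightarrow> real \<Rightarrow> real \<Rightarrow> real" where
  "kern \<mu> \<delta> s = (1 / pi) * (LBINT r:{\<bar>\<mu>\<bar>..sqrt (1 / \<delta>\<^sup>2 + \<mu>\<^sup>2)}. r * cos (s * r))"

definition fbar ::
  "real \<Rightarrow> nat \<Rightarrow> real \<Rightarrow> real^2 \<Rightarrow> (nat \<Rightarrow> (real^2) \<times> real \<times> real) \<Rightarrow> real" where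
  "fbar \<mu> n \<delta> x \<omega> =
     (1 / real n) * (\<Sum>i=1..n. case \<omega> i of (\<theta>, s, Y) \<Rightarrow>
        exp (- \<mu> * (x \<bullet> perp \<theta>)) * kern \<mu> \<delta> (x \<bullet> \<theta> - s) * Y)"

definition grid :: "real \<Rightarrow> nat \<Rightarrow> real set" where
  "grid a n = {\<delta>. ln (real n) / real n \<le> \<delta> \<and> \<delta> \<le> 1 \<and> (\<exists>j::nat. \<delta> = 1 / a ^ j)}"

definition var1 :: "real \<Rightarrow> nat \<Rightarrow> real \<Rightarrow> real" where
  "var1 c1 n \<delta> = c1 * (1 / \<delta> ^ 3) / real n"

definition var2 :: "real \<Rightarrow> real \<Rightarrow> nat \<Rightarrow> real \<Rightarrow> real \<Rightarrow> real" where
  "var2 \<mu> c2 n \<delta> \<eta> = c2 / real n * (LBINT u. (kern \<mu> \<delta> u - kern \<mu> \<eta> u)\<^sup>2)"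

definition lam :: "real \<Rightarrow> real \<Rightarrow> real" where
  "lam D2 \<delta> = max 1 (sqrt (D2 * ln (1 / \<delta>)))"

definition thresh ::
  "real \<Rightarrow> real \<Rightarrow> real \<Rightarrow> real \<Rightarrow> nat \<Rightarrow> real \<Rightarrow> real \<Rightarrow> real" where
  "thresh \<mu> c1 c2 D2 n \<delta> \<eta> =
     sqrt (var1 c1 n \<delta>) * lam D2 \<delta> + sqrt (var2 \<mu> c2 n \<delta> \<eta>) * lam D2 \<eta>"

text \<open>For \<open>n \<ge> 2\<close> the grid is finite, and its least element satisfies the condition trivially,
  so the maximum is over a nonempty finite set.\<close>

definition adapt_bw ::
  "real \<Rightarrow> real \<Rightarrow> real \<Rightarrow> real \<Rightarrow> real \<Rightarrow> nat \<Rightarrow> real^2 \<Rightarrow> (nat \<Rightarrow> (real^2) \<times> real \<times> real) \<Rightarrow> real"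
  where
  "adapt_bw \<mu> a c1 c2 D2 n x \<omega> =
     Max {\<delta> \<in> grid a n. \<forall>\<eta>\<in>grid a n. \<eta> \<le> \<delta> \<longrightarrow>
            \<bar>fbar \<mu> n \<delta> x \<omega> - fbar \<mu> n \<eta> x \<omega>\<bar> \<le> thresh \<mu> c1 c2 D2 n \<delta> \<eta>}"

definition fstar ::
  "real \<Rightarrow> real \<Rightarrow> real \<Rightarrow> real \<Rightarrow> real \<Rightarrow> nat \<Rightarrow> real^2 \<Rightarrow> (nat \<Rightarrow> (real^2) \<times> real \<times> real) \<Rightarrow> real"
  where
  "fstar \<mu> a c1 c2 D2 n x \<omega> = fbar \<mu> n (adapt_bw \<mu> a c1 c2 D2 n x \<omega>) x \<omega>"

end

theory Submission
  imports Defs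
begin

text \<open>
  Each estimator \<^const>\<open>fbar\<close> is a linear statistic: an average over the observations of the response times a weight
  given by a kernel. The proof controls its mean and its deviation from the mean, and then shows that the selection rule
  does as well as the best fixed bandwidth.

  \<^bold>\<open>Mean.\<close> The mean is the integral of \<open>f\<close> against an angular average of the kernel with an exponential weight. The
  substitution \<open>r = sqrt (\<rho>\<^sup>2 + \<mu>\<^sup>2)\<close> in the kernel and a shift of the angle into the complex plane
  (\<open>exponential_weight_shift\<close>) remove the exponential weight. The average becomes the Fourier transform of the disc of
  radius \<open>1 / \<delta>\<close>, so the mean is the Fourier inversion integral of \<open>f\<close> truncated at frequency \<open>1 / \<delta>\<close>
  (\<open>mean_functional_kern\<close>). For \<open>\<beta> > 1\<close> the transform of \<open>f\<close> is integrable, inversion holds at the continuity point \<open>x\<close>, and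
  the part of the integral beyond \<open>1 / \<delta>\<close> is of order \<open>\<delta> powr (\<beta> - 1)\<close> (\<open>band_limited_bias\<close>).

  \<^bold>\<open>Deviation.\<close> A summand is a bounded weight times the sum of a bounded number and a Gaussian one. Hence the exponential
  moment of order \<open>c\<close> of the deviation is at most the exponential of a constant times \<open>c\<^sup>2 / n\<close> times the squared
  \<open>L\<^sup>2\<close> norm of the kernel, as long as \<open>c\<close> is at most of order \<open>n\<close> divided by the supremum of the kernel
  (\<open>linear_estimator_mgf\<close>). The squared norm is of order \<open>\<delta>\<^sup>-\<^sup>3\<close> and the supremum of order \<open>\<delta>\<^sup>-\<^sup>2\<close>. On the grid
  \<open>n \<delta> \<ge> ln n\<close>, which keeps all exponents that are needed in the admissible range. This gives a second moment of order
  \<open>1 / (n \<delta>\<^sup>3)\<close>, a fourth moment of the order of its square (\<open>fbar_moments\<close>), and, for \<open>D2\<close> large enough, a probability of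
  at most \<open>2 \<eta> ^ 11\<close> that the difference of two estimators deviates by more than its part of the threshold
  (\<open>kern_diff_deviation\<close>).

  \<^bold>\<open>Selection.\<close> Let \<open>\<delta>\<^sub>0\<close> be a grid point of order \<open>(ln n / n) powr (1 / (2 * \<beta> + 1))\<close>, chosen so that up to \<open>\<delta>\<^sub>0\<close> the bias
  stays below the noise level. If the rule selects a bandwidth of at least \<open>\<delta>\<^sub>0\<close>, the selected estimator differs from the one at
  \<open>\<delta>\<^sub>0\<close> by at most a threshold of order \<open>sqrt (ln n / (n \<delta>\<^sub>0 ^ 3))\<close>, which is the asserted rate. If it selects some \<open>\<delta> < \<delta>\<^sub>0\<close>,
  then \<open>a * \<delta>\<close> was rejected although its bias is negligible, so a deviation bound failed for some \<open>\<eta> < a * \<delta>\<close>. The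
  probability of this is of order \<open>\<delta> ^ 10\<close>; weighed against the fourth power of the error it contributes only \<open>\<delta> / n\<close>,
  and these contributions sum to \<open>O (1 / n)\<close> over the geometric grid (\<open>adaptive_risk\<close>).
\<close>

section \<open>Oscillating integrals and the kernels\<close>

text \<open>Up to the factor \<open>1 / pi\<close>, the kernels of the estimators and the differences of two kernels are
  integrals of this form.\<close>

definition osc :: "real \<Rightarrow> real \<Rightarrow> real \<Rightarrow> real" where
  "osc A B s = (LBINT r:{A..B}. r * cos (s * r))"

definition osc_prim :: "real \<Rightarrow> real \<Rightarrow> real" where
  "osc_prim s r = (if s = 0 then r\<^sup>2 / 2 else r * sin (s * r) / s + cos (s * r) / s\<^sup>2)"

lemma osc_prim_deriv: "(osc_prim s has_real_derivative r * cos (s * r)) (at r within S)"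
proof (cases "s = 0")
  case True
  then show ?thesis unfolding osc_prim_def by (auto intro!: derivative_eq_intros)
next
  case False
  then show ?thesis unfolding osc_prim_def
    by (auto intro!: derivative_eq_intros simp: field_simps power2_eq_square)
qed

lemma osc_eq: assumes "A \<le> B" shows "osc A B s = osc_prim s B - osc_prim s A"
  unfolding osc_def set_lebesgue_integral_def
  by (rule integral_FTC_Icc[OF assms])
     (auto intro!: osc_prim_deriv continuous_intros simp: has_real_derivative_iff_has_vector_derivative[symmetric])

lemma osc_measurable [measurable]: "osc A B \<in> borel_measurable borel"
  unfolding osc_def set_lebesgue_integral_def by measurable

lemma osc_integrable: "integrable lborel (\<lambda>r::real. indicat_real {A..B} r *\<^sub>R (r * cos (s * r)))"
  by (rule borel_integrable_compact) (auto intro!: continuous_intros)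

lemma osc_bound: assumes "0 \<le> A" "A \<le> B" shows "\<bar>osc A B s\<bar> \<le> B\<^sup>2"
proof -
  have "\<bar>osc A B s\<bar> \<le> (LBINT r:{A..B}. B)"
    unfolding osc_def set_lebesgue_integral_def
  proof (rule integral_abs_bound_integral)
    show "integrable lborel (\<lambda>r. indicat_real {A..B} r *\<^sub>R (r * cos (s * r)))"
      by (rule osc_integrable)
    show "integrable lborel (\<lambda>r. indicat_real {A..B} r *\<^sub>R B)"
      by (rule borel_integrable_compact) auto
    show "\<bar>indicat_real {A..B} r *\<^sub>R (r * cos (s * r))\<bar> \<le> indicat_real {A..B} r *\<^sub>R B" for r
    proof (cases "r \<in> {A..B}")
      case True
      then have "\<bar>r\<bar> * \<bar>cos (s * r)\<bar> \<le> B * 1" using assms by (intro mult_mono) auto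
      then show ?thesis using True by (simp add: abs_mult)
    qed simp
  qed
  also have "\<dots> = (B - A) * B" using assms by (simp add: set_lebesgue_integral_def)
  also have "\<dots> \<le> B * B" using assms by (intro mult_right_mono) auto
  finally show ?thesis by (simp add: power2_eq_square)
qed

text \<open>Integration by parts gains a factor \<open>1 / s\<close>.\<close>

lemma osc_decay: assumes "0 \<le> A" "A \<le> B" shows "\<bar>s\<bar> * \<bar>osc A B s\<bar> \<le> 3 * B"
proof (cases "s = 0")
  case False
  have *: "s * osc A B s = (B * sin (s * B) - A * sin (s * A)) + (cos (s * B) - cos (s * A)) / s"
    using False unfolding osc_eq[OF assms(2)] osc_prim_def by (simp add: field_simps power2_eq_square)
  have "\<bar>cos (s * B) - cos (s * A)\<bar> \<le> \<bar>s\<bar> * (B - A)"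
  proof -
    have "norm (cos (s * B) - cos (s * A)) \<le> \<bar>s\<bar> * norm (B - A)"
    proof (rule field_differentiable_bound[of UNIV "\<lambda>r. cos (s * r)" "\<lambda>r. - sin (s * r) * s"])
      show "norm (- sin (s * r) * s) \<le> \<bar>s\<bar>" for r
        by (simp add: abs_mult mult_left_le_one_le)
    qed (auto intro!: derivative_eq_intros)
    then show ?thesis using assms by simp
  qed
  then have 1: "\<bar>(cos (s * B) - cos (s * A)) / s\<bar> \<le> B - A"
    using False by (simp add: abs_divide divide_le_eq mult.commute)
  have 2: "\<bar>B * sin (s * B)\<bar> \<le> B" "\<bar>A * sin (s * A)\<bar> \<le> A"
    using assms by (auto simp: abs_mult mult_left_le)
  show ?thesis using 1 2 assms unfolding abs_mult[symmetric] * by linarith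
qed (use assms in auto)

lemma inverse_square_tail:
  fixes c :: real assumes "c > 0"
  shows "(\<integral>\<^sup>+s. ennreal (1 / s\<^sup>2) * indicator {c..} s \<partial>lborel) = ennreal (1 / c)"
proof -
  have "(\<integral>\<^sup>+s. ennreal (1 / s\<^sup>2) * indicator {c..} s \<partial>lborel) = ennreal (0 - (- 1 / c))"
  proof (rule nn_integral_FTC_atLeast)
    show "((\<lambda>x. - 1 / x) has_real_derivative 1 / x\<^sup>2) (at x)" if "c \<le> x" for x
      using that assms by (auto intro!: derivative_eq_intros simp: power2_eq_square)
    show "((\<lambda>x::real. - 1 / x) \<longlongrightarrow> 0) at_top" by real_asymp
  qed auto
  then show ?thesis by simp
qed

text \<open>The bound by \<open>B\<^sup>2\<close> is used for \<open>\<bar>s\<bar> \<le> 1 / B\<close> and the decay in \<open>s\<close> outside. This gives the order \<open>B ^ 3\<close>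
  that the Plancherel identity would give.\<close>

lemma osc_square_nn_integral:
  assumes "0 \<le> A" "A \<le> B" "0 < B"
  shows "(\<integral>\<^sup>+s. ennreal ((osc A B s)\<^sup>2) \<partial>lborel) \<le> ennreal (20 * B ^ 3)"
proof -
  define c where "c = 1 / B"
  have c: "c > 0" using assms by (simp add: c_def)
  let ?t = "\<lambda>s::real. ennreal (1 / s\<^sup>2) * indicator {c..} s"
  have pw: "ennreal ((osc A B s)\<^sup>2) \<le> ennreal (B ^ 4) * indicator {-c..c} s + (ennreal (9 * B\<^sup>2) * ?t s + ennreal (9 * B\<^sup>2) * ?t (0 + (-1) * s))" for s
  proof (cases "\<bar>s\<bar> \<le> c")
    case True
    have "(osc A B s)\<^sup>2 \<le> (B\<^sup>2)\<^sup>2"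
      using osc_bound[OF assms(1,2)] by (intro power2_le_iff_abs_le[THEN iffD2]) auto
    then have "ennreal ((osc A B s)\<^sup>2) \<le> ennreal (B ^ 4) * indicator {-c..c} s"
      using True by (auto simp: abs_le_iff indicator_def intro!: ennreal_leI)
    then show ?thesis by (rule order_trans) simp
  next
    case False
    have "(s * osc A B s)\<^sup>2 \<le> (3 * B)\<^sup>2"
      using osc_decay[OF assms(1,2), of s] assms by (intro power2_le_iff_abs_le[THEN iffD2]) (auto simp: abs_mult)
    then have "(osc A B s)\<^sup>2 \<le> 9 * B\<^sup>2 * (1 / s\<^sup>2)"
      using False c by (auto simp: power_mult_distrib field_simps)
    then have "ennreal ((osc A B s)\<^sup>2) \<le> ennreal (9 * B\<^sup>2) * ennreal (1 / s\<^sup>2)"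
      by (subst ennreal_mult[symmetric]) (auto intro!: ennreal_leI)
    also have "\<dots> \<le> ennreal (9 * B\<^sup>2) * ?t s + ennreal (9 * B\<^sup>2) * ?t (0 + (-1) * s)"
      using False by (auto simp: indicator_def)
    finally show ?thesis by (rule order_trans) simp
  qed
  have refl: "(\<integral>\<^sup>+s. ?t (0 + (-1) * s) \<partial>lborel) = (\<integral>\<^sup>+s. ?t s \<partial>lborel)"
    using nn_integral_real_affine[of ?t "-1" 0] by simp
  have "(\<integral>\<^sup>+s. ennreal ((osc A B s)\<^sup>2) \<partial>lborel) \<le>
    (\<integral>\<^sup>+s. ennreal (B ^ 4) * indicator {-c..c} s + (ennreal (9 * B\<^sup>2) * ?t s + ennreal (9 * B\<^sup>2) * ?t (0 + (-1) * s)) \<partial>lborel)"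
    by (intro nn_integral_mono pw)
  also have "\<dots> = ennreal (B ^ 4) * ennreal (2 * c) + (ennreal (9 * B\<^sup>2) * ennreal (1 / c) + ennreal (9 * B\<^sup>2) * ennreal (1 / c))"
    using c by (simp add: nn_integral_add nn_integral_cmult refl[simplified] inverse_square_tail del: mult_minus1)
  also have "\<dots> = ennreal (20 * B ^ 3)"
    using assms by (simp add: ennreal_mult[symmetric] ennreal_plus[symmetric] c_def power2_eq_square power3_eq_cube power4_eq_xxxx del: ennreal_plus)
  finally show ?thesis .
qed

lemma osc_square_integrable:
  assumes "0 \<le> A" "A \<le> B" "0 < B"
  shows "integrable lborel (\<lambda>s. (osc A B s)\<^sup>2)" "(LBINT s. (osc A B s)\<^sup>2) \<le> 20 * B ^ 3"
proof -
  show 1: "integrable lborel (\<lambda>s. (osc A B s)\<^sup>2)"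
    using le_less_trans[OF osc_square_nn_integral[OF assms] ennreal_less_top] by (intro integrableI_bounded) auto
  show "(LBINT s. (osc A B s)\<^sup>2) \<le> 20 * B ^ 3"
    using osc_square_nn_integral[OF assms] assms(3) by (simp add: nn_integral_eq_integral[OF 1])
qed

text \<open>On the interval where \<open>cos (s * r)\<close> stays above one half for all \<open>r \<le> B\<close>, the oscillating integral is
  comparable with its value at \<open>s = 0\<close>.\<close>

lemma osc_square_lower:
  assumes "0 \<le> A" "A \<le> B" "0 < B"
  shows "(B\<^sup>2 - A\<^sup>2)\<^sup>2 / (8 * B) \<le> (LBINT s. (osc A B s)\<^sup>2)"
proof -
  have pw: "indicat_real {-(1/B)..1/B} s * ((B\<^sup>2 - A\<^sup>2) / 4)\<^sup>2 \<le> (osc A B s)\<^sup>2" for s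
  proof (cases "s \<in> {-(1/B)..1/B}")
    case True
    have cosb: "cos (s * r) \<ge> 1 / 2" if "r \<in> {A..B}" for r
    proof -
      have "\<bar>s * r\<bar> \<le> (1 / B) * B" unfolding abs_mult using that assms True by (intro mult_mono) auto
      then have "\<bar>s * r\<bar> \<le> 1" using assms by simp
      then have "(s * r)\<^sup>2 \<le> 1" by (simp add: abs_square_le_1)
      moreover have "1 - (s * r)\<^sup>2 / 2 \<le> cos (s * r)"
        using cos_double_sin[of "s * r / 2"] abs_sin_x_le_abs_x[of "s * r / 2"]
          abs_le_square_iff[of "sin (s * r / 2)" "s * r / 2"] by (simp add: power_divide field_simps)
      ultimately show ?thesis by simp
    qed
    have "(B\<^sup>2 - A\<^sup>2) / 4 = (LBINT r:{A..B}. r / 2)"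
      unfolding set_lebesgue_integral_def
      by (subst integral_FTC_Icc[OF assms(2), where F="\<lambda>r. r\<^sup>2 / 4"])
        (auto intro!: derivative_eq_intros continuous_intros simp: has_real_derivative_iff_has_vector_derivative[symmetric] diff_divide_distrib)
    also have "\<dots> \<le> osc A B s" unfolding osc_def set_lebesgue_integral_def
    proof (rule integral_mono[OF _ osc_integrable])
      show "integrable lborel (\<lambda>r. indicat_real {A..B} r *\<^sub>R (r / 2))"
        by (rule borel_integrable_compact) (auto intro!: continuous_intros)
      show "indicat_real {A..B} r *\<^sub>R (r / 2) \<le> indicat_real {A..B} r *\<^sub>R (r * cos (s * r))" for r
        using cosb[of r] assms mult_left_mono[OF cosb[of r], of r] by (auto simp: indicator_def)
    qed
    finally have "((B\<^sup>2 - A\<^sup>2) / 4)\<^sup>2 \<le> (osc A B s)\<^sup>2"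
      using assms by (intro power_mono) (auto intro: power_mono)
    then show ?thesis using True by simp
  qed simp
  have "(B\<^sup>2 - A\<^sup>2)\<^sup>2 / (8 * B) = (LBINT s. indicat_real {-(1/B)..1/B} s * ((B\<^sup>2 - A\<^sup>2) / 4)\<^sup>2)"
    using assms by (simp add: power_divide)
  also have "\<dots> \<le> (LBINT s. (osc A B s)\<^sup>2)"
    by (rule integral_mono[OF _ osc_square_integrable(1)[OF assms] pw])
      (intro integrable_mult_left integrable_real_indicator, auto simp: emeasure_lborel_Icc_eq)
  finally show ?thesis .
qed

definition cutoff :: "real \<Rightarrow> real \<Rightarrow> real" where
  "cutoff \<mu> \<delta> = sqrt (1 / \<delta>\<^sup>2 + \<mu>\<^sup>2)"

lemma kern_eq_osc: "kern \<mu> \<delta> s = osc \<bar>\<mu>\<bar> (cutoff \<mu> \<delta>) s / pi"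
  by (simp add: kern_def osc_def cutoff_def)

lemma kern_measurable [measurable]: "kern \<mu> \<delta> \<in> borel_measurable borel"
  unfolding kern_eq_osc[abs_def] by measurable

lemma cutoff_bounds:
  assumes "0 < \<delta>" "\<delta> \<le> 1"
  shows "\<bar>\<mu>\<bar> \<le> cutoff \<mu> \<delta>" "0 < cutoff \<mu> \<delta>" "cutoff \<mu> \<delta> \<le> sqrt (1 + \<mu>\<^sup>2) / \<delta>"
    "(cutoff \<mu> \<delta>)\<^sup>2 = 1 / \<delta>\<^sup>2 + \<mu>\<^sup>2" "(cutoff \<mu> \<delta>)\<^sup>2 \<le> (1 + \<mu>\<^sup>2) / \<delta>\<^sup>2"
    "(cutoff \<mu> \<delta>) ^ 3 \<le> (1 + \<mu>\<^sup>2)\<^sup>2 / \<delta> ^ 3"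
proof -
  show "\<bar>\<mu>\<bar> \<le> cutoff \<mu> \<delta>" unfolding cutoff_def by (rule real_le_rsqrt) simp
  show pos: "0 < cutoff \<mu> \<delta>" unfolding cutoff_def using assms by (simp add: add_pos_nonneg)
  show sq: "(cutoff \<mu> \<delta>)\<^sup>2 = 1 / \<delta>\<^sup>2 + \<mu>\<^sup>2" by (simp add: cutoff_def)
  have "\<delta>\<^sup>2 \<le> 1" using assms by (simp add: abs_square_le_1)
  then have "\<mu>\<^sup>2 * \<delta>\<^sup>2 \<le> \<mu>\<^sup>2 * 1" by (intro mult_left_mono) auto
  then show le: "(cutoff \<mu> \<delta>)\<^sup>2 \<le> (1 + \<mu>\<^sup>2) / \<delta>\<^sup>2"
    unfolding sq using assms by (simp add: field_simps power2_eq_square)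
  show le1: "cutoff \<mu> \<delta> \<le> sqrt (1 + \<mu>\<^sup>2) / \<delta>"
    by (rule power2_le_imp_le) (use le assms in \<open>auto simp: power_divide\<close>)
  have "(cutoff \<mu> \<delta>) ^ 3 \<le> (sqrt (1 + \<mu>\<^sup>2) / \<delta>) ^ 3" using le1 pos by (intro power_mono) auto
  also have "\<dots> = (sqrt (1 + \<mu>\<^sup>2)) ^ 3 / \<delta> ^ 3" by (simp add: power_divide)
  also have "\<dots> \<le> (sqrt (1 + \<mu>\<^sup>2)) ^ 4 / \<delta> ^ 3"
    using assms by (intro divide_right_mono power_increasing) auto
  also have "(sqrt (1 + \<mu>\<^sup>2)) ^ 4 = (1 + \<mu>\<^sup>2)\<^sup>2"
    using power_mult[of "sqrt (1 + \<mu>\<^sup>2)" 2 2] by simp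
  finally show "(cutoff \<mu> \<delta>) ^ 3 \<le> (1 + \<mu>\<^sup>2)\<^sup>2 / \<delta> ^ 3" .
qed

lemma cutoff_antimono: "0 < \<eta> \<Longrightarrow> \<eta> \<le> \<delta> \<Longrightarrow> cutoff \<mu> \<delta> \<le> cutoff \<mu> \<eta>"
  unfolding cutoff_def by (intro real_sqrt_le_mono add_right_mono divide_left_mono power_mono) auto

lemma osc_add: assumes "A \<le> B" "B \<le> C" shows "osc A C s = osc A B s + osc B C s"
  using assms by (simp add: osc_eq)

lemma kern_diff:
  assumes "0 < \<eta>" "\<eta> \<le> \<delta>" "\<delta> \<le> 1"
  shows "kern \<mu> \<delta> s - kern \<mu> \<eta> s = - osc (cutoff \<mu> \<delta>) (cutoff \<mu> \<eta>) s / pi"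
  using osc_add[of "\<bar>\<mu>\<bar>" "cutoff \<mu> \<delta>" "cutoff \<mu> \<eta>" s] cutoff_antimono[OF assms(1,2)] cutoff_bounds(1)[of \<delta>] assms
  by (simp add: kern_eq_osc field_simps)

lemma osc_pi_bounds:
  assumes "0 \<le> A" "A \<le> cutoff \<mu> \<eta>" "0 < \<eta>" "\<eta> \<le> 1"
  shows "\<bar>osc A (cutoff \<mu> \<eta>) s / pi\<bar> \<le> (1 + \<mu>\<^sup>2) / \<eta>\<^sup>2"
    and "integrable lborel (\<lambda>s. (osc A (cutoff \<mu> \<eta>) s / pi)\<^sup>2)"
    and "(LBINT s. (osc A (cutoff \<mu> \<eta>) s / pi)\<^sup>2) \<le> 20 * (1 + \<mu>\<^sup>2)\<^sup>2 / \<eta> ^ 3"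
proof -
  have pi1: "1 \<le> pi" using pi_ge_two by linarith
  have "\<bar>osc A (cutoff \<mu> \<eta>) s / pi\<bar> \<le> \<bar>osc A (cutoff \<mu> \<eta>) s\<bar> / 1"
    using pi1 by (simp add: abs_divide divide_le_eq mult_le_cancel_left1)
  also have "\<dots> \<le> (1 + \<mu>\<^sup>2) / \<eta>\<^sup>2"
    using osc_bound[OF assms(1,2), of s] cutoff_bounds(5)[OF assms(3,4), of \<mu>] by simp
  finally show "\<bar>osc A (cutoff \<mu> \<eta>) s / pi\<bar> \<le> (1 + \<mu>\<^sup>2) / \<eta>\<^sup>2" .
  note * = osc_square_integrable[OF assms(1,2) cutoff_bounds(2)[OF assms(3,4), of \<mu>]]
  show "integrable lborel (\<lambda>s. (osc A (cutoff \<mu> \<eta>) s / pi)\<^sup>2)"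
    unfolding power_divide using *(1) by simp
  have "(LBINT s. (osc A (cutoff \<mu> \<eta>) s / pi)\<^sup>2) = (LBINT s. (osc A (cutoff \<mu> \<eta>) s)\<^sup>2) / pi\<^sup>2"
    unfolding power_divide by simp
  also have "\<dots> \<le> (LBINT s. (osc A (cutoff \<mu> \<eta>) s)\<^sup>2) / 1"
    using pi1 by (intro divide_left_mono integral_nonneg) auto
  also have "\<dots> \<le> 20 * (1 + \<mu>\<^sup>2)\<^sup>2 / \<eta> ^ 3"
    using *(2) cutoff_bounds(6)[OF assms(3,4), of \<mu>] by simp
  finally show "(LBINT s. (osc A (cutoff \<mu> \<eta>) s / pi)\<^sup>2) \<le> 20 * (1 + \<mu>\<^sup>2)\<^sup>2 / \<eta> ^ 3" .
qed

lemma kern_bounds: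
  assumes "0 < \<eta>" "\<eta> \<le> 1"
  shows "\<bar>kern \<mu> \<eta> s\<bar> \<le> (1 + \<mu>\<^sup>2) / \<eta>\<^sup>2"
    and "integrable lborel (\<lambda>s. (kern \<mu> \<eta> s)\<^sup>2)"
    and "(LBINT s. (kern \<mu> \<eta> s)\<^sup>2) \<le> 20 * (1 + \<mu>\<^sup>2)\<^sup>2 / \<eta> ^ 3"
  using osc_pi_bounds[OF _ cutoff_bounds(1)[OF assms] assms] by (simp_all add: kern_eq_osc)

lemma kern_diff_bounds:
  assumes "0 < \<eta>" "\<eta> \<le> \<delta>" "\<delta> \<le> 1"
  shows "\<bar>kern \<mu> \<delta> s - kern \<mu> \<eta> s\<bar> \<le> (1 + \<mu>\<^sup>2) / \<eta>\<^sup>2"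
    and "integrable lborel (\<lambda>s. (kern \<mu> \<delta> s - kern \<mu> \<eta> s)\<^sup>2)"
    and "(LBINT s. (kern \<mu> \<delta> s - kern \<mu> \<eta> s)\<^sup>2) \<le> 20 * (1 + \<mu>\<^sup>2)\<^sup>2 / \<eta> ^ 3"
proof -
  have "0 < \<delta>" "\<eta> \<le> 1" using assms by auto
  note * = osc_pi_bounds[OF less_imp_le[OF cutoff_bounds(2)[OF \<open>0 < \<delta>\<close> assms(3)]] cutoff_antimono[OF assms(1,2)] assms(1) \<open>\<eta> \<le> 1\<close>]
  show "\<bar>kern \<mu> \<delta> s - kern \<mu> \<eta> s\<bar> \<le> (1 + \<mu>\<^sup>2) / \<eta>\<^sup>2"
    "integrable lborel (\<lambda>s. (kern \<mu> \<delta> s - kern \<mu> \<eta> s)\<^sup>2)"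
    "(LBINT s. (kern \<mu> \<delta> s - kern \<mu> \<eta> s)\<^sup>2) \<le> 20 * (1 + \<mu>\<^sup>2)\<^sup>2 / \<eta> ^ 3"
    using * by (simp_all add: kern_diff[OF assms])
qed

text \<open>A difference of two estimators obeys a Gaussian deviation bound only on a range that is governed by the
  supremum of its kernel, which is of order \<open>\<eta>\<^sup>-\<^sup>2\<close>. The squared \<open>L\<^sup>2\<close> norm must therefore have its
  full order \<open>\<eta>\<^sup>-\<^sup>3\<close>, and this holds once the two bandwidths are separated by a factor.\<close>

lemma kern_diff_lower:
  assumes "0 < \<eta>" "\<eta> \<le> \<delta> / 2" "\<delta> \<le> 1"
  shows "1 / (256 * (1 + \<mu>\<^sup>2)) / \<eta> ^ 3 \<le> (LBINT s. (kern \<mu> \<delta> s - kern \<mu> \<eta> s)\<^sup>2)"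
proof -
  have d: "0 < \<delta>" "\<eta> \<le> \<delta>" "\<eta> \<le> 1" using assms by auto
  let ?A = "cutoff \<mu> \<delta>" and ?B = "cutoff \<mu> \<eta>"
  have A: "0 \<le> ?A" "?A \<le> ?B" "0 < ?B" 
    using cutoff_bounds(2)[OF d(1) assms(3), of \<mu>] cutoff_antimono[OF assms(1) d(2), of \<mu>] by auto
  have "(2 * \<eta>)\<^sup>2 \<le> \<delta>\<^sup>2" using assms by (intro power_mono) auto
  then have "1 / \<delta>\<^sup>2 \<le> 1 / (2 * \<eta>)\<^sup>2" using assms(1) d by (intro divide_left_mono) auto
  then have diff: "3 / 4 * (1 / \<eta>\<^sup>2) \<le> ?B\<^sup>2 - ?A\<^sup>2"
    unfolding cutoff_bounds(4)[OF d(1) assms(3)] cutoff_bounds(4)[OF assms(1) d(3)] by (simp add: power_mult_distrib)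
  have B: "?B \<le> (1 + \<mu>\<^sup>2) / \<eta>"
  proof -
    have "sqrt (1 + \<mu>\<^sup>2) * 1 \<le> sqrt (1 + \<mu>\<^sup>2) * sqrt (1 + \<mu>\<^sup>2)" by (intro mult_left_mono) auto
    then have "sqrt (1 + \<mu>\<^sup>2) \<le> 1 + \<mu>\<^sup>2" by simp
    then show ?thesis using cutoff_bounds(3)[OF assms(1) d(3), of \<mu>] assms(1)
      by (meson divide_right_mono less_imp_le order_trans)
  qed
  have "1 / (256 * (1 + \<mu>\<^sup>2)) / \<eta> ^ 3 = (8 / 2048) * (1 / ((1 + \<mu>\<^sup>2) * \<eta> ^ 3))"
    by simp
  also have "\<dots> \<le> (9 / 2048) * (1 / ((1 + \<mu>\<^sup>2) * \<eta> ^ 3))"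
    using assms(1) by (intro mult_right_mono) auto
  also have "\<dots> = (3 / 4 * (1 / \<eta>\<^sup>2))\<^sup>2 / (8 * ((1 + \<mu>\<^sup>2) / \<eta>)) / 16"
    using assms(1) by (simp add: power_divide power_mult_distrib power2_eq_square power3_eq_cube)
  also have "\<dots> \<le> (?B\<^sup>2 - ?A\<^sup>2)\<^sup>2 / (8 * ?B) / 16"
    using diff mult_left_mono[OF B, of 8] A(3) assms(1) by (intro divide_right_mono frac_le power_mono) simp_all
  also have "\<dots> \<le> (LBINT s. (osc ?A ?B s)\<^sup>2) / 16"
    using osc_square_lower[OF A] by (intro divide_right_mono) auto
  also have "\<dots> \<le> (LBINT s. (osc ?A ?B s)\<^sup>2) / pi\<^sup>2"
    using power_mono[OF less_imp_le[OF pi_less_4], of 2] pi_gt_zero 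
    by (intro divide_left_mono integral_nonneg) auto
  also have "\<dots> = (LBINT s. (kern \<mu> \<delta> s - kern \<mu> \<eta> s)\<^sup>2)"
    by (simp add: kern_diff[OF assms(1) d(2) assms(3)] power_divide)
  finally show ?thesis .
qed

text \<open>The substitution \<open>r = sqrt (\<rho>\<^sup>2 + \<mu>\<^sup>2)\<close> replaces the cutoff at \<open>\<bar>\<mu>\<bar>\<close> by integration over the radii of a
  disc.\<close>

lemma kern_radial:
  assumes "0 < \<delta>"
  shows "kern \<mu> \<delta> s = (LBINT \<rho>:{0..1/\<delta>}. \<rho> * cos (s * sqrt (\<rho>\<^sup>2 + \<mu>\<^sup>2))) / pi"
proof -
  let ?f = "\<lambda>\<rho>. \<rho> * cos (s * sqrt (\<rho>\<^sup>2 + \<mu>\<^sup>2))"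
  have int: "integrable lborel (\<lambda>\<rho>. indicat_real {0..1/\<delta>} \<rho> *\<^sub>R ?f \<rho>)"
    by (rule borel_integrable_compact) (auto intro!: continuous_intros)
  have "(?f has_integral osc_prim s (sqrt ((1/\<delta>)\<^sup>2 + \<mu>\<^sup>2)) - osc_prim s (sqrt (0\<^sup>2 + \<mu>\<^sup>2))) {0..1/\<delta>}"
  proof (rule fundamental_theorem_of_calculus_interior)
    show "0 \<le> 1 / \<delta>" using assms by simp
    have "continuous_on UNIV (osc_prim s)"
      by (intro DERIV_continuous_on[where D="\<lambda>r. r * cos (s * r)"] osc_prim_deriv)
    then show "continuous_on {0..1/\<delta>} (\<lambda>\<rho>. osc_prim s (sqrt (\<rho>\<^sup>2 + \<mu>\<^sup>2)))"
      by (rule continuous_on_compose2) (auto intro!: continuous_intros)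
    fix \<rho> assume "\<rho> \<in> {0<..<1/\<delta>}"
    then have pos: "\<rho> > 0" "\<rho>\<^sup>2 + \<mu>\<^sup>2 > 0" by (simp_all add: add_pos_nonneg)
    have "((\<lambda>\<rho>. osc_prim s (sqrt (\<rho>\<^sup>2 + \<mu>\<^sup>2))) has_real_derivative
       (sqrt (\<rho>\<^sup>2 + \<mu>\<^sup>2) * cos (s * sqrt (\<rho>\<^sup>2 + \<mu>\<^sup>2))) * (\<rho> / sqrt (\<rho>\<^sup>2 + \<mu>\<^sup>2))) (at \<rho>)"
      by (rule DERIV_chain2[OF osc_prim_deriv]) (use pos in \<open>auto intro!: derivative_eq_intros simp: divide_simps\<close>)
    then show "((\<lambda>\<rho>. osc_prim s (sqrt (\<rho>\<^sup>2 + \<mu>\<^sup>2))) has_vector_derivative ?f \<rho>) (at \<rho>)"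
      using pos by (simp add: has_real_derivative_iff_has_vector_derivative mult.commute)
  qed
  moreover have "(?f has_integral (LBINT \<rho>:{0..1/\<delta>}. ?f \<rho>)) {0..1/\<delta>}"
    using set_borel_integral_eq_integral[of "{0..1/\<delta>}" ?f] int
    by (simp add: set_integrable_def has_integral_iff)
  ultimately have "(LBINT \<rho>:{0..1/\<delta>}. ?f \<rho>) = osc_prim s (sqrt ((1/\<delta>)\<^sup>2 + \<mu>\<^sup>2)) - osc_prim s (sqrt (0\<^sup>2 + \<mu>\<^sup>2))"
    by (rule has_integral_unique[symmetric])
  also have "\<dots> = osc \<bar>\<mu>\<bar> (cutoff \<mu> \<delta>) s"
    by (subst osc_eq) (auto simp: cutoff_def power_divide intro!: real_le_rsqrt)
  finally show ?thesis by (simp add: kern_eq_osc)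
qed

section \<open>Line coordinates and polar coordinates\<close>

definition circ :: "real \<Rightarrow> real^2" where
  "circ \<phi> = vector [cos \<phi>, sin \<phi>]"

lemma circ_nth [simp]: "circ \<phi> $ 1 = cos \<phi>" "circ \<phi> $ 2 = sin \<phi>"
  by (simp_all add: circ_def)

lemma perp_nth [simp]: "perp \<theta> $ 1 = - (\<theta> $ 2)" "perp \<theta> $ 2 = \<theta> $ 1"
  by (simp_all add: perp_def)

lemma inner_2: "(x :: real^2) \<bullet> y = x $ 1 * y $ 1 + x $ 2 * y $ 2"
  by (simp add: inner_vec_def sum_2)

lemma norm_2_sq: "(norm (x :: real^2))\<^sup>2 = (x $ 1)\<^sup>2 + (x $ 2)\<^sup>2"
  by (simp add: norm_eq_sqrt_inner inner_2 power2_eq_square)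

lemma norm_circ [simp]: "norm (circ \<phi>) = 1"
  by (simp add: norm_eq_sqrt_inner inner_2)

lemma vec2_eq_iff: "(x :: real^2) = y \<longleftrightarrow> x $ 1 = y $ 1 \<and> x $ 2 = y $ 2"
  by (auto simp: vec_eq_iff forall_2)

lemma vector_axis: "(vector [a, b] :: real^2) = a *\<^sub>R axis 1 1 + b *\<^sub>R axis 2 1"
  by (simp add: vec2_eq_iff axis_def)

lemma vector_measurable [measurable (raw)]:
  assumes [measurable]: "f \<in> borel_measurable M" "g \<in> borel_measurable M"
  shows "(\<lambda>x. vector [f x, g x] :: real^2) \<in> borel_measurable M"
  unfolding vector_axis by measurable

lemma nth_measurable [measurable (raw)]:
  fixes f :: "'a \<Rightarrow> real^2"
  assumes [measurable]: "f \<in> borel_measurable M"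
  shows "(\<lambda>x. f x $ i) \<in> borel_measurable M"
  unfolding cart_eq_inner_axis by measurable

lemma circ_measurable [measurable]: "circ \<in> borel_measurable borel"
  unfolding circ_def[abs_def] by measurable

lemma perp_measurable [measurable]: "perp \<in> borel_measurable borel"
  unfolding perp_def[abs_def] by measurable

lemma prod_Basis_2: "(\<Prod>b\<in>Basis. (x :: real^2) \<bullet> b) = x $ 1 * x $ 2"
proof -
  have "Basis = {axis 1 1, axis 2 1 :: real^2}"
    by (auto simp: Basis_vec_def UNIV_2)
  then have "(\<Prod>b\<in>Basis. x \<bullet> b) = (\<Prod>b\<in>{axis 1 1, axis 2 1 :: real^2}. x \<bullet> b)" by (rule arg_cong)
  then show ?thesis by (simp add: axis_eq_axis inner_axis)
qed

lemma box_2: "p \<in> box l u \<longleftrightarrow> l $ 1 < p $ 1 \<and> p $ 1 < u $ 1 \<and> l $ 2 < p $ 2 \<and> p $ 2 < u $ 2" for p :: "real^2"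
  by (auto simp: mem_box_cart forall_2)

lemma box_le_2:
  fixes l u :: "real^2"
  assumes "\<And>b. b \<in> Basis \<Longrightarrow> l \<bullet> b \<le> u \<bullet> b" shows "l $ i \<le> u $ i"
  using assms[of "axis i 1"] by (simp add: inner_axis)

lemma lborel_cartesian:
  "distr (lborel \<Otimes>\<^sub>M lborel) borel (\<lambda>(a, b). vector [a, b] :: real^2) = lborel"
proof (rule lborel_eqI[symmetric])
  fix l u :: "real^2" assume le: "\<And>b. b \<in> Basis \<Longrightarrow> l \<bullet> b \<le> u \<bullet> b"
  have *: "(\<lambda>(a, b). vector [a, b] :: real^2) -` box l u = {l$1<..<u$1} \<times> {l$2<..<u$2}"
    by (auto simp: box_2)
  show "emeasure (distr (lborel \<Otimes>\<^sub>M lborel) borel (\<lambda>(a, b). vector [a, b])) (box l u) = ennreal (\<Prod>b\<in>Basis. (u - l) \<bullet> b)"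
    using box_le_2[OF le] 
    by (subst emeasure_distr) (simp_all add: * space_pair_measure lborel.emeasure_pair_measure_Times prod_Basis_2 ennreal_mult)
qed simp

definition frame :: "real \<Rightarrow> real^2 \<Rightarrow> real^2" where
  "frame \<phi> v = v $ 1 *\<^sub>R circ \<phi> + v $ 2 *\<^sub>R perp (circ \<phi>)"

lemma frame_orthogonal: "orthogonal_transformation (frame \<phi>)"
  unfolding orthogonal_transformation_def
proof (intro conjI allI)
  show "linear (frame \<phi>)"
    by (rule linearI) (simp_all add: frame_def vec2_eq_iff algebra_simps)
  fix v w
  have "frame \<phi> v \<bullet> frame \<phi> w = (v$1 * w$1 + v$2 * w$2) * ((sin \<phi>)\<^sup>2 + (cos \<phi>)\<^sup>2)"
    by (simp add: frame_def inner_2 power2_eq_square algebra_simps del: sin_cos_squared_add sin_cos_squared_add2 sin_cos_squared_add3)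
  then show "frame \<phi> v \<bullet> frame \<phi> w = v \<bullet> w" by (simp add: inner_2)
qed

lemma frame_measurable [measurable]: "frame \<phi> \<in> borel_measurable borel"
  unfolding frame_def[abs_def] by measurable

lemma lborel_frame: "distr lborel borel (frame \<phi>) = lborel"
proof (rule lborel_eqI[symmetric])
  fix l u :: "real^2" assume le: "\<And>b. b \<in> Basis \<Longrightarrow> l \<bullet> b \<le> u \<bullet> b"
  have inv: "orthogonal_transformation (inv (frame \<phi>))"
    by (rule orthogonal_transformation_inv[OF frame_orthogonal])
  have *: "frame \<phi> -` box l u = inv (frame \<phi>) ` box l u"
    by (rule bij_vimage_eq_inv_image[OF orthogonal_transformation_bij[OF frame_orthogonal]])
  have borel: "inv (frame \<phi>) ` box l u \<in> sets borel"
    unfolding *[symmetric] using measurable_sets_borel[OF frame_measurable, of "box l u"] by simp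
  have "measure lborel (inv (frame \<phi>) ` box l u) = measure lborel (box l u)"
    using measure_orthogonal_image[OF inv, of "box l u"] borel by (simp add: measure_completion)
  moreover have "emeasure lborel (inv (frame \<phi>) ` box l u) < \<infinity>"
    using measurable_orthogonal_image[OF inv lmeasurable_box, of l u] borel
    by (simp add: fmeasurable_def)
  moreover have "emeasure lborel (box l u) < \<infinity>"
    using lmeasurable_box[of l u] by (simp add: fmeasurable_def)
  ultimately have "emeasure lborel (inv (frame \<phi>) ` box l u) = emeasure lborel (box l u)"
    by (simp add: emeasure_eq_ennreal_measure less_top[symmetric])
  then show "emeasure (distr lborel borel (frame \<phi>)) (box l u) = ennreal (\<Prod>b\<in>Basis. (u - l) \<bullet> b)"
    using le by (subst emeasure_distr) (simp_all add: * emeasure_lborel_box)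
qed simp

text \<open>Rotations preserve Lebesgue measure, so for every direction Fubini applies: integrate along the lines orthogonal to it,
  then over their offsets.\<close>

lemma lborel_line_coordinates:
  "distr (lborel \<Otimes>\<^sub>M lborel) borel (\<lambda>(s, t). s *\<^sub>R circ \<phi> + t *\<^sub>R perp (circ \<phi>)) = lborel"
proof -
  have "lborel = distr (distr (lborel \<Otimes>\<^sub>M lborel) borel (\<lambda>(a, b). vector [a, b] :: real^2)) borel (frame \<phi>)"
    by (simp add: lborel_cartesian lborel_frame)
  also have "\<dots> = distr (lborel \<Otimes>\<^sub>M lborel) borel (\<lambda>(s, t). s *\<^sub>R circ \<phi> + t *\<^sub>R perp (circ \<phi>))"
    by (subst distr_distr) (auto simp: comp_def frame_def case_prod_beta')
  finally show ?thesis by simp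
qed

definition polar :: "real^2 \<Rightarrow> real^2" where
  "polar v = v $ 1 *\<^sub>R circ (v $ 2)"

lemma polar_derivative:
  "(polar has_derivative (\<lambda>h. h $ 1 *\<^sub>R circ (v $ 2) + (v $ 1 * h $ 2) *\<^sub>R perp (circ (v $ 2)))) (at v within S)"
proof -
  have eq: "polar = (\<lambda>v. (v $ 1 * cos (v $ 2)) *\<^sub>R axis 1 1 + (v $ 1 * sin (v $ 2)) *\<^sub>R axis 2 1)"
    by (auto simp: polar_def vec2_eq_iff axis_def fun_eq_iff)
  have nth: "((\<lambda>v. v $ i) has_derivative (\<lambda>h. h $ i)) (at v within S)" for i :: 2 and v :: "real^2"
    by (rule bounded_linear_imp_has_derivative[OF bounded_linear_vec_nth])
  show ?thesis unfolding eq
    by (rule has_derivative_eq_rhs, (rule derivative_intros nth)+)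
      (simp add: fun_eq_iff vec2_eq_iff axis_def algebra_simps)
qed

lemma det_polar:
  "det (matrix (\<lambda>h. h $ 1 *\<^sub>R circ \<phi> + (r * h $ 2) *\<^sub>R perp (circ \<phi>))) = r"
proof -
  have "cos \<phi> * (r * cos \<phi>) + r * sin \<phi> * sin \<phi> = r"
    using sin_cos_squared_add3[of \<phi>] by algebra
  then show ?thesis by (simp add: det_2 matrix_def axis_def)
qed

lemma polar_inj: "inj_on polar {v. 0 < v $ 1 \<and> 0 < v $ 2 \<and> v $ 2 < 2 * pi}"
proof (rule inj_onI)
  fix v w :: "real^2"
  assume v: "v \<in> {v. 0 < v $ 1 \<and> 0 < v $ 2 \<and> v $ 2 < 2 * pi}"
    and w: "w \<in> {v. 0 < v $ 1 \<and> 0 < v $ 2 \<and> v $ 2 < 2 * pi}" and eq: "polar v = polar w"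
  have "norm (polar v) = norm (polar w)" using eq by simp
  then have r: "v $ 1 = w $ 1" using v w by (simp add: polar_def)
  then have "circ (v $ 2) = circ (w $ 2)" using eq v by (simp add: polar_def)
  then have "sin (v$2) = sin (w$2) \<and> cos (v$2) = cos (w$2)" by (simp add: vec2_eq_iff)
  then obtain n :: int where n: "v $ 2 = w $ 2 + 2 * pi * n" by (auto simp: sin_cos_eq_iff)
  have "2 * pi * real_of_int n < 2 * pi * 1" "2 * pi * (-1) < 2 * pi * real_of_int n"
    using n v w unfolding mem_Collect_eq by linarith+
  moreover have k: "0 < 2 * pi" by simp
  ultimately have "real_of_int n < 1" "-1 < real_of_int n"
    using mult_less_cancel_left_pos[OF k, of "real_of_int n" 1]
      mult_less_cancel_left_pos[OF k, of "-1" "real_of_int n"] by blast+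
  then have "n = 0" by linarith
  then show "v = w" using n r by (simp add: vec2_eq_iff)
qed

lemma polar_image:
  "polar ` {v. 0 < v $ 1 \<and> 0 < v $ 2 \<and> v $ 2 < 2 * pi} = {p. \<not> (p $ 2 = 0 \<and> 0 \<le> p $ 1)}"
proof (intro equalityI subsetI)
  fix p assume "p \<in> polar ` {v. 0 < v $ 1 \<and> 0 < v $ 2 \<and> v $ 2 < 2 * pi}"
  then obtain v where v: "0 < v $ 1" "0 < v $ 2" "v $ 2 < 2 * pi" "p = polar v" by auto
  show "p \<in> {p. \<not> (p $ 2 = 0 \<and> 0 \<le> p $ 1)}"
  proof (rule ccontr)
    assume "p \<notin> {p. \<not> (p $ 2 = 0 \<and> 0 \<le> p $ 1)}"
    then have s: "sin (v$2) = 0" "0 \<le> cos (v$2)" using v by (auto simp: polar_def zero_le_mult_iff)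
    consider "v$2 < pi" | "v$2 = pi" | "v$2 > pi" by linarith
    then show False
      using s v sin_gt_zero[of "v$2"] sin_lt_zero[of "v$2"] by cases auto
  qed
next
  fix p :: "real^2" assume p: "p \<in> {p. \<not> (p $ 2 = 0 \<and> 0 \<le> p $ 1)}"
  then have n: "norm p > 0" by auto
  have "(p $ 1 / norm p)\<^sup>2 + (p $ 2 / norm p)\<^sup>2 = 1"
    unfolding power_divide add_divide_distrib[symmetric] norm_2_sq[symmetric] using n by simp
  then obtain t where t: "0 \<le> t" "t < 2 * pi" "p $ 1 / norm p = cos t" "p $ 2 / norm p = sin t"
    by (rule sincos_total_2pi)
  have "t \<noteq> 0"
  proof
    assume "t = 0"
    then have "p $ 2 = 0" "p $ 1 = norm p" using t n by auto
    then show False using p by auto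
  qed
  moreover have "p = polar (vector [norm p, t])"
    using t(3,4)[unfolded nonzero_divide_eq_eq[OF less_imp_neq[OF n, symmetric]]] by (simp add: vec2_eq_iff polar_def mult.commute)
  ultimately show "p \<in> polar ` {v. 0 < v $ 1 \<and> 0 < v $ 2 \<and> v $ 2 < 2 * pi}"
    using t n by (intro image_eqI[where x="vector [norm p, t]"]) auto
qed

lemma polar_measurable [measurable]: "polar \<in> borel_measurable borel"
  unfolding polar_def[abs_def] by measurable

text \<open>Polar coordinates miss only the nonnegative half of the first axis, which is a null set.\<close>

lemma nn_integral_polar_box:
  fixes l u :: "real^2"
  shows "(\<integral>\<^sup>+v. ennreal (v $ 1) * indicator {v. 0 < v $ 1 \<and> 0 < v $ 2 \<and> v $ 2 < 2 * pi} v * indicator (box l u) (polar v) \<partial>lborel)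
    = emeasure lborel (box l u)"
proof -
  let ?S = "{v :: real^2. 0 < v $ 1 \<and> 0 < v $ 2 \<and> v $ 2 < 2 * pi}"
  let ?S' = "?S \<inter> polar -` box l u"
  let ?R = "{p :: real^2. p $ 2 = 0 \<and> 0 \<le> p $ 1}"
  have "?S \<in> sets borel" by measurable
  then have S: "?S' \<in> sets borel"
    using measurable_sets_borel[OF polar_measurable borel_open[OF open_box]] by (intro sets.Int) auto
  have img: "polar ` ?S' = box l u - ?R"
  proof -
    have "polar ` ?S' = polar ` ?S \<inter> box l u" by blast
    also have "\<dots> = box l u - ?R" unfolding polar_image by blast
    finally show ?thesis .
  qed
  have "negligible {p :: real^2. p $ 2 = 0}"
    using negligible_standard_hyperplane_cart[of 2] by simp
  then have R: "negligible ?R" by (rule negligible_subset) auto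
  have lm: "box l u - ?R \<in> lmeasurable" 
    by (intro fmeasurable_Diff lmeasurable_box negligible_imp_sets R)
  have meas: "measure lebesgue (box l u - ?R) = measure lebesgue (box l u)"
    by (rule measure_negligible_symdiff) (auto intro: negligible_subset[OF R])
  have "((\<lambda>v. \<bar>det (matrix (\<lambda>h. h $ 1 *\<^sub>R circ (v $ 2) + (v $ 1 * h $ 2) *\<^sub>R perp (circ (v $ 2))))\<bar>)
      has_integral measure lebesgue (box l u)) ?S'"
  proof (rule has_measure_differentiable_image[where f=polar, THEN iffD1])
    show "?S' \<in> sets lebesgue" using S by simp
    show "inj_on polar ?S'" by (rule inj_on_subset[OF polar_inj]) auto
    show "polar ` ?S' \<in> lmeasurable \<and> measure lebesgue (polar ` ?S') = measure lebesgue (box l u)"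
      unfolding img using lm meas by blast
  qed (rule polar_derivative)
  then have "((\<lambda>v. v $ 1) has_integral measure lebesgue (box l u)) ?S'"
    unfolding det_polar by (rule has_integral_eq[rotated]) auto
  then have "(\<integral>\<^sup>+v. ennreal (v $ 1) * indicator ?S' v \<partial>lborel) = measure lebesgue (box l u)"
    using S by (intro nn_integral_has_integral_lebesgue')  auto
  moreover have "ennreal (v $ 1) * indicator ?S' v = ennreal (v $ 1) * indicator ?S v * indicator (box l u) (polar v)" for v
    by (simp add: indicator_def)
  moreover have "emeasure lborel (box l u) = measure lebesgue (box l u)"
    using lmeasurable_box[of l u] by (simp add: fmeasurable_def emeasure_eq_ennreal_measure)
  ultimately show ?thesis by simp
qed

lemma nn_integral_cartesian:
  assumes [measurable]: "h \<in> borel_measurable borel"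
  shows "(\<integral>\<^sup>+v. h v \<partial>(lborel :: (real^2) measure)) = (\<integral>\<^sup>+a. \<integral>\<^sup>+b. h (vector [a, b]) \<partial>lborel \<partial>lborel)"
  by (subst lborel_cartesian[symmetric], subst nn_integral_distr)
     (auto simp: lborel.nn_integral_fst[symmetric] split_beta)

lemma lborel_polar:
  "distr (density lborel (\<lambda>v. ennreal (v $ 1) * indicator {v. 0 < v $ 1 \<and> 0 < v $ 2 \<and> v $ 2 < 2 * pi} v)) borel polar = lborel"
proof (rule lborel_eqI[symmetric])
  fix l u :: "real^2" assume le: "\<And>b. b \<in> Basis \<Longrightarrow> l \<bullet> b \<le> u \<bullet> b"
  let ?d = "\<lambda>v :: real^2. ennreal (v $ 1) * indicator {v. 0 < v $ 1 \<and> 0 < v $ 2 \<and> v $ 2 < 2 * pi} v"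
  have "emeasure (distr (density lborel ?d) borel polar) (box l u) = emeasure (density lborel ?d) (polar -` box l u)"
    by (subst emeasure_distr) auto
  also have "\<dots> = (\<integral>\<^sup>+v. ?d v * indicator (polar -` box l u) v \<partial>lborel)"
    using measurable_sets_borel[OF polar_measurable borel_open[OF open_box]] by (intro emeasure_density) auto
  also have "\<dots> = emeasure lborel (box l u)"
    using nn_integral_polar_box[of l u] by (simp add: indicator_vimage comp_def)
  also have "\<dots> = ennreal (\<Prod>b\<in>Basis. (u - l) \<bullet> b)" using le by (simp add: emeasure_lborel_box)
  finally show "emeasure (distr (density lborel ?d) borel polar) (box l u) = ennreal (\<Prod>b\<in>Basis. (u - l) \<bullet> b)" .
qed simp

lemma nn_integral_polar:
  assumes [measurable]: "h \<in> borel_measurable borel"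
  shows "(\<integral>\<^sup>+v. h v \<partial>(lborel :: (real^2) measure)) =
    (\<integral>\<^sup>+r. ennreal r * indicator {0<..} r * (\<integral>\<^sup>+\<phi>. h (r *\<^sub>R circ \<phi>) * indicator {0<..<2*pi} \<phi> \<partial>lborel) \<partial>lborel)"
proof -
  have "(\<integral>\<^sup>+v. h v \<partial>(lborel :: (real^2) measure)) =
    (\<integral>\<^sup>+v. ennreal (v $ 1) * indicator {v. 0 < v $ 1 \<and> 0 < v $ 2 \<and> v $ 2 < 2 * pi} v * h (polar v) \<partial>lborel)"
    by (subst lborel_polar[symmetric], subst nn_integral_distr, simp, simp, subst nn_integral_density) auto
  also have "\<dots> = (\<integral>\<^sup>+r. \<integral>\<^sup>+\<phi>. ennreal r * indicator {0<..} r * (h (r *\<^sub>R circ \<phi>) * indicator {0<..<2*pi} \<phi>) \<partial>lborel \<partial>lborel)"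
    by (subst nn_integral_cartesian)
       (auto intro!: nn_integral_cong simp: polar_def indicator_def)
  finally show ?thesis by (simp add: nn_integral_cmult)
qed

section \<open>Removing the exponential weight\<close>

text \<open>For real \<open>p\<close>, \<open>q\<close> and a real angle \<open>w\<close> this is \<open>exp (\<i> \<xi> \<bullet> circ w)\<close> with \<open>\<xi> = (p, q)\<close>. The angle is
  complex so that it can be moved off the real axis.\<close>

definition plane_wave :: "complex \<Rightarrow> complex \<Rightarrow> complex \<Rightarrow> complex" where
  "plane_wave p q w = exp (\<i> * (p * cos w + q * sin w))"

lemma plane_wave_deriv:
  "(plane_wave p q has_field_derivative (\<i> * (q * cos w - p * sin w)) * plane_wave p q w) (at w within S)"
  unfolding plane_wave_def by (auto intro!: derivative_eq_intros simp: algebra_simps)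

lemma plane_wave_period: "plane_wave p q (of_real (2 * pi) + w) = plane_wave p q w"
proof -
  have "cos (complex_of_real (2 * pi)) = 1" "sin (complex_of_real (2 * pi)) = 0"
    using arg_cong[OF cos_two_pi, of complex_of_real] arg_cong[OF sin_two_pi, of complex_of_real]
    unfolding cos_of_real sin_of_real of_real_1 of_real_0 .
  then show ?thesis
    unfolding plane_wave_def cos_add sin_add by (simp only: mult_1_left mult_zero_left diff_zero add_0_left)
qed

abbreviation (input) plane_wave_diff :: "complex \<Rightarrow> complex \<Rightarrow> complex \<Rightarrow> complex" where
  "plane_wave_diff p q w \<equiv> (\<i> * (q * cos w - p * sin w)) * plane_wave p q w"

lemma plane_wave_continuous:
  fixes f :: "'z::t2_space \<Rightarrow> complex"
  assumes "continuous_on A f"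
  shows "continuous_on A (\<lambda>x. plane_wave p q (f x))" "continuous_on A (\<lambda>x. \<i> * plane_wave_diff p q (f x))"
  unfolding plane_wave_def by (intro continuous_intros assms)+

lemma plane_wave_deriv_vertical:
  "((\<lambda>\<tau>. plane_wave p q (of_real \<phi> + \<i> * of_real \<tau>)) has_vector_derivative
     \<i> * plane_wave_diff p q (of_real \<phi> + \<i> * of_real \<tau>)) (at \<tau>)"
proof -
  have "((\<lambda>\<tau>. of_real \<phi> + \<i> * of_real \<tau> :: complex) has_vector_derivative \<i>) (at \<tau>)"
    by (rule has_vector_derivative_eq_rhs, (rule derivative_intros DERIV_ident)+)
      (simp only: of_real_1 mult_1_right add_0_left)
  from field_vector_diff_chain_at[OF this plane_wave_deriv, of p q] show ?thesis
    by (simp only: comp_def)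
qed

lemma plane_wave_deriv_horizontal:
  "((\<lambda>\<phi>. plane_wave p q (of_real \<phi> + \<i> * of_real \<tau>)) has_vector_derivative
     plane_wave_diff p q (of_real \<phi> + \<i> * of_real \<tau>)) (at \<phi>)"
proof -
  have "((\<lambda>\<phi>. of_real \<phi> + \<i> * of_real \<tau> :: complex) has_vector_derivative 1) (at \<phi>)"
    by (rule has_vector_derivative_eq_rhs, (rule derivative_intros DERIV_ident)+)
      (simp only: of_real_1 mult_zero_right of_real_0 add_0_right)
  from field_vector_diff_chain_at[OF this plane_wave_deriv, of p q] show ?thesis
    by (simp only: comp_def mult_1_left)
qed

lemma plane_wave_period_integral:
  "((\<lambda>\<phi>. \<i> * plane_wave_diff p q (of_real \<phi> + \<i> * of_real \<tau>)) has_integral 0) (cbox 0 (2*pi))"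
proof -
  have "((\<lambda>\<phi>. \<i> * plane_wave_diff p q (of_real \<phi> + \<i> * of_real \<tau>)) has_integral
      \<i> * plane_wave p q (of_real (2 * pi) + \<i> * of_real \<tau>) - \<i> * plane_wave p q (of_real 0 + \<i> * of_real \<tau>)) {0..2*pi}"
  proof (rule fundamental_theorem_of_calculus)
    show "0 \<le> 2 * pi" by (simp only: pi_ge_zero zero_le_mult_iff zero_le_numeral simp_thms)
  qed (rule has_vector_derivative_mult_right[OF has_vector_derivative_at_within[OF plane_wave_deriv_horizontal]])
  then show ?thesis
    by (simp only: plane_wave_period cbox_interval of_real_0 add_0_left diff_self)
qed

text \<open>The derivative of the shifted integral in the direction of the shift is the integral over a full period
  of a derivative in the angle, hence zero.\<close>

lemma plane_wave_shift:
  "integral {0..2*pi} (\<lambda>\<phi>. plane_wave p q (of_real \<phi> + \<i> * of_real \<tau>)) = integral {0..2*pi} (\<lambda>\<phi>. plane_wave p q (of_real \<phi>))"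
proof -
  define H where "H \<tau> = integral (cbox 0 (2*pi)) (\<lambda>\<phi>. plane_wave p q (of_real \<phi> + \<i> * of_real \<tau>))" for \<tau>
  have "(H has_vector_derivative 0) (at \<tau> within UNIV)" for \<tau>
  proof -
    have "(H has_vector_derivative integral (cbox 0 (2*pi)) (\<lambda>\<phi>. \<i> * plane_wave_diff p q (of_real \<phi> + \<i> * of_real \<tau>))) (at \<tau> within UNIV)"
      unfolding H_def[abs_def]
    proof (rule leibniz_rule_vector_derivative)
      fix \<tau> show "(\<lambda>\<phi>. plane_wave p q (of_real \<phi> + \<i> * of_real \<tau>)) integrable_on cbox 0 (2*pi)"
        by (rule integrable_continuous, rule plane_wave_continuous) (intro continuous_intros)
    next
      show "continuous_on (UNIV \<times> cbox 0 (2*pi)) (\<lambda>(\<tau>, \<phi>). \<i> * plane_wave_diff p q (of_real \<phi> + \<i> * of_real \<tau>))"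
        unfolding split_beta by (rule plane_wave_continuous) (intro continuous_intros)
    qed (rule plane_wave_deriv_vertical UNIV_I convex_UNIV)+
    then show ?thesis using plane_wave_period_integral[where \<tau>=\<tau> and p=p and q=q] by (simp only: has_integral_iff)
  qed
  then obtain c where "\<And>\<tau>. \<tau> \<in> UNIV \<Longrightarrow> H \<tau> = c"
    by (rule has_vector_derivative_zero_constant[OF convex_UNIV]) blast
  from this[of \<tau>] this[of 0] have "H \<tau> = H 0" by (simp only: UNIV_I)
  then show ?thesis unfolding H_def by (simp only: cbox_interval of_real_0 mult_zero_right add_0_right)
qed

text \<open>This identity is what inverts the exponential transform. With \<open>sinh \<tau> = \<mu> / \<rho>\<close>, moving the angle by \<open>\<i> \<tau>\<close>
  turns the frequency \<open>\<rho>\<close> into \<open>sqrt (\<rho>\<^sup>2 + \<mu>\<^sup>2)\<close> and creates the exponential weight.\<close>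

lemma exponential_weight_shift:
  fixes z :: "real^2"
  assumes "\<rho> > 0"
  shows "integral {0..2*pi} (\<lambda>\<phi>. exp (- \<mu> * (z \<bullet> perp (circ \<phi>))) * cos ((z \<bullet> circ \<phi>) * sqrt (\<rho>\<^sup>2 + \<mu>\<^sup>2)))
    = integral {0..2*pi} (\<lambda>\<phi>. cos (\<rho> * (z \<bullet> circ \<phi>)))"
proof -
  (* The choice gives \<rho> sinh \<tau> = \<mu> and hence \<rho> cosh \<tau> = sqrt (\<rho>\<^sup>2 + \<mu>\<^sup>2). *)
  define \<tau> where "\<tau> = arsinh (\<mu> / \<rho>)"
  define r where "r = sqrt (\<rho>\<^sup>2 + \<mu>\<^sup>2)"
  have s: "\<rho> * sinh \<tau> = \<mu>" using assms by (simp add: \<tau>_def)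
  have "cosh \<tau> = sqrt (1 + (\<mu> / \<rho>)\<^sup>2)"
    by (rule real_sqrt_unique[symmetric]) (simp_all add: \<tau>_def cosh_square_eq)
  also have "\<dots> = r / \<rho>" 
    using assms by (simp add: r_def real_sqrt_divide[symmetric] real_sqrt_unique power_divide add_divide_distrib)
  finally have c: "\<rho> * cosh \<tau> = r" using assms by simp
  let ?p = "of_real (\<rho> * z $ 1) :: complex" and ?q = "of_real (\<rho> * z $ 2) :: complex"
  have hyp: "cos (\<i> * complex_of_real \<tau>) = of_real (cosh \<tau>)" "sin (\<i> * complex_of_real \<tau>) = \<i> * of_real (sinh \<tau>)"
    by (simp_all add: cosh_conv_cos[symmetric] sinh_conv_sin cosh_def sinh_def scaleR_conv_of_real exp_of_real[symmetric] exp_minus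
        sin_exp_eq field_simps)
  have eq: "plane_wave ?p ?q (of_real \<phi> + \<i> * of_real \<tau>) =
     of_real (exp (- \<mu> * (z \<bullet> perp (circ \<phi>)))) * cis ((z \<bullet> circ \<phi>) * r)" for \<phi>
  proof -
    have "\<i> * (?p * cos (of_real \<phi> + \<i> * of_real \<tau>) + ?q * sin (of_real \<phi> + \<i> * of_real \<tau>)) =
      of_real (- (\<rho> * sinh \<tau>) * (z \<bullet> perp (circ \<phi>))) + \<i> * of_real ((z \<bullet> circ \<phi>) * (\<rho> * cosh \<tau>))"
      unfolding cos_add sin_add hyp by (simp add: inner_2 algebra_simps cos_of_real sin_of_real)
    then show ?thesis unfolding plane_wave_def s c
      by (simp only: exp_add exp_of_real cis_conv_exp)
  qed
  have int: "(\<lambda>\<phi>. plane_wave ?p ?q (of_real \<phi> + \<i> * of_real \<tau>)) integrable_on {0..2*pi}" for \<tau>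
    unfolding plane_wave_def by (intro integrable_continuous_real continuous_intros)
  have "integral {0..2*pi} (\<lambda>\<phi>. Re (plane_wave ?p ?q (of_real \<phi> + \<i> * of_real \<tau>))) =
    integral {0..2*pi} (\<lambda>\<phi>. Re (plane_wave ?p ?q (of_real \<phi> + \<i> * of_real 0)))"
    using integral_linear[OF int bounded_linear_Re, of \<tau>] integral_linear[OF int bounded_linear_Re, of 0]
      plane_wave_shift[of ?p ?q \<tau>] by (simp add: comp_def)
  also have "(\<lambda>\<phi>. Re (plane_wave ?p ?q (of_real \<phi> + \<i> * of_real 0))) = (\<lambda>\<phi>. cos (\<rho> * (z \<bullet> circ \<phi>)))"
    by (rule ext) (simp add: plane_wave_def Re_exp inner_2 algebra_simps cos_of_real sin_of_real)
  finally show ?thesis unfolding eq by (simp add: r_def)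
qed

lemma integral_polar:
  fixes h :: "real^2 \<Rightarrow> real"
  assumes [measurable]: "integrable lborel h"
  shows "(\<integral>v. h v \<partial>lborel) = (\<integral>r. (\<integral>\<phi>. (r * indicator {0<..} r) * (indicator {0<..<2*pi} \<phi> * h (r *\<^sub>R circ \<phi>)) \<partial>lborel) \<partial>lborel)"
proof -
  have [measurable]: "h \<in> borel_measurable borel" using assms by simp
  define w :: "real^2 \<Rightarrow> real" where "w v = v $ 1 * indicator {0<..} (v $ 1) * indicator {0<..<2*pi} (v $ 2)" for v
  have [measurable]: "w \<in> borel_measurable borel" unfolding w_def[abs_def] by measurable
  have w: "ennreal (w v) = ennreal (v $ 1) * indicator {v. 0 < v $ 1 \<and> 0 < v $ 2 \<and> v $ 2 < 2 * pi} v" "0 \<le> w v" for v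
    by (auto simp: w_def indicator_def)
  have lb: "lborel = distr (density lborel w) borel polar"
    using lborel_polar by (simp only: w)
  have lc: "lborel = distr (lborel \<Otimes>\<^sub>M lborel) borel (\<lambda>(a, b). vector [a, b] :: real^2)"
    by (rule lborel_cartesian[symmetric])
  have "integrable (density lborel w) (\<lambda>v. h (polar v))"
    using assms by (subst (asm) lb, subst (asm) integrable_distr_eq) auto
  then have "integrable lborel (\<lambda>v. w v * h (polar v))"
    using w(2) by (subst (asm) integrable_density) auto
  then have int: "integrable (lborel \<Otimes>\<^sub>M lborel) (\<lambda>(r, \<phi>). w (vector [r, \<phi>]) * h (polar (vector [r, \<phi>])))"
    by (subst (asm) lc, subst (asm) integrable_distr_eq) (auto simp: case_prod_beta')
  have "(\<integral>v. h v \<partial>lborel) = (\<integral>v. h (polar v) \<partial>density lborel w)"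
    by (subst lb, subst integral_distr) auto
  also have "\<dots> = (\<integral>v. w v * h (polar v) \<partial>lborel)"
    using w(2) by (subst integral_density) auto
  also have "\<dots> = (\<integral>(r, \<phi>). w (vector [r, \<phi>]) * h (polar (vector [r, \<phi>])) \<partial>(lborel \<Otimes>\<^sub>M lborel))"
    by (subst lc, subst integral_distr) (auto simp: case_prod_beta')
  also have "\<dots> = (\<integral>r. (\<integral>\<phi>. w (vector [r, \<phi>]) * h (polar (vector [r, \<phi>])) \<partial>lborel) \<partial>lborel)"
    using lborel_pair.integral_fst'[OF int] by simp
  finally show ?thesis by (simp add: w_def polar_def mult.assoc)
qed

lemma integral_disc_cos:
  fixes z :: "real^2"
  assumes "0 < R"
  shows "integrable lborel (\<lambda>v. indicator (cball 0 R) v * cos (z \<bullet> v))"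
    "(\<integral>v. indicator (cball 0 R) v * cos (z \<bullet> v) \<partial>lborel) = integral {0..R} (\<lambda>\<rho>. \<rho> * integral {0..2*pi} (\<lambda>\<phi>. cos (\<rho> * (z \<bullet> circ \<phi>))))"
proof -
  show int: "integrable lborel (\<lambda>v. indicator (cball 0 R) v * cos (z \<bullet> v))"
    using borel_integrable_compact[OF compact_cball, of 0 R "\<lambda>v. cos (z \<bullet> v)"]
    by (simp add: continuous_on_cos continuous_on_inner)
  have circ_cont: "continuous_on A (\<lambda>x. cos (f x * (z \<bullet> circ (g x))))" if "continuous_on A f" "continuous_on A g"
    for A and f g :: "'a :: t2_space \<Rightarrow> real"
    unfolding inner_2 circ_nth by (intro continuous_intros that)
  have inner: "(\<integral>\<phi>. indicator {0<..<2*pi} \<phi> * cos (r * (z \<bullet> circ \<phi>)) \<partial>lborel) = integral {0..2*pi} (\<lambda>\<phi>. cos (r * (z \<bullet> circ \<phi>)))" for r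
  proof -
    have "(\<integral>\<phi>. indicator {0<..<2*pi} \<phi> * cos (r * (z \<bullet> circ \<phi>)) \<partial>lborel) = (LBINT \<phi>:{0..2*pi}. cos (r * (z \<bullet> circ \<phi>)))"
      unfolding set_lebesgue_integral_def
    proof (rule integral_cong_AE)
      have "AE \<phi> in lborel. \<phi> \<noteq> 0 \<and> \<phi> \<noteq> 2 * pi" using AE_lborel_singleton[of 0] AE_lborel_singleton[of "2*pi"] by eventually_elim simp
      then show "AE \<phi> in lborel. indicator {0<..<2*pi} \<phi> * cos (r * (z \<bullet> circ \<phi>)) = indicat_real {0..2*pi} \<phi> *\<^sub>R cos (r * (z \<bullet> circ \<phi>))"
        by eventually_elim (auto simp: indicator_def)
    qed auto
    also have "\<dots> = integral {0..2*pi} (\<lambda>\<phi>. cos (r * (z \<bullet> circ \<phi>)))"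
      by (intro set_borel_integral_eq_integral borel_integrable_atLeastAtMost' circ_cont continuous_intros)
    finally show ?thesis .
  qed
  have cont: "continuous_on {0..R} (\<lambda>\<rho>. integral {0..2*pi} (\<lambda>\<phi>. cos (\<rho> * (z \<bullet> circ \<phi>))))"
    using integral_continuous_on_param[of "{0..R}" 0 "2*pi" "\<lambda>\<rho> \<phi>. cos (\<rho> * (z \<bullet> circ \<phi>))"]
    by (simp add: split_beta circ_cont continuous_intros)
  have "(\<integral>v. indicator (cball 0 R) v * cos (z \<bullet> v) \<partial>lborel) = 
     (\<integral>r. (\<integral>\<phi>. (r * indicator {0<..} r) * (indicator {0<..<2*pi} \<phi> * (indicator (cball 0 R) (r *\<^sub>R circ \<phi>) * cos (z \<bullet> (r *\<^sub>R circ \<phi>)))) \<partial>lborel) \<partial>lborel)"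
    by (rule integral_polar[OF int])
  also have "\<dots> = (\<integral>r. (\<integral>\<phi>. (indicator {0..R} r * r) * (indicator {0<..<2*pi} \<phi> * cos (r * (z \<bullet> circ \<phi>))) \<partial>lborel) \<partial>lborel)"
    by (intro Bochner_Integration.integral_cong refl) (auto simp: indicator_def)
  also have "\<dots> = (LBINT r:{0..R}. r * integral {0..2*pi} (\<lambda>\<phi>. cos (r * (z \<bullet> circ \<phi>))))"
    unfolding set_lebesgue_integral_def integral_mult_right_zero inner by (simp add: mult.assoc)
  also have "\<dots> = integral {0..R} (\<lambda>\<rho>. \<rho> * integral {0..2*pi} (\<lambda>\<phi>. cos (\<rho> * (z \<bullet> circ \<phi>))))"
    by (intro set_borel_integral_eq_integral borel_integrable_atLeastAtMost' continuous_intros cont)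
  finally show "(\<integral>v. indicator (cball 0 R) v * cos (z \<bullet> v) \<partial>lborel) = integral {0..R} (\<lambda>\<rho>. \<rho> * integral {0..2*pi} (\<lambda>\<phi>. cos (\<rho> * (z \<bullet> circ \<phi>))))" .
qed

text \<open>For every radius \<open>\<rho>\<close> the angular average loses its exponential weight, and the remaining radial integral
  is the Fourier transform of a disc in polar coordinates.\<close>

lemma weighted_kern_average:
  fixes z :: "real^2"
  assumes "0 < \<delta>"
  shows "(LBINT \<phi>:{0..2*pi}. exp (- \<mu> * (z \<bullet> perp (circ \<phi>))) * kern \<mu> \<delta> (z \<bullet> circ \<phi>)) =
    (\<integral>v. indicator (cball 0 (1/\<delta>)) v * cos (z \<bullet> v) \<partial>lborel) / pi"
proof -
  let ?R = "1 / \<delta>"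
  let ?f = "\<lambda>\<phi> \<rho>. exp (- \<mu> * (z \<bullet> perp (circ \<phi>))) * (\<rho> * cos ((z \<bullet> circ \<phi>) * sqrt (\<rho>\<^sup>2 + \<mu>\<^sup>2)))"
  have cont: "continuous_on A (\<lambda>(\<phi>, \<rho>). ?f \<phi> \<rho>)" for A
    unfolding split_beta inner_2 circ_nth perp_nth by (intro continuous_intros)
  have kern: "kern \<mu> \<delta> s = integral {0..?R} (\<lambda>\<rho>. \<rho> * cos (s * sqrt (\<rho>\<^sup>2 + \<mu>\<^sup>2))) / pi" for s
    unfolding kern_radial[OF assms]
    by (subst set_borel_integral_eq_integral) (auto intro!: borel_integrable_atLeastAtMost' continuous_intros)
  have integrand: "exp (- \<mu> * (z \<bullet> perp (circ \<phi>))) * kern \<mu> \<delta> (z \<bullet> circ \<phi>) = integral {0..?R} (?f \<phi>) / pi" for \<phi>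
    unfolding kern by simp
  have ci: "continuous_on {0..2*pi} (\<lambda>\<phi>. integral {0..?R} (?f \<phi>))"
    using integral_continuous_on_param[of "{0..2*pi}" 0 ?R ?f] cont by simp
  have "(LBINT \<phi>:{0..2*pi}. exp (- \<mu> * (z \<bullet> perp (circ \<phi>))) * kern \<mu> \<delta> (z \<bullet> circ \<phi>)) = (LBINT \<phi>:{0..2*pi}. integral {0..?R} (?f \<phi>)) / pi"
    unfolding integrand by simp
  also have "(LBINT \<phi>:{0..2*pi}. integral {0..?R} (?f \<phi>)) = integral {0..2*pi} (\<lambda>\<phi>. integral {0..?R} (?f \<phi>))"
    by (intro set_borel_integral_eq_integral borel_integrable_atLeastAtMost' ci)
  also have "\<dots> = integral {0..?R} (\<lambda>\<rho>. integral {0..2*pi} (\<lambda>\<phi>. ?f \<phi> \<rho>))"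
    using integral_swap_continuous[of 0 0 "2*pi" ?R ?f] cont by simp
  also have "\<dots> = integral {0..?R} (\<lambda>\<rho>. \<rho> * integral {0..2*pi} (\<lambda>\<phi>. cos (\<rho> * (z \<bullet> circ \<phi>))))"
  proof (rule integral_cong)
    fix \<rho> assume "\<rho> \<in> {0..?R}"
    show "integral {0..2*pi} (\<lambda>\<phi>. ?f \<phi> \<rho>) = \<rho> * integral {0..2*pi} (\<lambda>\<phi>. cos (\<rho> * (z \<bullet> circ \<phi>)))"
    proof (cases "\<rho> = 0")
      case False
      then have "\<rho> > 0" using \<open>\<rho> \<in> {0..?R}\<close> by simp
      have "integral {0..2*pi} (\<lambda>\<phi>. ?f \<phi> \<rho>) = \<rho> * integral {0..2*pi} (\<lambda>\<phi>. exp (- \<mu> * (z \<bullet> perp (circ \<phi>))) * cos ((z \<bullet> circ \<phi>) * sqrt (\<rho>\<^sup>2 + \<mu>\<^sup>2)))"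
        by (subst integral_mult_right[symmetric]) (simp only: mult.left_commute)
      then show ?thesis using exponential_weight_shift[OF \<open>\<rho> > 0\<close>, of \<mu> z] by simp
    qed simp
  qed
  finally show ?thesis using integral_disc_cos(2)[of ?R z] assms by simp
qed

section \<open>Borel versions\<close>

definition supported_bounded :: "real \<Rightarrow> (real^2 \<Rightarrow> real) \<Rightarrow> bool" where
  "supported_bounded L g \<longleftrightarrow> g \<in> borel_measurable borel \<and> (\<forall>y. norm y > 1 \<longrightarrow> g y = 0) \<and> (\<forall>y. \<bar>g y\<bar> \<le> L)"

text \<open>A member of the class need not be Borel, and an arbitrary Borel version of it need not be continuous at
  \<open>x\<close>. Clipping such a version to the oscillation of \<open>f\<close> around \<open>x\<close> restores continuity there.\<close>

lemma continuous_borel_version: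
  fixes f :: "real^2 \<Rightarrow> real"
  assumes meas: "f \<in> borel_measurable lebesgue" and supp: "\<And>y. norm y > 1 \<Longrightarrow> f y = 0"
    and bound: "\<And>y. \<bar>f y\<bar> \<le> L" and cont: "isCont f x"
  obtains g where "supported_bounded L g" "AE y in lborel. f y = g y" "isCont g x" "g x = f x"
proof -
  obtain g0 where [measurable]: "g0 \<in> borel_measurable borel" and ae: "AE y in lborel. f y = g0 y"
    using completion_ex_borel_measurable_real[OF meas] by auto
  (* For negative radii the ball is empty and its supremum unspecified; max 0 r keeps w monotone,
     hence Borel. *)
  define w where "w r = (SUP y\<in>cball x (max 0 r). \<bar>f y - f x\<bar>)" for r :: real
  have bdd: "bdd_above ((\<lambda>y. \<bar>f y - f x\<bar>) ` S)" for S
    by (rule bdd_aboveI[of _ "2 * L"]) (use bound in \<open>auto intro!: order_trans[OF abs_triangle_ineq4] add_mono[of _ L _ L, simplified mult_2[symmetric]]\<close>)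
  have "mono w" unfolding w_def mono_def
    by (auto intro!: cSUP_subset_mono bdd simp: subset_iff)
  then have [measurable]: "w \<in> borel_measurable borel" by (rule borel_measurable_mono)
  have w_le: "\<bar>f y - f x\<bar> \<le> w (dist x y)" for y
    unfolding w_def by (rule cSUP_upper[OF _ bdd]) simp
  have w_small: "\<exists>d>0. \<forall>r<d. w r \<le> e" if "e > 0" for e
  proof -
    obtain d where d: "d > 0" "\<And>y. dist y x < d \<Longrightarrow> \<bar>f y - f x\<bar> < e"
      using cont \<open>e > 0\<close> unfolding continuous_at_eps_delta by (auto simp: dist_real_def)
    have "w r \<le> e" if "r < d" for r
      unfolding w_def
      by (rule cSUP_least) (use d that in \<open>auto simp: dist_commute intro!: less_imp_le d(2)\<close>)
    then show ?thesis using d(1) by blast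
  qed
  (* Almost everywhere the first two cases apply and g equals f. *)
  define g where "g y = (if norm y > 1 then 0 else if \<bar>g0 y\<bar> \<le> L \<and> \<bar>g0 y - f x\<bar> \<le> w (dist x y) then g0 y else f x)" for y
  have g1: "supported_bounded L g"
    unfolding supported_bounded_def
  proof (intro conjI allI impI)
    show "g \<in> borel_measurable borel" unfolding g_def[abs_def] by measurable
    show "\<bar>g y\<bar> \<le> L" for y using bound[of x] by (auto simp: g_def)
  qed (simp add: g_def)
  have g2: "AE y in lborel. f y = g y"
    using ae
  proof eventually_elim
    case (elim y)
    then show ?case using supp[of y] bound[of y] w_le[of y] by (simp add: g_def)
  qed
  have w0: "w r \<ge> 0" for r
    unfolding w_def by (rule cSUP_upper2[OF bdd, of x]) auto
  have gw: "\<bar>g y - f x\<bar> \<le> w (dist x y)" for y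
    using w_le[of y] supp[of y] w0[of "dist x y"] by (auto simp: g_def)
  have "w 0 \<le> e" if "e > 0" for e using w_small[OF that] by blast
  then have "w 0 \<le> 0" by (rule field_le_epsilon[of "w 0" 0, simplified])
  then have g4: "g x = f x" using gw[of x] by simp
  have g3: "isCont g x" unfolding continuous_at_eps_delta
  proof (intro allI impI)
    fix e :: real assume "e > 0"
    then obtain d where d: "d > 0" "\<And>r. r < d \<Longrightarrow> w r \<le> e / 2" using w_small[of "e / 2"] by auto
    show "\<exists>d>0. \<forall>y. dist y x < d \<longrightarrow> dist (g y) (g x) < e"
    proof (intro exI conjI allI impI)
      fix y assume "dist y x < d"
      then have "w (dist x y) \<le> e / 2" by (intro d) (simp add: dist_commute)
      then show "dist (g y) (g x) < e" using gw[of y] \<open>e > 0\<close> by (simp add: g4 dist_real_def)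
    qed (rule d)
  qed
  show ?thesis by (rule that[OF g1 g2 g3 g4])
qed

lemma supported_bounded_integrable:
  assumes "supported_bounded L g" shows "integrable lborel g"
proof (rule Bochner_Integration.integrable_bound)
  show "integrable lborel (\<lambda>y. indicator (cball 0 1) y * L :: real)"
    using borel_integrable_compact[OF compact_cball, of 0 1 "\<lambda>_. L"] by simp
  show "g \<in> borel_measurable lborel" using assms by (simp add: supported_bounded_def)
  show "AE y in lborel. norm (g y) \<le> norm (indicator (cball 0 1) y * L :: real)"
    using assms by (auto simp: supported_bounded_def indicator_def intro!: AE_I2 order_trans[OF _ abs_ge_self])
qed

lemma measurable_completion_cong_AE:
  assumes g: "g \<in> measurable M N" and ae: "AE x in M. f x = g x" and f: "f \<in> space M \<rightarrow> space N"
  shows "f \<in> measurable (completion M) N"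
proof (rule measurableI)
  fix A assume A: "A \<in> sets N"
  have [measurable]: "Measurable.pred (completion M) (\<lambda>x. g x \<in> A)"
    using measurable_sets[OF measurable_completion[OF g] A] by (simp add: pred_def vimage_def Int_def conj_commute)
  have [measurable]: "Measurable.pred (completion M) (\<lambda>x. g x \<in> A \<and> f x \<notin> A)"
    by (rule sets_completion_AE) (use ae in eventually_elim, auto)
  have [measurable]: "Measurable.pred (completion M) (\<lambda>x. f x \<in> A \<and> g x \<notin> A)"
    by (rule sets_completion_AE) (use ae in eventually_elim, auto)
  have "Measurable.pred (completion M) (\<lambda>x. (g x \<in> A \<and> \<not> (g x \<in> A \<and> f x \<notin> A)) \<or> (f x \<in> A \<and> g x \<notin> A))"
    by measurable
  also have "(\<lambda>x. (g x \<in> A \<and> \<not> (g x \<in> A \<and> f x \<notin> A)) \<or> (f x \<in> A \<and> g x \<notin> A)) = (\<lambda>x. f x \<in> A)"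
    by auto
  finally show "f -` A \<inter> space (completion M) \<in> sets (completion M)"
    by (simp add: pred_def vimage_def Int_def conj_commute)
qed (use f in auto)

lemma fourier_cong_AE:
  assumes "AE y in lborel. f y = g y" "g \<in> borel_measurable borel"
  shows "fourier f \<xi> = (\<integral>y. cis (- (y \<bullet> \<xi>)) * complex_of_real (g y) \<partial>lborel)"
proof -
  have [measurable]: "g \<in> borel_measurable borel" by fact
  have ae: "AE y in lebesgue. f y = g y" using AE_completion[OF assms(1)] .
  have m: "(\<lambda>y. cis (- (y \<bullet> \<xi>)) * complex_of_real (g y)) \<in> borel_measurable borel"
    unfolding cis_conv_exp by measurable
  then have ml: "(\<lambda>y. cis (- (y \<bullet> \<xi>)) * complex_of_real (g y)) \<in> borel_measurable lebesgue"
    by (intro measurable_completion) simp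
  have "fourier f \<xi> = (\<integral>y. cis (- (y \<bullet> \<xi>)) * complex_of_real (g y) \<partial>lebesgue)"
    unfolding fourier_def
  proof (rule integral_cong_AE)
    show e: "AE y in lebesgue. cis (- (y \<bullet> \<xi>)) * complex_of_real (f y) = cis (- (y \<bullet> \<xi>)) * complex_of_real (g y)"
      using ae by eventually_elim simp
    show "(\<lambda>y. cis (- (y \<bullet> \<xi>)) * complex_of_real (f y)) \<in> borel_measurable lebesgue"
      by (rule measurable_completion_cong_AE[OF _ AE_completion_iff[THEN iffD1, OF e]]) (use m in auto)
  qed (rule ml)
  also have "\<dots> = (\<integral>y. cis (- (y \<bullet> \<xi>)) * complex_of_real (g y) \<partial>lborel)"
    by (rule integral_completion) (use m in simp)
  finally show ?thesis .
qed

section \<open>Fourier inversion and the bias\<close>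

definition borel_fourier :: "(real^2 \<Rightarrow> real) \<Rightarrow> real^2 \<Rightarrow> complex" where
  "borel_fourier g \<xi> = (\<integral>y. cis (- (y \<bullet> \<xi>)) * complex_of_real (g y) \<partial>lborel)"

lemma borel_fourier_measurable [measurable]:
  assumes [measurable]: "g \<in> borel_measurable borel" shows "borel_fourier g \<in> borel_measurable borel"
  unfolding borel_fourier_def[abs_def] cis_conv_exp by measurable

text \<open>Fubini turns a multiplier on the frequency side into a convolution. A Gaussian multiplier gives Fourier
  inversion; the indicator of a disc gives the mean of the estimator.\<close>

lemma fourier_multiplier:
  fixes g h :: "real^2 \<Rightarrow> real"
  assumes g: "integrable lborel g" and h: "integrable lborel h"
  shows "(\<integral>\<xi>. h \<xi> * Re (cis (x \<bullet> \<xi>) * borel_fourier g \<xi>) \<partial>lborel) = (\<integral>y. g y * (\<integral>\<xi>. h \<xi> * cos ((x - y) \<bullet> \<xi>) \<partial>lborel) \<partial>lborel)"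
proof -
  have [measurable]: "g \<in> borel_measurable borel" "h \<in> borel_measurable borel" using g h by simp_all
  have intc: "integrable lborel (\<lambda>y. cis (- (y \<bullet> \<xi>)) * complex_of_real (g y))" for \<xi>
  proof (rule Bochner_Integration.integrable_bound[OF g])
    show "(\<lambda>y. cis (- (y \<bullet> \<xi>)) * complex_of_real (g y)) \<in> borel_measurable lborel"
      unfolding cis_conv_exp by measurable
  qed (simp add: norm_mult)
  have inner: "h \<xi> * Re (cis (x \<bullet> \<xi>) * borel_fourier g \<xi>) = (\<integral>y. g y * (h \<xi> * cos ((x - y) \<bullet> \<xi>)) \<partial>lborel)" for \<xi>
  proof -
    have "Re (cis (x \<bullet> \<xi>) * borel_fourier g \<xi>) = (\<integral>y. Re (cis (x \<bullet> \<xi>) * (cis (- (y \<bullet> \<xi>)) * complex_of_real (g y))) \<partial>lborel)"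
      unfolding borel_fourier_def
      by (subst integral_mult_right_zero[symmetric], subst integral_Re) (auto intro: intc)
    also have "(\<lambda>y. Re (cis (x \<bullet> \<xi>) * (cis (- (y \<bullet> \<xi>)) * complex_of_real (g y)))) = (\<lambda>y. g y * cos ((x - y) \<bullet> \<xi>))"
      by (auto simp: mult.assoc[symmetric] cis_mult inner_diff_left)
    finally show ?thesis by (simp add: mult.left_commute[of "g _"])
  qed
  have "integrable (lborel \<Otimes>\<^sub>M lborel) (\<lambda>(y, \<xi>). g y * (h \<xi> * cos ((x - y) \<bullet> \<xi>)))"
  proof (rule Bochner_Integration.integrable_bound)
    show "integrable (lborel \<Otimes>\<^sub>M lborel) (\<lambda>(y, \<xi>). g y * h \<xi>)"
    proof (rule lborel_pair.Fubini_integrable)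
      show "integrable lborel (\<lambda>y. \<integral>\<xi>. norm (case (y, \<xi>) of (y, \<xi>) \<Rightarrow> g y * h \<xi>) \<partial>lborel)"
        using g by (simp add: abs_mult)
      show "AE y in lborel. integrable lborel (\<lambda>\<xi>. case (y, \<xi>) of (y, \<xi>) \<Rightarrow> g y * h \<xi>)"
        using h by simp
    qed measurable
    show "AE p in lborel \<Otimes>\<^sub>M lborel. norm (case p of (y, \<xi>) \<Rightarrow> g y * (h \<xi> * cos ((x - y) \<bullet> \<xi>))) \<le> norm (case p of (y, \<xi>) \<Rightarrow> g y * h \<xi>)"
      by (intro AE_I2) (simp add: split_beta abs_mult mult.assoc[symmetric] mult_left_le)
  qed measurable
  from lborel_pair.Fubini_integral[OF this] show ?thesis
    unfolding inner by simp
qed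

lemma std_normal_cos_sin:
  shows "integrable lborel (\<lambda>t. std_normal_density t * cos (w * t))" "integrable lborel (\<lambda>t. std_normal_density t * sin (w * t))"
    "(LBINT t. std_normal_density t * cos (w * t)) = exp (- (w\<^sup>2) / 2)" "(LBINT t. std_normal_density t * sin (w * t)) = 0"
proof -
  have d: "integrable lborel std_normal_density" by (rule integrable_normal_density) simp
  show 1: "integrable lborel (\<lambda>t. std_normal_density t * cos (w * t))"
    by (rule Bochner_Integration.integrable_bound[OF d]) (auto simp: abs_mult intro!: mult_left_le)
  show 2: "integrable lborel (\<lambda>t. std_normal_density t * sin (w * t))"
    by (rule Bochner_Integration.integrable_bound[OF d]) (auto simp: abs_mult intro!: mult_left_le)
  have int: "integrable lborel (\<lambda>t. complex_of_real (std_normal_density t) * cis (w * t))"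
    by (rule Bochner_Integration.integrable_bound[OF d]) (auto simp: norm_mult cis_conv_exp)
  have "complex_of_real (exp (- (w\<^sup>2) / 2)) = char std_normal_distribution w"
    by (simp add: char_std_normal_distribution)
  also have "\<dots> = (CLBINT t. complex_of_real (std_normal_density t) * cis (w * t))"
    unfolding char_def by (subst integral_density) (auto simp: scaleR_conv_of_real cis_conv_exp)
  finally have eq: "(CLBINT t. complex_of_real (std_normal_density t) * cis (w * t)) = complex_of_real (exp (- (w\<^sup>2) / 2))" by simp
  show "(LBINT t. std_normal_density t * cos (w * t)) = exp (- (w\<^sup>2) / 2)"
    using arg_cong[OF eq, of Re] by (simp add: integral_Re[OF int, symmetric])
  show "(LBINT t. std_normal_density t * sin (w * t)) = 0"
    using arg_cong[OF eq, of Im] by (simp add: integral_Im[OF int, symmetric])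
qed

definition gauss2 :: "real^2 \<Rightarrow> real" where
  "gauss2 v = std_normal_density (v $ 1) * std_normal_density (v $ 2)"

lemma gauss2_measurable [measurable]: "gauss2 \<in> borel_measurable borel"
  unfolding gauss2_def[abs_def] by measurable

lemma gauss2_eq: "gauss2 v = exp (- ((norm v)\<^sup>2) / 2) / (2 * pi)"
proof -
  have "gauss2 v = exp (- ((v $ 1)\<^sup>2) / 2) * exp (- ((v $ 2)\<^sup>2) / 2) / (sqrt (2 * pi) * sqrt (2 * pi))"
    by (simp add: gauss2_def std_normal_density_def)
  also have "\<dots> = exp (- ((norm v)\<^sup>2) / 2) / (2 * pi)"
    by (simp only: exp_add[symmetric] norm_2_sq) (simp add: add_divide_distrib)
  finally show ?thesis .
qed

lemma gauss2_nonneg: "0 \<le> gauss2 v"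
  by (simp add: gauss2_eq)

lemma gauss2_fourier:
  "integrable lborel (\<lambda>v. gauss2 v * cos (w \<bullet> v))" "(\<integral>v. gauss2 v * cos (w \<bullet> v) \<partial>lborel) = exp (- ((norm w)\<^sup>2) / 2)"
proof -
  let ?n = std_normal_density
  let ?c = "\<lambda>i t. ?n t * cos (w $ i * t)" and ?s = "\<lambda>i t. ?n t * sin (w $ i * t)"
  have prod: "integrable (lborel \<Otimes>\<^sub>M lborel) (\<lambda>(a, b). f a * h b)" "(\<integral>(a, b). f a * h b \<partial>(lborel \<Otimes>\<^sub>M lborel)) = (LBINT a. f a) * (LBINT b. h b)"
    if f: "integrable lborel f" and h: "integrable lborel h" for f h :: "real \<Rightarrow> real"
  proof -
    have [measurable]: "f \<in> borel_measurable borel" "h \<in> borel_measurable borel" using f h by simp_all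
    show i: "integrable (lborel \<Otimes>\<^sub>M lborel) (\<lambda>(a, b). f a * h b)"
    proof (rule lborel_pair.Fubini_integrable)
      show "integrable lborel (\<lambda>y. \<integral>\<xi>. norm (case (y, \<xi>) of (y, \<xi>) \<Rightarrow> f y * h \<xi>) \<partial>lborel)"
        using f by (simp add: abs_mult)
      show "AE y in lborel. integrable lborel (\<lambda>\<xi>. case (y, \<xi>) of (y, \<xi>) \<Rightarrow> f y * h \<xi>)"
        using h by simp
    qed measurable
    show "(\<integral>(a, b). f a * h b \<partial>(lborel \<Otimes>\<^sub>M lborel)) = (LBINT a. f a) * (LBINT b. h b)"
      using lborel_pair.integral_fst'[OF i] by simp
  qed
  note c = std_normal_cos_sin(1)[of "w $ 1"] std_normal_cos_sin(1)[of "w $ 2"]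
  note s = std_normal_cos_sin(2)[of "w $ 1"] std_normal_cos_sin(2)[of "w $ 2"]
  have eq: "(\<lambda>p. gauss2 (case p of (a, b) \<Rightarrow> vector [a, b]) * cos (w \<bullet> (case p of (a, b) \<Rightarrow> vector [a, b]))) =
    (\<lambda>p. (case p of (a, b) \<Rightarrow> ?c 1 a * ?c 2 b) - (case p of (a, b) \<Rightarrow> ?s 1 a * ?s 2 b))"
    by (auto simp: fun_eq_iff gauss2_def inner_2 cos_add algebra_simps)
  have m: "(\<lambda>(a, b). vector [a, b] :: real^2) \<in> lborel \<Otimes>\<^sub>M lborel \<rightarrow>\<^sub>M borel" by measurable
  have m': "(\<lambda>v. gauss2 v * cos (w \<bullet> v)) \<in> borel_measurable borel" by measurable
  show "integrable lborel (\<lambda>v. gauss2 v * cos (w \<bullet> v))"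
    unfolding lborel_cartesian[symmetric] integrable_distr_eq[OF m m'] eq
    by (intro Bochner_Integration.integrable_diff prod(1)[OF c] prod(1)[OF s])
  have "(\<integral>v. gauss2 v * cos (w \<bullet> v) \<partial>lborel) = (\<integral>p. (case p of (a, b) \<Rightarrow> ?c 1 a * ?c 2 b) - (case p of (a, b) \<Rightarrow> ?s 1 a * ?s 2 b) \<partial>(lborel \<Otimes>\<^sub>M lborel))"
    unfolding lborel_cartesian[symmetric] integral_distr[OF m m'] eq ..
  also have "\<dots> = (LBINT t. ?c 1 t) * (LBINT t. ?c 2 t) - (LBINT t. ?s 1 t) * (LBINT t. ?s 2 t)"
    by (subst Bochner_Integration.integral_diff[OF prod(1)[OF c] prod(1)[OF s]]) (simp only: prod(2)[OF c] prod(2)[OF s])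
  also have "\<dots> = exp (- ((norm w)\<^sup>2) / 2)"
    unfolding std_normal_cos_sin(3,4) exp_add[symmetric] norm_2_sq mult_exp_exp by (simp add: add_divide_distrib)
  finally show "(\<integral>v. gauss2 v * cos (w \<bullet> v) \<partial>lborel) = exp (- ((norm w)\<^sup>2) / 2)" .
qed

lemma integral_affine_2:
  fixes f :: "real^2 \<Rightarrow> real"
  assumes [measurable]: "f \<in> borel_measurable borel" and "c \<noteq> 0"
  shows "(\<integral>y. f y \<partial>lborel) = c\<^sup>2 * (\<integral>u. f (t + c *\<^sub>R u) \<partial>lborel)"
    and "integrable lborel (\<lambda>u. f (t + c *\<^sub>R u)) \<Longrightarrow> integrable lborel f"
proof -
  have l: "lborel = density (distr lborel borel (\<lambda>x :: real^2. t + c *\<^sub>R x)) (\<lambda>_. c\<^sup>2)"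
    using lborel_affine[OF assms(2), of t] by simp
  show "(\<integral>y. f y \<partial>lborel) = c\<^sup>2 * (\<integral>u. f (t + c *\<^sub>R u) \<partial>lborel)"
    by (subst l, subst integral_density, simp, simp, simp, subst integral_distr) auto
  show "integrable lborel (\<lambda>u. f (t + c *\<^sub>R u)) \<Longrightarrow> integrable lborel f"
    by (subst l, subst integrable_density, simp, simp, simp, subst integrable_distr_eq) auto
qed

text \<open>Gaussian summation: the multiplier \<open>exp (- (\<bar>\<xi>\<bar> / k)\<^sup>2 / 2)\<close> corresponds to averaging \<open>g\<close> over a normal
  variable of scale \<open>1 / k\<close> around \<open>x\<close>. As \<open>k\<close> grows, one side tends to the full inversion integral by dominated
  convergence, the other to \<open>g x\<close> by continuity.\<close>

lemma fourier_inversion_at_continuity_point: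
  assumes sb: "supported_bounded L g" and F: "integrable lborel (borel_fourier g)" and cont: "isCont g x"
  shows "(\<integral>\<xi>. Re (cis (x \<bullet> \<xi>) * borel_fourier g \<xi>) \<partial>lborel) = (2 * pi)\<^sup>2 * g x"
proof -
  have [measurable]: "g \<in> borel_measurable borel" and gL: "\<bar>g y\<bar> \<le> L" for y using sb by (simp_all add: supported_bounded_def)
  have [measurable]: "(\<lambda>\<xi>. cis (x \<bullet> \<xi>)) \<in> borel_measurable borel" unfolding cis_conv_exp by measurable
  define h where "h k \<xi> = 2 * pi * gauss2 ((1 / real (Suc k)) *\<^sub>R \<xi>)" for k \<xi>
  have h_eq: "h k \<xi> = exp (- ((norm \<xi> * (1 / real (Suc k)))\<^sup>2) / 2)" for k \<xi>
    unfolding h_def gauss2_eq norm_scaleR by (simp del: of_nat_Suc)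
  have [measurable]: "h k \<in> borel_measurable borel" for k unfolding h_def[abs_def] by measurable
  have hcos: "integrable lborel (\<lambda>\<xi>. h k \<xi> * cos (z \<bullet> \<xi>))" "(\<integral>\<xi>. h k \<xi> * cos (z \<bullet> \<xi>) \<partial>lborel) = (2 * pi)\<^sup>2 * (real (Suc k))\<^sup>2 * gauss2 (real (Suc k) *\<^sub>R z)" for k z
  proof -
    have e: "h k (0 + real (Suc k) *\<^sub>R u) * cos (z \<bullet> (0 + real (Suc k) *\<^sub>R u)) = 2 * pi * (gauss2 u * cos ((real (Suc k) *\<^sub>R z) \<bullet> u))" for u
      by (simp add: h_def del: of_nat_Suc)
    have i: "integrable lborel (\<lambda>u. h k (0 + real (Suc k) *\<^sub>R u) * cos (z \<bullet> (0 + real (Suc k) *\<^sub>R u)))"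
      unfolding e by (intro integrable_mult_right gauss2_fourier(1))
    show "integrable lborel (\<lambda>\<xi>. h k \<xi> * cos (z \<bullet> \<xi>))"
      by (rule integral_affine_2(2)[OF _ _ i]) auto
    have "(\<integral>\<xi>. h k \<xi> * cos (z \<bullet> \<xi>) \<partial>lborel) = (real (Suc k))\<^sup>2 * (\<integral>u. h k (0 + real (Suc k) *\<^sub>R u) * cos (z \<bullet> (0 + real (Suc k) *\<^sub>R u)) \<partial>lborel)"
      by (rule integral_affine_2(1)) auto
    also have "\<dots> = (real (Suc k))\<^sup>2 * (2 * pi * exp (- ((norm (real (Suc k) *\<^sub>R z))\<^sup>2) / 2))"
      unfolding e integral_mult_right_zero gauss2_fourier(2) ..
    also have "\<dots> = (2 * pi)\<^sup>2 * (real (Suc k))\<^sup>2 * gauss2 (real (Suc k) *\<^sub>R z)"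
      by (simp add: gauss2_eq power2_eq_square)
    finally show "(\<integral>\<xi>. h k \<xi> * cos (z \<bullet> \<xi>) \<partial>lborel) = (2 * pi)\<^sup>2 * (real (Suc k))\<^sup>2 * gauss2 (real (Suc k) *\<^sub>R z)" .
  qed
  have hint: "integrable lborel (h k)" for k using hcos(1)[of k 0] by simp
  have smoothed: "(\<integral>\<xi>. h k \<xi> * Re (cis (x \<bullet> \<xi>) * borel_fourier g \<xi>) \<partial>lborel) = (2 * pi)\<^sup>2 * (\<integral>u. g (x + (1 / real (Suc k)) *\<^sub>R u) * gauss2 u \<partial>lborel)" for k
  proof -
    have "(\<integral>\<xi>. h k \<xi> * Re (cis (x \<bullet> \<xi>) * borel_fourier g \<xi>) \<partial>lborel) = (\<integral>y. g y * ((2 * pi)\<^sup>2 * (real (Suc k))\<^sup>2 * gauss2 (real (Suc k) *\<^sub>R (x - y))) \<partial>lborel)"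
      unfolding fourier_multiplier[OF supported_bounded_integrable[OF sb] hint] hcos(2) ..
    also have "\<dots> = (1 / real (Suc k))\<^sup>2 * (\<integral>u. g (x + (1 / real (Suc k)) *\<^sub>R u) * ((2 * pi)\<^sup>2 * (real (Suc k))\<^sup>2 * gauss2 (real (Suc k) *\<^sub>R (x - (x + (1 / real (Suc k)) *\<^sub>R u)))) \<partial>lborel)"
      by (rule integral_affine_2(1)) auto
    also have "\<dots> = (2 * pi)\<^sup>2 * (\<integral>u. g (x + (1 / real (Suc k)) *\<^sub>R u) * gauss2 u \<partial>lborel)"
    proof -
      have "gauss2 (real (Suc k) *\<^sub>R (x - (x + (1 / real (Suc k)) *\<^sub>R u))) = gauss2 u" for u
        by (simp add: gauss2_eq)
      then have "(\<integral>u. g (x + (1 / real (Suc k)) *\<^sub>R u) * ((2 * pi)\<^sup>2 * (real (Suc k))\<^sup>2 * gauss2 (real (Suc k) *\<^sub>R (x - (x + (1 / real (Suc k)) *\<^sub>R u)))) \<partial>lborel)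
        = (\<integral>u. ((2 * pi)\<^sup>2 * (real (Suc k))\<^sup>2) * (g (x + (1 / real (Suc k)) *\<^sub>R u) * gauss2 u) \<partial>lborel)"
        by (simp only: mult_ac)
      then show ?thesis by (simp add: power_divide del: of_nat_Suc)
    qed
    finally show ?thesis .
  qed
  have inv0: "(\<lambda>k. 1 / real (Suc k)) \<longlonglongrightarrow> 0" using LIMSEQ_inverse_real_of_nat unfolding inverse_eq_divide .
  have lim1: "(\<lambda>k. \<integral>\<xi>. h k \<xi> * Re (cis (x \<bullet> \<xi>) * borel_fourier g \<xi>) \<partial>lborel) \<longlonglongrightarrow> (\<integral>\<xi>. Re (cis (x \<bullet> \<xi>) * borel_fourier g \<xi>) \<partial>lborel)"
  proof (rule integral_dominated_convergence)
    show "integrable lborel (\<lambda>\<xi>. cmod (borel_fourier g \<xi>))" using F by simp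
    show "AE \<xi> in lborel. (\<lambda>k. h k \<xi> * Re (cis (x \<bullet> \<xi>) * borel_fourier g \<xi>)) \<longlonglongrightarrow> Re (cis (x \<bullet> \<xi>) * borel_fourier g \<xi>)"
    proof (rule AE_I2)
      fix \<xi> :: "real^2"
      have "(\<lambda>k. exp (- ((norm \<xi> * (1 / real (Suc k)))\<^sup>2) / 2)) \<longlonglongrightarrow> exp (- ((norm \<xi> * 0)\<^sup>2) / 2)"
        by (intro tendsto_intros inv0) simp
      then have "(\<lambda>k. h k \<xi>) \<longlonglongrightarrow> 1" by (simp only: h_eq mult_zero_right power_zero_numeral minus_zero div_0 exp_zero)
      from tendsto_mult_right[OF this] show "(\<lambda>k. h k \<xi> * Re (cis (x \<bullet> \<xi>) * borel_fourier g \<xi>)) \<longlonglongrightarrow> Re (cis (x \<bullet> \<xi>) * borel_fourier g \<xi>)"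
        by simp
    qed
    show "AE \<xi> in lborel. norm (h k \<xi> * Re (cis (x \<bullet> \<xi>) * borel_fourier g \<xi>)) \<le> cmod (borel_fourier g \<xi>)" for k
    proof (rule AE_I2)
      fix \<xi> :: "real^2"
      have "\<bar>h k \<xi>\<bar> * \<bar>Re (cis (x \<bullet> \<xi>) * borel_fourier g \<xi>)\<bar> \<le> 1 * cmod (cis (x \<bullet> \<xi>) * borel_fourier g \<xi>)"
        by (intro mult_mono abs_Re_le_cmod) (auto simp: h_eq)
      then show "norm (h k \<xi> * Re (cis (x \<bullet> \<xi>) * borel_fourier g \<xi>)) \<le> cmod (borel_fourier g \<xi>)"
        by (simp add: abs_mult norm_mult del: times_complex.simps)
    qed
  qed (auto simp del: times_complex.simps)
  have lim2: "(\<lambda>k. \<integral>u. g (x + (1 / real (Suc k)) *\<^sub>R u) * gauss2 u \<partial>lborel) \<longlonglongrightarrow> (\<integral>u. g x * gauss2 u \<partial>lborel)"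
  proof (rule integral_dominated_convergence)
    show "integrable lborel (\<lambda>u. L * gauss2 u)" using gauss2_fourier(1)[of 0] by simp
    show "AE u in lborel. (\<lambda>k. g (x + (1 / real (Suc k)) *\<^sub>R u) * gauss2 u) \<longlonglongrightarrow> g x * gauss2 u"
    proof (rule AE_I2)
      fix u :: "real^2"
      have "(\<lambda>k. x + (1 / real (Suc k)) *\<^sub>R u) \<longlonglongrightarrow> x + 0 *\<^sub>R u" by (intro tendsto_intros inv0)
      then have "(\<lambda>k. x + (1 / real (Suc k)) *\<^sub>R u) \<longlonglongrightarrow> x" by simp
      from isCont_tendsto_compose[OF cont this] 
      show "(\<lambda>k. g (x + (1 / real (Suc k)) *\<^sub>R u) * gauss2 u) \<longlonglongrightarrow> g x * gauss2 u" by (rule tendsto_mult_right)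
    qed
    show "AE u in lborel. norm (g (x + (1 / real (Suc k)) *\<^sub>R u) * gauss2 u) \<le> L * gauss2 u" for k
      using gL by (auto simp: abs_mult gauss2_nonneg intro!: mult_right_mono)
  qed auto
  have "(\<integral>u. g x * gauss2 u \<partial>lborel) = g x" using gauss2_fourier(2)[of 0] by simp
  with tendsto_mult_left[OF lim2, of "(2 * pi)\<^sup>2"]
  have "(\<lambda>k. \<integral>\<xi>. h k \<xi> * Re (cis (x \<bullet> \<xi>) * borel_fourier g \<xi>) \<partial>lborel) \<longlonglongrightarrow> (2 * pi)\<^sup>2 * g x"
    by (simp only: smoothed)
  from LIMSEQ_unique[OF lim1 this] show ?thesis .
qed


lemma sobolev_weight_tail:
  assumes b: "\<beta> > 1" and R: "R > 0"
  shows "(\<integral>\<^sup>+\<xi>. ennreal ((1 + (norm (\<xi> :: real^2))\<^sup>2) powr (-\<beta>)) * indicator {\<xi>. R < norm \<xi>} \<xi> \<partial>lborel)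
    \<le> ennreal (pi / (\<beta> - 1) * R powr (2 - 2 * \<beta>))"
proof -
  let ?f = "\<lambda>r::real. r powr (1 - 2 * \<beta>)"
  have radial: "(\<integral>\<^sup>+r. ennreal (?f r) * indicator {R..} r \<partial>lborel) = ennreal (0 - (- (R powr (2 - 2 * \<beta>) / (2 * \<beta> - 2))))"
  proof (rule nn_integral_FTC_atLeast[where F="\<lambda>r. - (r powr (2 - 2 * \<beta>) / (2 * \<beta> - 2))"])
    fix r assume "R \<le> r"
    then show "((\<lambda>r. - (r powr (2 - 2 * \<beta>) / (2 * \<beta> - 2))) has_real_derivative ?f r) (at r)"
    proof -
      have "((\<lambda>r. - (r powr (2 - 2 * \<beta>) / (2 * \<beta> - 2))) has_real_derivative
          - ((2 - 2 * \<beta>) * r powr (2 - 2 * \<beta> - 1) / (2 * \<beta> - 2))) (at r)"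
        using \<open>R \<le> r\<close> R by (intro DERIV_minus DERIV_cdivide has_real_derivative_powr) simp
      also have "- ((2 - 2 * \<beta>) * r powr (2 - 2 * \<beta> - 1) / (2 * \<beta> - 2)) = ?f r"
      proof -
        have "2 - 2 * \<beta> = - (2 * \<beta> - 2)" "2 - 2 * \<beta> - 1 = 1 - 2 * \<beta>" by simp_all
        then show ?thesis using b by (simp only: mult_minus_left minus_divide_left minus_minus) simp
      qed
      finally show ?thesis .
    qed
  next
    show "((\<lambda>r. - (r powr (2 - 2 * \<beta>) / (2 * \<beta> - 2))) \<longlongrightarrow> 0) at_top"
      using b by real_asymp
  qed auto
  have pw: "ennreal r * indicator {0<..} r * (\<integral>\<^sup>+\<phi>. (ennreal ((1 + (norm (r *\<^sub>R circ \<phi>))\<^sup>2) powr (-\<beta>)) * indicator {\<xi>. R < norm \<xi>} (r *\<^sub>R circ \<phi>)) * indicator {0<..<2*pi} \<phi> \<partial>lborel)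
      \<le> ennreal (2 * pi) * (ennreal (?f r) * indicator {R..} r)" for r
  proof (cases "r > R")
    case True
    then have r: "r > 0" using R by simp
    have "(\<integral>\<^sup>+\<phi>. (ennreal ((1 + (norm (r *\<^sub>R circ \<phi>))\<^sup>2) powr (-\<beta>)) * indicator {\<xi>. R < norm \<xi>} (r *\<^sub>R circ \<phi>)) * indicator {0<..<2*pi} \<phi> \<partial>lborel)
      = (\<integral>\<^sup>+\<phi>. ennreal ((1 + r\<^sup>2) powr (-\<beta>)) * indicator {0<..<2*pi} \<phi> \<partial>lborel)"
      using True r by (intro nn_integral_cong) (simp add: indicator_def)
    also have "\<dots> = ennreal ((1 + r\<^sup>2) powr (-\<beta>)) * ennreal (2 * pi)"
      by (simp add: nn_integral_cmult_indicator)
    finally have I: "(\<integral>\<^sup>+\<phi>. (ennreal ((1 + (norm (r *\<^sub>R circ \<phi>))\<^sup>2) powr (-\<beta>)) * indicator {\<xi>. R < norm \<xi>} (r *\<^sub>R circ \<phi>)) * indicator {0<..<2*pi} \<phi> \<partial>lborel) = ennreal ((1 + r\<^sup>2) powr (-\<beta>)) * ennreal (2 * pi)" .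
    have "r * (1 + r\<^sup>2) powr (-\<beta>) \<le> r * (r\<^sup>2) powr (-\<beta>)"
      using r b by (intro mult_left_mono powr_mono2') auto
    also have "(r\<^sup>2) powr (-\<beta>) = r powr (2 * (-\<beta>))"
      using r powr_powr[of r 2 "-\<beta>"] by (simp add: powr_numeral)
    also have "r * r powr (2 * (-\<beta>)) = ?f r"
      using r powr_add[of r 1 "2 * (-\<beta>)"] by simp
    finally have "r * (1 + r\<^sup>2) powr (-\<beta>) \<le> ?f r" .
    then have "ennreal (r * (1 + r\<^sup>2) powr (-\<beta>)) * ennreal (2 * pi) \<le> ennreal (?f r) * ennreal (2 * pi)"
      by (intro mult_right_mono ennreal_leI) auto
    then show ?thesis unfolding I using True r by (simp add: ennreal_mult mult_ac)
  next
    case False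
    have "indicator {0<..} r * (indicator {\<xi>. R < norm \<xi>} (r *\<^sub>R circ \<phi>) :: ennreal) = 0" for \<phi>
      using False by (auto simp: indicator_def)
    then have "ennreal r * indicator {0<..} r * (\<integral>\<^sup>+\<phi>. (ennreal ((1 + (norm (r *\<^sub>R circ \<phi>))\<^sup>2) powr (-\<beta>)) * indicator {\<xi>. R < norm \<xi>} (r *\<^sub>R circ \<phi>)) * indicator {0<..<2*pi} \<phi> \<partial>lborel) = 0"
      using False by (cases "r > 0") (auto simp: indicator_def)
    then show ?thesis by (simp only: zero_le)
  qed
  have "(\<integral>\<^sup>+\<xi>. ennreal ((1 + (norm (\<xi> :: real^2))\<^sup>2) powr (-\<beta>)) * indicator {\<xi>. R < norm \<xi>} \<xi> \<partial>lborel) \<le> (\<integral>\<^sup>+r. ennreal (2 * pi) * (ennreal (?f r) * indicator {R..} r) \<partial>lborel)"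
    by (subst nn_integral_polar, measurable) (rule nn_integral_mono, rule pw)
  also have "\<dots> = ennreal (2 * pi) * ennreal (R powr (2 - 2 * \<beta>) / (2 * \<beta> - 2))"
    by (subst nn_integral_cmult) (simp_all only: radial, simp_all)
  also have "\<dots> = ennreal (2 * pi * (R powr (2 - 2 * \<beta>) / (2 * \<beta> - 2)))"
    using b by (subst ennreal_mult) auto
  also have "2 * pi * (R powr (2 - 2 * \<beta>) / (2 * \<beta> - 2)) = pi / (\<beta> - 1) * R powr (2 - 2 * \<beta>)"
    using b by (simp add: field_simps)
  finally show ?thesis .
qed

definition bias_const :: "real \<Rightarrow> real \<Rightarrow> real" where
  "bias_const \<beta> C = (C + pi / (\<beta> - 1)) / 2"

text \<open>The inequality \<open>2 \<bar>F\<bar> \<le> t W \<bar>F\<bar>\<^sup>2 + 1 / (t W)\<close> with the Sobolev weight \<open>W\<close> takes the role of the Cauchy-Schwarz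
  inequality; \<open>t\<close> balances the two integrals.\<close>

lemma fourier_tail:
  fixes F :: "real^2 \<Rightarrow> complex"
  assumes b: "\<beta> > 1" and R: "R > 0" and C: "C > 0" and [measurable]: "F \<in> borel_measurable borel"
    and sob: "(\<integral>\<^sup>+\<xi>. ennreal ((1 + (norm \<xi>)\<^sup>2) powr \<beta> * (cmod (F \<xi>))\<^sup>2) \<partial>lborel) \<le> ennreal C"
  shows "(\<integral>\<^sup>+\<xi>. ennreal (cmod (F \<xi>)) * indicator {\<xi>. R < norm \<xi>} \<xi> \<partial>lborel) \<le> ennreal (bias_const \<beta> C * R powr (1 - \<beta>))"
proof -
  define t where "t = R powr (1 - \<beta>)"
  have t: "t > 0" using R by (simp add: t_def)
  have pw: "ennreal (cmod (F \<xi>)) * indicator {\<xi>. R < norm \<xi>} \<xi> \<le> ennreal (t / 2) * ennreal ((1 + (norm \<xi>)\<^sup>2) powr \<beta> * (cmod (F \<xi>))\<^sup>2)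
      + ennreal (1 / (2 * t)) * (ennreal ((1 + (norm \<xi>)\<^sup>2) powr (-\<beta>)) * indicator {\<xi>. R < norm \<xi>} \<xi>)" for \<xi>
  proof (cases "R < norm \<xi>")
    case True
    define w where "w = (1 + (norm \<xi>)\<^sup>2) powr \<beta>"
    have "0 < 1 + (norm \<xi>)\<^sup>2" by (rule add_pos_nonneg) auto
    then have w: "w > 0" unfolding w_def by simp
    have wi: "(1 + (norm \<xi>)\<^sup>2) powr (-\<beta>) = 1 / w" by (simp add: w_def powr_minus_divide)
    have "0 \<le> (t * w * cmod (F \<xi>) - 1)\<^sup>2" by simp
    then have "2 * (t * w) * cmod (F \<xi>) \<le> (t * w)\<^sup>2 * (cmod (F \<xi>))\<^sup>2 + 1" by (simp add: power2_eq_square algebra_simps)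
    then have "cmod (F \<xi>) \<le> t / 2 * (w * (cmod (F \<xi>))\<^sup>2) + 1 / (2 * t) * (1 / w)"
      using t w by (simp add: field_simps power2_eq_square)
    then have "ennreal (cmod (F \<xi>)) \<le> ennreal (t / 2 * (w * (cmod (F \<xi>))\<^sup>2) + 1 / (2 * t) * (1 / w))" by (rule ennreal_leI)
    also have "\<dots> = ennreal (t / 2) * ennreal (w * (cmod (F \<xi>))\<^sup>2) + ennreal (1 / (2 * t)) * ennreal (1 / w)"
      using t w by (simp only: ennreal_plus[symmetric] ennreal_mult[symmetric] zero_le_mult_iff zero_le_divide_iff less_imp_le zero_le_numeral zero_le_one zero_le_power2 simp_thms)
    finally show ?thesis using True by (simp only: wi w_def[symmetric]) simp
  qed simp
  have "(\<integral>\<^sup>+\<xi>. ennreal (cmod (F \<xi>)) * indicator {\<xi>. R < norm \<xi>} \<xi> \<partial>lborel) \<le>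
    ennreal (t / 2) * (\<integral>\<^sup>+\<xi>. ennreal ((1 + (norm \<xi>)\<^sup>2) powr \<beta> * (cmod (F \<xi>))\<^sup>2) \<partial>lborel) +
    ennreal (1 / (2 * t)) * (\<integral>\<^sup>+\<xi>. ennreal ((1 + (norm (\<xi> :: real^2))\<^sup>2) powr (-\<beta>)) * indicator {\<xi>. R < norm \<xi>} \<xi> \<partial>lborel)"
    by (rule order_trans[OF nn_integral_mono[OF pw]]) (simp add: nn_integral_add nn_integral_cmult)
  also have "\<dots> \<le> ennreal (t / 2) * ennreal C + ennreal (1 / (2 * t)) * ennreal (pi / (\<beta> - 1) * R powr (2 - 2 * \<beta>))"
    by (intro add_mono mult_left_mono sob sobolev_weight_tail b R) auto
  also have "\<dots> = ennreal (t / 2 * C + 1 / (2 * t) * (pi / (\<beta> - 1) * R powr (2 - 2 * \<beta>)))"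
  proof -
    have 1: "ennreal (t / 2) * ennreal C = ennreal (t / 2 * C)" using t C by (intro ennreal_mult[symmetric]) auto
    have 2: "ennreal (1 / (2 * t)) * ennreal (pi / (\<beta> - 1) * R powr (2 - 2 * \<beta>)) = ennreal (1 / (2 * t) * (pi / (\<beta> - 1) * R powr (2 - 2 * \<beta>)))"
      using t b by (intro ennreal_mult[symmetric]) auto
    show ?thesis unfolding 1 2 using t C b by (intro ennreal_plus[symmetric]) auto
  qed
  also have "R powr (2 - 2 * \<beta>) = t * t" using R by (simp add: t_def powr_add[symmetric])
  also have "t / 2 * C + 1 / (2 * t) * (pi / (\<beta> - 1) * (t * t)) = bias_const \<beta> C * t"
  proof -
    have "t / 2 * C + 1 / (2 * t) * (k * (t * t)) = (C + k) / 2 * t" for k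
      using t by (simp add: field_simps)
    then show ?thesis by (simp only: bias_const_def)
  qed
  finally show ?thesis unfolding t_def .
qed

text \<open>The Fourier inversion integral truncated at frequency \<open>R\<close>.\<close>

definition band_limited :: "real \<Rightarrow> (real^2 \<Rightarrow> real) \<Rightarrow> real^2 \<Rightarrow> real" where
  "band_limited R g x = (\<integral>\<xi>. indicator (cball 0 R) \<xi> * Re (cis (x \<bullet> \<xi>) * borel_fourier g \<xi>) \<partial>lborel) / (2 * pi)\<^sup>2"

lemma borel_fourier_bound:
  assumes "integrable lborel g" shows "cmod (borel_fourier g \<xi>) \<le> (\<integral>y. \<bar>g y\<bar> \<partial>lborel)"
proof -
  have "cmod (borel_fourier g \<xi>) \<le> (\<integral>y. cmod (cis (- (y \<bullet> \<xi>)) * complex_of_real (g y)) \<partial>lborel)"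
    unfolding borel_fourier_def by (rule integral_norm_bound)
  then show ?thesis by (simp add: norm_mult)
qed

lemma band_limited_bias:
  assumes b: "\<beta> > 1" and C: "C > 0" and R: "R \<ge> 1" and sb: "supported_bounded L g" and cont: "isCont g x"
    and sob: "(\<integral>\<^sup>+\<xi>. ennreal ((1 + (norm \<xi>)\<^sup>2) powr \<beta> * (cmod (borel_fourier g \<xi>))\<^sup>2) \<partial>lborel) \<le> ennreal C"
  shows "\<bar>band_limited R g x - g x\<bar> \<le> bias_const \<beta> C * R powr (1 - \<beta>)"
proof -
  have gm [measurable]: "g \<in> borel_measurable borel" using sb by (simp add: supported_bounded_def)
  have [measurable]: "borel_fourier g \<in> borel_measurable borel" by measurable
  have [measurable]: "cball (0 :: real^2) R \<in> sets borel" by simp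
  let ?F = "borel_fourier g"
  let ?T = "{\<xi> :: real^2. R < norm \<xi>}"
  have R0: "R > 0" using R by simp
  note tail = fourier_tail[OF b R0 C borel_fourier_measurable[OF gm] sob]
  have tail_int: "integrable lborel (\<lambda>\<xi>. indicator ?T \<xi> * cmod (?F \<xi>))"
  proof (rule integrableI_bounded)
    have "(\<integral>\<^sup>+\<xi>. ennreal (norm (indicator ?T \<xi> * cmod (?F \<xi>))) \<partial>lborel) = (\<integral>\<^sup>+\<xi>. ennreal (cmod (?F \<xi>)) * indicator ?T \<xi> \<partial>lborel)"
      by (intro nn_integral_cong) (auto simp: indicator_def)
    also have "\<dots> < \<infinity>" using le_less_trans[OF tail ennreal_less_top] by simp
    finally show "(\<integral>\<^sup>+\<xi>. ennreal (norm (indicator ?T \<xi> * cmod (?F \<xi>))) \<partial>lborel) < \<infinity>" .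
  qed measurable
  have ball_int: "integrable lborel (\<lambda>\<xi>. indicator (cball 0 R) \<xi> * cmod (?F \<xi>))"
  proof (rule Bochner_Integration.integrable_bound)
    show "integrable lborel (\<lambda>\<xi>. indicator (cball 0 R) \<xi> *\<^sub>R (\<integral>y. \<bar>g y\<bar> \<partial>lborel))"
      by (rule borel_integrable_compact) auto
    show "AE \<xi> in lborel. norm (indicator (cball 0 R) \<xi> * cmod (?F \<xi>)) \<le> norm (indicator (cball 0 R) \<xi> *\<^sub>R (\<integral>y. \<bar>g y\<bar> \<partial>lborel))"
      using borel_fourier_bound[OF supported_bounded_integrable[OF sb]]
      by (intro AE_I2) (auto simp: indicator_def intro: order_trans[OF _ abs_ge_self])
  qed measurable
  have "integrable lborel (\<lambda>\<xi>. indicator (cball 0 R) \<xi> * cmod (?F \<xi>) + indicator ?T \<xi> * cmod (?F \<xi>))"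
    by (rule Bochner_Integration.integrable_add[OF ball_int tail_int])
  also have "(\<lambda>\<xi>. indicator (cball 0 R) \<xi> * cmod (?F \<xi>) + indicator ?T \<xi> * cmod (?F \<xi>)) = (\<lambda>\<xi>. cmod (?F \<xi>))"
    by (auto simp: indicator_def)
  finally have F_int: "integrable lborel ?F"
    by (subst (asm) integrable_norm_iff) measurable
  have re: "integrable lborel (\<lambda>\<xi>. Re (cis (x \<bullet> \<xi>) * ?F \<xi>))"
  proof (rule integrable_Re, rule Bochner_Integration.integrable_bound[OF F_int])
    show "(\<lambda>\<xi>. cis (x \<bullet> \<xi>) * ?F \<xi>) \<in> borel_measurable lborel"
      unfolding cis_conv_exp by measurable
  qed (simp add: norm_mult)
  have re_in: "integrable lborel (\<lambda>\<xi>. indicator (cball 0 R) \<xi> * Re (cis (x \<bullet> \<xi>) * ?F \<xi>))"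
    using integrable_real_mult_indicator[OF _ re, of "cball 0 R"] by (simp add: mult.commute del: times_complex.simps)
  have re_out: "integrable lborel (\<lambda>\<xi>. indicator ?T \<xi> * Re (cis (x \<bullet> \<xi>) * ?F \<xi>))"
    using integrable_real_mult_indicator[OF _ re, of ?T] by (simp add: mult.commute del: times_complex.simps)
  have "(2 * pi)\<^sup>2 * g x = (\<integral>\<xi>. Re (cis (x \<bullet> \<xi>) * ?F \<xi>) \<partial>lborel)"
    by (rule fourier_inversion_at_continuity_point[OF sb F_int cont, symmetric])
  also have "(\<lambda>\<xi>. Re (cis (x \<bullet> \<xi>) * ?F \<xi>)) = (\<lambda>\<xi>. indicator (cball 0 R) \<xi> * Re (cis (x \<bullet> \<xi>) * ?F \<xi>) + indicator ?T \<xi> * Re (cis (x \<bullet> \<xi>) * ?F \<xi>))"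
    by (auto simp: indicator_def simp del: times_complex.simps)
  finally have split: "(2 * pi)\<^sup>2 * g x = (2 * pi)\<^sup>2 * band_limited R g x + (\<integral>\<xi>. indicator ?T \<xi> * Re (cis (x \<bullet> \<xi>) * ?F \<xi>) \<partial>lborel)"
    unfolding band_limited_def by (simp add: Bochner_Integration.integral_add[OF re_in re_out] del: times_complex.simps)
  have "\<bar>\<integral>\<xi>. indicator ?T \<xi> * Re (cis (x \<bullet> \<xi>) * ?F \<xi>) \<partial>lborel\<bar> \<le> (\<integral>\<xi>. indicator ?T \<xi> * cmod (?F \<xi>) \<partial>lborel)"
  proof (rule integral_abs_bound_integral[OF re_out tail_int])
    fix \<xi>
    have "\<bar>Re (cis (x \<bullet> \<xi>) * ?F \<xi>)\<bar> \<le> cmod (?F \<xi>)"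
      using abs_Re_le_cmod[of "cis (x \<bullet> \<xi>) * ?F \<xi>"] by (simp add: norm_mult del: times_complex.simps)
    then show "\<bar>indicator ?T \<xi> * Re (cis (x \<bullet> \<xi>) * ?F \<xi>)\<bar> \<le> indicator ?T \<xi> * cmod (?F \<xi>)"
      by (simp add: indicator_def del: times_complex.simps)
  qed
  also have "\<dots> \<le> bias_const \<beta> C * R powr (1 - \<beta>)"
  proof -
    have "ennreal (\<integral>\<xi>. indicator ?T \<xi> * cmod (?F \<xi>) \<partial>lborel) = (\<integral>\<^sup>+\<xi>. ennreal (cmod (?F \<xi>)) * indicator ?T \<xi> \<partial>lborel)"
      by (subst nn_integral_eq_integral[OF tail_int, symmetric]) (auto intro!: nn_integral_cong simp: indicator_def)
    also note tail
    finally have "ennreal (\<integral>\<xi>. indicator ?T \<xi> * cmod (?F \<xi>) \<partial>lborel) \<le> ennreal (bias_const \<beta> C * R powr (1 - \<beta>))" .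
    moreover have "0 \<le> bias_const \<beta> C * R powr (1 - \<beta>)" using b C by (simp add: bias_const_def)
    ultimately show ?thesis using ennreal_le_iff by blast
  qed
  finally have err: "\<bar>(2 * pi)\<^sup>2 * (band_limited R g x - g x)\<bar> \<le> bias_const \<beta> C * R powr (1 - \<beta>)"
    using split by (simp add: algebra_simps)
  (* The factor (2 * pi)\<^sup>2 of the inversion formula is at least one and is dropped. *)
  have "1 \<le> (2 * pi)\<^sup>2" using pi_ge_two by (intro one_le_power) simp
  then have "1 * \<bar>band_limited R g x - g x\<bar> \<le> (2 * pi)\<^sup>2 * \<bar>band_limited R g x - g x\<bar>" by (intro mult_right_mono) auto
  then show ?thesis using err by (simp add: abs_mult)
qed

lemma band_limited_kern:
  assumes sb: "supported_bounded L g" and \<delta>: "0 < \<delta>"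
  shows "band_limited (1 / \<delta>) g x = (\<integral>y. g y * (LBINT \<phi>:{0..2*pi}. exp (- \<mu> * ((x - y) \<bullet> perp (circ \<phi>))) * kern \<mu> \<delta> ((x - y) \<bullet> circ \<phi>)) \<partial>lborel) / (4 * pi)"
proof -
  have h: "integrable lborel (\<lambda>\<xi>. indicat_real (cball (0::real^2) (1/\<delta>)) \<xi>)"
    using integral_disc_cos(1)[of "1/\<delta>" 0] \<delta> by simp
  show ?thesis
    unfolding band_limited_def fourier_multiplier[OF supported_bounded_integrable[OF sb] h]
      weighted_kern_average[OF \<delta>]
    by (simp add: power2_eq_square)
qed

section \<open>The law of an observation\<close>

definition radon :: "real \<Rightarrow> (real^2 \<Rightarrow> real) \<Rightarrow> real^2 \<Rightarrow> real \<Rightarrow> real" where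
  "radon \<mu> g \<theta> s = (\<integral>t. exp (\<mu> * t) * g (s *\<^sub>R \<theta> + t *\<^sub>R perp \<theta>) \<partial>lborel)"

lemma radon_measurable [measurable (raw)]:
  assumes [measurable]: "g \<in> borel_measurable borel" "\<theta> \<in> borel_measurable M" "s \<in> borel_measurable M"
  shows "(\<lambda>p. radon \<mu> g (\<theta> p) (s p)) \<in> borel_measurable M"
  unfolding radon_def by measurable

text \<open>The law of the angle and the offset. All points \<open>circ \<phi>\<close> lie on the unit circle, while \<^const>\<open>design\<close>
  lives on all of the plane and sees the circle only up to null sets.\<close>

definition unif_design :: "(real \<times> real) measure" where
  "unif_design = uniform_measure lborel {0..2*pi} \<Otimes>\<^sub>M uniform_measure lborel {-1..1}"

lemma prob_space_unif: "a < b \<Longrightarrow> prob_space (uniform_measure lborel {a..b::real})"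
  by (rule prob_space_uniform_measure) auto

lemma prob_space_unif_design: "prob_space unif_design"
proof -
  interpret A: prob_space "uniform_measure lborel {0..2*pi}" by (rule prob_space_unif) simp
  interpret B: prob_space "uniform_measure lborel {-1..1::real}" by (rule prob_space_unif) simp
  interpret pair_prob_space "uniform_measure lborel {0..2*pi}" "uniform_measure lborel {-1..1::real}" ..
  show ?thesis unfolding unif_design_def by (rule prob_space_axioms)
qed

lemma sets_unif_design [measurable_cong]: "sets unif_design = sets (borel \<Otimes>\<^sub>M borel)"
  unfolding unif_design_def by (intro sets_pair_measure_cong) simp_all

lemma design_eq: "design = distr unif_design (borel \<Otimes>\<^sub>M borel) (\<lambda>(\<phi>, s). (circ \<phi>, s))"
proof -
  let ?A = "uniform_measure lborel {0..2*pi}" and ?B = "uniform_measure lborel {-1..1::real}"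
  interpret B: prob_space ?B by (rule prob_space_unif) simp
  have id: "distr ?B borel (\<lambda>s. s) = ?B" by (rule distr_id2) simp
  have "design = distr ?A borel circ \<Otimes>\<^sub>M distr ?B borel (\<lambda>s. s)"
    unfolding id by (simp add: design_def circle_unif_def circ_def[abs_def])
  also have "\<dots> = distr (?A \<Otimes>\<^sub>M ?B) (borel \<Otimes>\<^sub>M borel) (\<lambda>(\<phi>, s). (circ \<phi>, s))"
    by (rule pair_measure_distr) (auto simp: id B.sigma_finite_measure_axioms)
  finally show ?thesis unfolding unif_design_def .
qed

lemma nn_integral_unif_design:
  assumes [measurable]: "case_prod h \<in> borel_measurable (borel \<Otimes>\<^sub>M borel)"
  shows "(\<integral>\<^sup>+p. case_prod h p \<partial>unif_design) = ennreal (1 / (4 * pi)) * (\<integral>\<^sup>+\<phi>. (\<integral>\<^sup>+s. h \<phi> s * indicator {-1..1} s \<partial>lborel) * indicator {0..2*pi} \<phi> \<partial>lborel)"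
proof -
  let ?A = "uniform_measure lborel {0..2*pi}" and ?B = "uniform_measure lborel {-1..1::real}"
  interpret B: prob_space ?B by (rule prob_space_unif) simp
  have m: "case_prod h \<in> borel_measurable (?A \<Otimes>\<^sub>M ?B)" by measurable
  have "(\<integral>\<^sup>+p. case_prod h p \<partial>unif_design) = (\<integral>\<^sup>+\<phi>. \<integral>\<^sup>+s. h \<phi> s \<partial>?B \<partial>?A)"
    unfolding unif_design_def using B.nn_integral_fst[OF m] by simp
  also have "(\<lambda>\<phi>. \<integral>\<^sup>+s. h \<phi> s \<partial>?B) = (\<lambda>\<phi>. (\<integral>\<^sup>+s. h \<phi> s * indicator {-1..1} s \<partial>lborel) / 2)"
    by (subst nn_integral_uniform_measure) (simp_all add: fun_eq_iff)
  also have "(\<integral>\<^sup>+\<phi>. (\<integral>\<^sup>+s. h \<phi> s * indicator {-1..1} s \<partial>lborel) / 2 \<partial>?A) = (\<integral>\<^sup>+\<phi>. (\<integral>\<^sup>+s. h \<phi> s * indicator {-1..1} s \<partial>lborel) / 2 * indicator {0..2*pi} \<phi> \<partial>lborel) / ennreal (2 * pi)"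
    by (subst nn_integral_uniform_measure) simp_all
  also have "(\<integral>\<^sup>+\<phi>. (\<integral>\<^sup>+s. h \<phi> s * indicator {-1..1} s \<partial>lborel) / 2 * indicator {0..2*pi} \<phi> \<partial>lborel) =
     (\<integral>\<^sup>+\<phi>. (\<integral>\<^sup>+s. h \<phi> s * indicator {-1..1} s \<partial>lborel) * indicator {0..2*pi} \<phi> \<partial>lborel) * inverse 2"
    by (subst nn_integral_multc[symmetric]) (auto simp: divide_ennreal_def mult_ac)
  also have "X * inverse 2 / ennreal (2 * pi) = ennreal (1 / (4 * pi)) * X" for X :: ennreal
  proof -
    have i2: "inverse (2 :: ennreal) = ennreal (1 / 2)"
      using inverse_ennreal[of 2] by (simp add: inverse_eq_divide)
    have ip: "inverse (ennreal (2 * pi)) = ennreal (1 / (2 * pi))"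
      by (subst inverse_ennreal) (simp_all add: inverse_eq_divide)
    have "inverse 2 * inverse (ennreal (2 * pi)) = ennreal (1 / (4 * pi))"
      unfolding i2 ip by (subst ennreal_mult[symmetric]) auto
    then show ?thesis by (metis divide_ennreal_def mult.assoc mult.commute)
  qed
  finally show ?thesis .
qed

text \<open>Along each direction a null set of the plane meets almost every line in a null set of the line.\<close>

lemma exp_radon_eq_radon:
  assumes sb: "supported_bounded L g" and ae: "AE y in lborel. f y = g y"
  shows "AE p in design. exp_radon \<mu> f (fst p) (snd p) = radon \<mu> g (fst p) (snd p)"
proof -
  have [measurable]: "g \<in> borel_measurable borel" using sb by (simp add: supported_bounded_def)
  have sd [measurable_cong]: "sets design = sets (borel \<Otimes>\<^sub>M borel)" by (simp add: design_eq)
  obtain N where N: "{y \<in> space lborel. \<not> f y = g y} \<subseteq> N" "emeasure lborel N = 0" "N \<in> sets lborel"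
    using ae by (rule AE_E)
  have [measurable]: "N \<in> sets borel" using N by simp
  let ?B = "\<lambda>\<theta> s. \<integral>\<^sup>+t. indicator N (s *\<^sub>R \<theta> + t *\<^sub>R perp \<theta>) \<partial>lborel"
  have z: "(\<integral>\<^sup>+s. ?B (circ \<phi>) s * indicator {-1..1} s \<partial>lborel) = 0" for \<phi>
  proof -
    have "(\<integral>\<^sup>+s. ?B (circ \<phi>) s * indicator {-1..1} s \<partial>lborel) \<le> (\<integral>\<^sup>+s. ?B (circ \<phi>) s \<partial>lborel)"
      by (intro nn_integral_mono) (auto simp: indicator_def)
    also have "\<dots> = (\<integral>\<^sup>+p. indicator N (case p of (s, t) \<Rightarrow> s *\<^sub>R circ \<phi> + t *\<^sub>R perp (circ \<phi>)) \<partial>(lborel \<Otimes>\<^sub>M lborel))"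
      by (subst lborel.nn_integral_fst[symmetric]) auto
    also have "\<dots> = (\<integral>\<^sup>+y. indicator N y \<partial>distr (lborel \<Otimes>\<^sub>M lborel) borel (\<lambda>(s, t). s *\<^sub>R circ \<phi> + t *\<^sub>R perp (circ \<phi>)))"
      by (subst nn_integral_distr) auto
    also have "\<dots> = 0" unfolding lborel_line_coordinates using N by simp
    finally show ?thesis by simp
  qed
  have "(\<integral>\<^sup>+p. ?B (fst p) (snd p) \<partial>design) = (\<integral>\<^sup>+p. (case p of (\<phi>, s) \<Rightarrow> ?B (circ \<phi>) s) \<partial>unif_design)"
    unfolding design_eq by (subst nn_integral_distr) (auto simp: case_prod_beta')
  also have "\<dots> = 0"
    by (subst nn_integral_unif_design) (simp_all add: z)
  finally have "AE p in design. ?B (fst p) (snd p) = 0"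
    by (subst (asm) nn_integral_0_iff_AE) auto
  then show ?thesis
  proof eventually_elim
    case (elim p)
    obtain \<theta> s where p: "p = (\<theta>, s)" by (cases p)
    let ?y = "\<lambda>t. s *\<^sub>R \<theta> + t *\<^sub>R perp \<theta>"
    have "AE t in lborel. indicator N (?y t) = (0 :: ennreal)"
      using elim by (subst nn_integral_0_iff_AE[symmetric]) (auto simp: p)
    then have e: "AE t in lborel. exp (\<mu> * t) * f (?y t) = exp (\<mu> * t) * g (?y t)"
      by eventually_elim (use N(1) in \<open>auto simp: indicator_def split: if_splits\<close>)
    have m: "(\<lambda>t. exp (\<mu> * t) * g (?y t)) \<in> borel_measurable lborel" by measurable
    have "exp_radon \<mu> f \<theta> s = (\<integral>t. exp (\<mu> * t) * g (?y t) \<partial>lebesgue)"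
      unfolding exp_radon_def
    proof (rule integral_cong_AE)
      show "(\<lambda>t. exp (\<mu> * t) * f (?y t)) \<in> borel_measurable lebesgue"
        by (rule measurable_completion_cong_AE[OF m e]) simp
    qed (use m e in \<open>auto intro: measurable_completion AE_completion\<close>)
    also have "\<dots> = radon \<mu> g \<theta> s" unfolding radon_def by (rule integral_completion[OF m])
    finally show ?case by (simp add: p)
  qed
qed

definition noise :: "real \<Rightarrow> real measure" where
  "noise \<sigma> = density lborel (\<lambda>e. ennreal (normal_density 0 \<sigma> e))"

lemma prob_space_noise: "\<sigma> > 0 \<Longrightarrow> prob_space (noise \<sigma>)"
  unfolding noise_def by (rule prob_space_normal_density)

lemma sets_noise [measurable_cong]: "sets (noise \<sigma>) = sets borel" by (simp add: noise_def)

lemma AE_fst_pair: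
  assumes "AE x in M. P x" "pair_sigma_finite M N"
  shows "AE z in M \<Otimes>\<^sub>M N. P (fst z)"
proof -
  interpret N: pair_sigma_finite M N by fact
  obtain B where B': "{x \<in> space M. \<not> P x} \<subseteq> B" "emeasure M B = 0" "B \<in> sets M" using assms(1) by (rule AE_E)
  then have B: "B \<in> null_sets M" "{x \<in> space M. \<not> P x} \<subseteq> B" by auto
  have [measurable]: "B \<in> sets M" using B by auto
  have "AE z in M \<Otimes>\<^sub>M N. fst z \<notin> B"
  proof (rule N.AE_pair_measure)
    show "{z \<in> space (M \<Otimes>\<^sub>M N). fst z \<notin> B} \<in> sets (M \<Otimes>\<^sub>M N)" by measurable
    show "AE x in M. AE y in N. fst (x, y) \<notin> B" using AE_not_in[OF B(1)] by auto
  qed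
  moreover have "AE z in M \<Otimes>\<^sub>M N. z \<in> space (M \<Otimes>\<^sub>M N)" by (rule AE_space)
  ultimately show ?thesis by eventually_elim (use B(2) in \<open>auto simp: space_pair_measure\<close>)
qed

text \<open>The map that produces an observation from \<open>f\<close> agrees almost everywhere with the Borel map built from \<open>g\<close>,
  and a Borel map has the same image law under a measure and under its completion.\<close>

lemma obs_law_eq:
  assumes \<sigma>: "\<sigma> > 0" and sb: "supported_bounded L g" and ae: "AE y in lborel. f y = g y"
  shows "obs_law \<mu> \<sigma> f = distr (unif_design \<Otimes>\<^sub>M noise \<sigma>) borel (\<lambda>((\<phi>, s), e). (circ \<phi>, s, radon \<mu> g (circ \<phi>) s + e))"
proof -
  have [measurable]: "g \<in> borel_measurable borel" using sb by (simp add: supported_bounded_def)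
  interpret N: prob_space "noise \<sigma>" by (rule prob_space_noise[OF \<sigma>])
  interpret U: prob_space unif_design by (rule prob_space_unif_design)
  interpret D: prob_space design unfolding design_eq by (rule U.prob_space_distr) measurable
  have dm: "(\<lambda>((\<theta>, s), e). (\<theta>, s, h \<theta> s + e)) = (\<lambda>z. (fst (fst z), snd (fst z), h (fst (fst z)) (snd (fst z)) + snd z))"
    for h :: "real^2 \<Rightarrow> real \<Rightarrow> real" by (auto simp: fun_eq_iff)
  let ?hf = "\<lambda>z. (fst (fst z), snd (fst z), exp_radon \<mu> f (fst (fst z)) (snd (fst z)) + snd z)"
  let ?hg = "\<lambda>z. (fst (fst z), snd (fst z), radon \<mu> g (fst (fst z)) (snd (fst z)) + snd z)"
  have sd: "sets design = sets (borel \<Otimes>\<^sub>M borel)" by (simp add: design_eq)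
  note [measurable_cong] = sd
  have "AE z in design \<Otimes>\<^sub>M noise \<sigma>. exp_radon \<mu> f (fst (fst z)) (snd (fst z)) = radon \<mu> g (fst (fst z)) (snd (fst z))"
    by (rule AE_fst_pair[OF exp_radon_eq_radon[OF sb ae]]) unfold_locales
  then have e: "AE z in design \<Otimes>\<^sub>M noise \<sigma>. ?hf z = ?hg z"
    by eventually_elim simp
  have hg: "?hg \<in> design \<Otimes>\<^sub>M noise \<sigma> \<rightarrow>\<^sub>M borel"
    unfolding borel_prod[symmetric] by measurable
  have "obs_law \<mu> \<sigma> f = distr (completion (design \<Otimes>\<^sub>M noise \<sigma>)) borel ?hg"
    unfolding obs_law_def noise_def[symmetric] dm
  proof (rule distr_cong_AE)
    show "AE z in completion (design \<Otimes>\<^sub>M noise \<sigma>). ?hf z = ?hg z" by (rule AE_completion[OF e])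
    show "?hf \<in> completion (design \<Otimes>\<^sub>M noise \<sigma>) \<rightarrow>\<^sub>M borel"
      by (rule measurable_completion_cong_AE[OF hg e]) simp
    show "?hg \<in> completion (design \<Otimes>\<^sub>M noise \<sigma>) \<rightarrow>\<^sub>M borel"
      by (rule measurable_completion[OF hg])
  qed auto
  also have "\<dots> = distr (design \<Otimes>\<^sub>M noise \<sigma>) borel ?hg" by (rule distr_completion[OF hg])
  also have "design \<Otimes>\<^sub>M noise \<sigma> = distr (unif_design \<Otimes>\<^sub>M noise \<sigma>) ((borel \<Otimes>\<^sub>M borel) \<Otimes>\<^sub>M borel) (\<lambda>(p, e). ((\<lambda>(\<phi>, s). (circ \<phi>, s)) p, e))"
  proof -
    have id: "distr (noise \<sigma>) borel (\<lambda>s. s) = noise \<sigma>" by (rule distr_id2) (simp add: sets_noise)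
    have "design \<Otimes>\<^sub>M noise \<sigma> = distr unif_design (borel \<Otimes>\<^sub>M borel) (\<lambda>(\<phi>, s). (circ \<phi>, s)) \<Otimes>\<^sub>M distr (noise \<sigma>) borel (\<lambda>s. s)"
      unfolding id design_eq[symmetric] ..
    also have "\<dots> = distr (unif_design \<Otimes>\<^sub>M noise \<sigma>) ((borel \<Otimes>\<^sub>M borel) \<Otimes>\<^sub>M borel) (\<lambda>(p, e). ((\<lambda>(\<phi>, s). (circ \<phi>, s)) p, e))"
      by (rule pair_measure_distr) (measurable, simp add: id N.sigma_finite_measure_axioms)
    finally show ?thesis .
  qed
  also have "distr \<dots> borel ?hg = distr (unif_design \<Otimes>\<^sub>M noise \<sigma>) borel (?hg \<circ> (\<lambda>(p, e). ((\<lambda>(\<phi>, s). (circ \<phi>, s)) p, e)))"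
    by (rule distr_distr) (unfold borel_prod[symmetric], measurable)
  also have "?hg \<circ> (\<lambda>(p, e). ((\<lambda>(\<phi>, s). (circ \<phi>, s)) p, e)) = (\<lambda>((\<phi>, s), e). (circ \<phi>, s, radon \<mu> g (circ \<phi>) s + e))"
    by (auto simp: fun_eq_iff)
  finally show ?thesis .
qed


section \<open>The mean of a linear estimator\<close>

lemma sin_cos_mult_add [simp]: "sin \<phi> * sin \<phi> + cos \<phi> * cos \<phi> = (1::real)"
  using sin_cos_squared_add[of \<phi>] by (simp add: power2_eq_square)

lemma norm_line_point: "(norm (s *\<^sub>R circ \<phi> + t *\<^sub>R perp (circ \<phi>)))\<^sup>2 = s\<^sup>2 + t\<^sup>2"
proof -
  have "(norm (s *\<^sub>R circ \<phi> + t *\<^sub>R perp (circ \<phi>)))\<^sup>2 = (s\<^sup>2 + t\<^sup>2) * ((sin \<phi>)\<^sup>2 + (cos \<phi>)\<^sup>2)"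
    unfolding norm_2_sq
    by (simp add: power2_eq_square algebra_simps del: sin_cos_squared_add sin_cos_squared_add2 sin_cos_squared_add3 sin_cos_mult_add)
  then show ?thesis by simp
qed

lemma inner_line_point:
  "(s *\<^sub>R circ \<phi> + t *\<^sub>R perp (circ \<phi>)) \<bullet> circ \<phi> = s" "(s *\<^sub>R circ \<phi> + t *\<^sub>R perp (circ \<phi>)) \<bullet> perp (circ \<phi>) = t"
proof -
  have 1: "circ \<phi> \<bullet> circ \<phi> = 1" "perp (circ \<phi>) \<bullet> perp (circ \<phi>) = 1" "perp (circ \<phi>) \<bullet> circ \<phi> = 0" "circ \<phi> \<bullet> perp (circ \<phi>) = 0"
    by (simp_all add: inner_2)
  show "(s *\<^sub>R circ \<phi> + t *\<^sub>R perp (circ \<phi>)) \<bullet> circ \<phi> = s" "(s *\<^sub>R circ \<phi> + t *\<^sub>R perp (circ \<phi>)) \<bullet> perp (circ \<phi>) = t"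
    by (simp_all add: inner_add_left 1)
qed

lemma supported_bounded_line:
  assumes sb: "supported_bounded L g"
  shows "\<bar>s\<bar> > 1 \<or> \<bar>t\<bar> > 1 \<Longrightarrow> g (s *\<^sub>R circ \<phi> + t *\<^sub>R perp (circ \<phi>)) = 0"
proof -
  assume "\<bar>s\<bar> > 1 \<or> \<bar>t\<bar> > 1"
  then have "s\<^sup>2 > 1 \<or> t\<^sup>2 > 1" using one_less_power[of "\<bar>s\<bar>" 2] one_less_power[of "\<bar>t\<bar>" 2] by auto
  then have "(norm (s *\<^sub>R circ \<phi> + t *\<^sub>R perp (circ \<phi>)))\<^sup>2 > 1"
    unfolding norm_line_point using zero_le_power2[of s] zero_le_power2[of t] by linarith
  then have "norm (s *\<^sub>R circ \<phi> + t *\<^sub>R perp (circ \<phi>)) > 1"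
    by (rule contrapos_pp) (simp add: not_less abs_square_le_1)
  then show ?thesis using sb by (simp add: supported_bounded_def)
qed

lemma radon_bound:
  assumes sb: "supported_bounded L g"
  shows "\<bar>radon \<mu> g (circ \<phi>) s\<bar> \<le> 2 * L * exp \<bar>\<mu>\<bar>"
proof -
  have [measurable]: "g \<in> borel_measurable borel" using sb by (simp add: supported_bounded_def)
  have gL: "\<bar>g y\<bar> \<le> L" for y using sb by (simp add: supported_bounded_def)
  have L: "L \<ge> 0" using gL[of 0] by linarith
  let ?b = "\<lambda>t::real. indicator {-1..1} t *\<^sub>R (L * exp \<bar>\<mu>\<bar>)"
  have b: "integrable lborel ?b" by (rule borel_integrable_compact) auto
  have pw: "\<bar>exp (\<mu> * t) * g (s *\<^sub>R circ \<phi> + t *\<^sub>R perp (circ \<phi>))\<bar> \<le> ?b t" for t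
  proof (cases "\<bar>t\<bar> > 1")
    case True
    then show ?thesis using supported_bounded_line[OF sb, of s t \<phi>] L by (simp add: indicator_def)
  next
    case False
    have "\<mu> * t \<le> \<bar>\<mu>\<bar> * \<bar>t\<bar>" unfolding abs_mult[symmetric] by simp
    also have "\<dots> \<le> \<bar>\<mu>\<bar> * 1" using False by (intro mult_left_mono) auto
    finally have "exp (\<mu> * t) \<le> exp \<bar>\<mu>\<bar>" by simp
    then have "exp (\<mu> * t) * \<bar>g (s *\<^sub>R circ \<phi> + t *\<^sub>R perp (circ \<phi>))\<bar> \<le> exp \<bar>\<mu>\<bar> * L"
      using gL by (intro mult_mono) auto
    moreover have "t \<in> {-1..1}" using False by auto
    ultimately show ?thesis by (simp add: abs_mult mult.commute)
  qed
  have int: "integrable lborel (\<lambda>t. exp (\<mu> * t) * g (s *\<^sub>R circ \<phi> + t *\<^sub>R perp (circ \<phi>)))"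
    by (rule Bochner_Integration.integrable_bound[OF b]) (auto intro!: AE_I2 order_trans[OF pw])
  have "\<bar>radon \<mu> g (circ \<phi>) s\<bar> \<le> (\<integral>t. ?b t \<partial>lborel)"
    unfolding radon_def by (rule integral_abs_bound_integral[OF int b pw])
  then show ?thesis by simp
qed

definition weight :: "real \<Rightarrow> real^2 \<Rightarrow> (real \<Rightarrow> real) \<Rightarrow> real \<Rightarrow> real \<Rightarrow> real" where
  "weight \<mu> x k \<phi> s = exp (- \<mu> * (x \<bullet> perp (circ \<phi>))) * k (x \<bullet> circ \<phi> - s)"

lemma weight_measurable [measurable (raw)]:
  assumes [measurable]: "k \<in> borel_measurable borel" "\<phi> \<in> borel_measurable M" "s \<in> borel_measurable M"
  shows "(\<lambda>p. weight \<mu> x k (\<phi> p) (s p)) \<in> borel_measurable M"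
  unfolding weight_def by measurable

lemma norm_perp_circ [simp]: "norm (perp (circ \<phi>)) = 1"
  by (simp add: norm_eq_sqrt_inner inner_2)

lemma exp_weight_bound: "exp (- \<mu> * (x \<bullet> perp (circ \<phi>))) \<le> exp (\<bar>\<mu>\<bar> * norm x)"
proof -
  have "\<bar>x \<bullet> perp (circ \<phi>)\<bar> \<le> norm x"
    using Cauchy_Schwarz_ineq2[of x "perp (circ \<phi>)"] by simp
  then have "\<bar>- \<mu> * (x \<bullet> perp (circ \<phi>))\<bar> \<le> \<bar>\<mu>\<bar> * norm x"
    unfolding abs_mult by (intro mult_mono) auto
  then show ?thesis by (simp only: exp_le_cancel_iff)
qed

lemma weight_bound:
  assumes "\<And>u. \<bar>k u\<bar> \<le> M"
  shows "\<bar>weight \<mu> x k \<phi> s\<bar> \<le> exp (\<bar>\<mu>\<bar> * norm x) * M"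
  unfolding weight_def abs_mult using assms exp_weight_bound[of \<mu> x \<phi>] by (intro mult_mono) auto

lemma weight_square_integral:
  assumes [measurable]: "k \<in> borel_measurable borel" and k: "integrable lborel (\<lambda>u. (k u)\<^sup>2)"
  shows "(\<integral>\<^sup>+p. ennreal ((weight \<mu> x k (fst p) (snd p))\<^sup>2) \<partial>unif_design) \<le> ennreal ((exp (\<bar>\<mu>\<bar> * norm x))\<^sup>2 / 2 * (LBINT u. (k u)\<^sup>2))"
proof -
  let ?q = "exp (\<bar>\<mu>\<bar> * norm x)" and ?I = "LBINT u. (k u)\<^sup>2"
  have inner: "(\<integral>\<^sup>+s. ennreal ((weight \<mu> x k \<phi> s)\<^sup>2) * indicator {-1..1} s \<partial>lborel) \<le> ennreal (?q\<^sup>2 * ?I)" for \<phi>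
  proof -
    have "(\<integral>\<^sup>+s. ennreal ((weight \<mu> x k \<phi> s)\<^sup>2) * indicator {-1..1} s \<partial>lborel) \<le> (\<integral>\<^sup>+s. ennreal (?q\<^sup>2) * ennreal ((k (x \<bullet> circ \<phi> + (-1) * s))\<^sup>2) \<partial>lborel)"
    proof (intro nn_integral_mono)
      fix s :: real
      have "(exp (- \<mu> * (x \<bullet> perp (circ \<phi>))))\<^sup>2 * (k (x \<bullet> circ \<phi> - s))\<^sup>2 \<le> ?q\<^sup>2 * (k (x \<bullet> circ \<phi> - s))\<^sup>2"
        using exp_weight_bound[of \<mu> x \<phi>] by (intro mult_right_mono power_mono) auto
      then have "ennreal ((weight \<mu> x k \<phi> s)\<^sup>2) \<le> ennreal (?q\<^sup>2) * ennreal ((k (x \<bullet> circ \<phi> + (-1) * s))\<^sup>2)"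
        unfolding weight_def power_mult_distrib by (subst ennreal_mult[symmetric]) (auto intro!: ennreal_leI)
      then show "ennreal ((weight \<mu> x k \<phi> s)\<^sup>2) * indicator {-1..1} s \<le> ennreal (?q\<^sup>2) * ennreal ((k (x \<bullet> circ \<phi> + (-1) * s))\<^sup>2)"
        by (auto simp: indicator_def)
    qed
    also have "\<dots> = ennreal (?q\<^sup>2) * (\<integral>\<^sup>+s. ennreal ((k (x \<bullet> circ \<phi> + (-1) * s))\<^sup>2) \<partial>lborel)"
      by (rule nn_integral_cmult) measurable
    also have "(\<integral>\<^sup>+s. ennreal ((k (x \<bullet> circ \<phi> + (-1) * s))\<^sup>2) \<partial>lborel) = (\<integral>\<^sup>+u. ennreal ((k u)\<^sup>2) \<partial>lborel)"
      using nn_integral_real_affine[of "\<lambda>u. ennreal ((k u)\<^sup>2)" "-1" "x \<bullet> circ \<phi>"] by simp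
    also have "\<dots> = ennreal ?I" by (rule nn_integral_eq_integral[OF k]) auto
    also have "ennreal (?q\<^sup>2) * ennreal ?I = ennreal (?q\<^sup>2 * ?I)" by (rule ennreal_mult[symmetric]) auto
    finally show ?thesis .
  qed
  have "(\<integral>\<^sup>+p. ennreal ((weight \<mu> x k (fst p) (snd p))\<^sup>2) \<partial>unif_design) =
    ennreal (1 / (4 * pi)) * (\<integral>\<^sup>+\<phi>. (\<integral>\<^sup>+s. ennreal ((weight \<mu> x k \<phi> s)\<^sup>2) * indicator {-1..1} s \<partial>lborel) * indicator {0..2*pi} \<phi> \<partial>lborel)"
    using nn_integral_unif_design[of "\<lambda>\<phi> s. ennreal ((weight \<mu> x k \<phi> s)\<^sup>2)"] by (simp add: case_prod_beta')
  also have "\<dots> \<le> ennreal (1 / (4 * pi)) * (\<integral>\<^sup>+\<phi>. ennreal (?q\<^sup>2 * ?I) * indicator {0..2*pi} \<phi> \<partial>lborel)"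
    by (intro mult_left_mono nn_integral_mono mult_right_mono inner) auto
  also have "\<dots> = ennreal (1 / (4 * pi)) * (ennreal (?q\<^sup>2 * ?I) * ennreal (2 * pi))"
    by (simp add: nn_integral_cmult_indicator)
  also have "\<dots> = ennreal (1 / (4 * pi) * (?q\<^sup>2 * ?I * (2 * pi)))"
    by (subst ennreal_mult[symmetric], simp, simp, subst ennreal_mult[symmetric]) auto
  also have "1 / (4 * pi) * (?q\<^sup>2 * ?I * (2 * pi)) = ?q\<^sup>2 / 2 * ?I" by simp
  finally show ?thesis .
qed

text \<open>The mean of the linear estimator with kernel \<open>k\<close>.\<close>

definition mean_functional :: "real \<Rightarrow> (real^2 \<Rightarrow> real) \<Rightarrow> real^2 \<Rightarrow> (real \<Rightarrow> real) \<Rightarrow> real" where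
  "mean_functional \<mu> g x k = (\<integral>p. weight \<mu> x k (fst p) (snd p) * radon \<mu> g (circ (fst p)) (snd p) \<partial>unif_design)"

lemma weight_radon_bound:
  assumes sb: "supported_bounded L g" and M: "\<And>u. \<bar>k u\<bar> \<le> M"
  shows "\<bar>weight \<mu> x k \<phi> s * radon \<mu> g (circ \<phi>) s\<bar> \<le> exp (\<bar>\<mu>\<bar> * norm x) * M * (2 * L * exp \<bar>\<mu>\<bar>)"
proof -
  have "M \<ge> 0" using M[of 0] by linarith
  then show ?thesis unfolding abs_mult by (intro mult_mono weight_bound M radon_bound[OF sb]) auto
qed

lemma weight_radon_integrable:
  assumes sb: "supported_bounded L g" and [measurable]: "k \<in> borel_measurable borel" and M: "\<And>u. \<bar>k u\<bar> \<le> M"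
  shows "integrable unif_design (\<lambda>p. weight \<mu> x k (fst p) (snd p) * radon \<mu> g (circ (fst p)) (snd p))"
proof -
  have [measurable]: "g \<in> borel_measurable borel" using sb by (simp add: supported_bounded_def)
  interpret prob_space unif_design by (rule prob_space_unif_design)
  show ?thesis
    by (rule integrable_const_bound[where B="exp (\<bar>\<mu>\<bar> * norm x) * M * (2 * L * exp \<bar>\<mu>\<bar>)"])
      (use weight_radon_bound[OF sb M] in \<open>auto intro!: AE_I2\<close>)
qed

lemma mean_functional_diff:
  assumes sb: "supported_bounded L g" and k: "k \<in> borel_measurable borel" "\<And>u. \<bar>k u\<bar> \<le> M" and k': "k' \<in> borel_measurable borel" "\<And>u. \<bar>k' u\<bar> \<le> M'"
  shows "mean_functional \<mu> g x (\<lambda>u. k u - k' u) = mean_functional \<mu> g x k - mean_functional \<mu> g x k'"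
proof -
  have "weight \<mu> x (\<lambda>u. k u - k' u) \<phi> s = weight \<mu> x k \<phi> s - weight \<mu> x k' \<phi> s" for \<phi> s
    by (simp add: weight_def right_diff_distrib)
  then show ?thesis unfolding mean_functional_def
    by (simp only: left_diff_distrib Bochner_Integration.integral_diff[OF weight_radon_integrable[OF sb k] weight_radon_integrable[OF sb k']])
qed

lemma integral_unif_design:
  fixes h :: "real \<Rightarrow> real \<Rightarrow> real"
  assumes [measurable]: "case_prod h \<in> borel_measurable (borel \<Otimes>\<^sub>M borel)" and int: "integrable unif_design (\<lambda>p. h (fst p) (snd p))"
  shows "(\<integral>p. h (fst p) (snd p) \<partial>unif_design) = (LBINT \<phi>:{0..2*pi}. (LBINT s:{-1..1}. h \<phi> s)) / (4 * pi)"
proof -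
  let ?A = "uniform_measure lborel {0..2*pi}" and ?B = "uniform_measure lborel {-1..1::real}"
  interpret A: prob_space ?A by (rule prob_space_unif) simp
  interpret B: prob_space ?B by (rule prob_space_unif) simp
  interpret pair_sigma_finite ?A ?B ..
  have u: "(\<integral>x. f x \<partial>uniform_measure lborel {a..b}) = (LBINT x:{a..b}. f x) / (b - a)" if "a < b" "f \<in> borel_measurable borel" for f :: "real \<Rightarrow> real" and a b
  proof -
    have "uniform_measure lborel {a..b} = density lborel (\<lambda>x. ennreal (indicator {a..b} x / (b - a)))"
      unfolding uniform_measure_def using that(1)
      by (intro density_cong) (auto intro!: AE_I2 simp: indicator_def divide_ennreal[symmetric])
    then show ?thesis unfolding set_lebesgue_integral_def using that
      by (simp add: integral_density)
  qed
  have "(\<integral>p. h (fst p) (snd p) \<partial>unif_design) = (\<integral>\<phi>. (\<integral>s. h \<phi> s \<partial>?B) \<partial>?A)"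
    using integral_fst'[of "\<lambda>p. h (fst p) (snd p)"] int unfolding unif_design_def by simp
  also have "\<dots> = (\<integral>\<phi>. (LBINT s:{-1..1}. h \<phi> s) / 2 \<partial>?A)"
    by (subst u) simp_all
  also have "\<dots> = (LBINT \<phi>:{0..2*pi}. (LBINT s:{-1..1}. h \<phi> s) / 2) / (2 * pi)"
    unfolding set_lebesgue_integral_def by (subst u) (simp_all add: set_lebesgue_integral_def)
  finally show ?thesis by simp
qed

lemma radon_outside: 
  assumes "supported_bounded L g" "\<bar>s\<bar> > 1" shows "radon \<mu> g (circ \<phi>) s = 0"
  unfolding radon_def using supported_bounded_line[OF assms(1), of s] assms(2) by simp

text \<open>Since \<open>y \<bullet> circ \<phi>\<close> and \<open>y \<bullet> perp (circ \<phi>)\<close> are the line coordinates of \<open>y\<close>, the weight of the estimator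
  and the weight of the transform combine to a function of \<open>x - y\<close> alone.\<close>

lemma line_integral_of_weighted:
  assumes sb: "supported_bounded L g" and [measurable]: "k \<in> borel_measurable borel" and M: "\<And>u. \<bar>k u\<bar> \<le> M"
  shows "(LBINT s:{-1..1}. weight \<mu> x k \<phi> s * radon \<mu> g (circ \<phi>) s) =
    (\<integral>y. g y * (exp (- \<mu> * ((x - y) \<bullet> perp (circ \<phi>))) * k ((x - y) \<bullet> circ \<phi>)) \<partial>lborel)"
proof -
  have [measurable]: "g \<in> borel_measurable borel" using sb by (simp add: supported_bounded_def)
  have M0: "M \<ge> 0" using M[of 0] by linarith
  let ?\<Psi> = "\<lambda>y. g y * (exp (- \<mu> * ((x - y) \<bullet> perp (circ \<phi>))) * k ((x - y) \<bullet> circ \<phi>))"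
  let ?y = "\<lambda>s t. s *\<^sub>R circ \<phi> + t *\<^sub>R perp (circ \<phi>)"
  have bound: "\<bar>exp (- \<mu> * ((x - y) \<bullet> perp (circ \<phi>))) * k ((x - y) \<bullet> circ \<phi>)\<bar> \<le> exp (\<bar>\<mu>\<bar> * (norm x + 1)) * M" if "norm y \<le> 1" for y
  proof -
    have "\<bar>\<mu>\<bar> * norm (x - y) \<le> \<bar>\<mu>\<bar> * (norm x + 1)"
      using norm_triangle_ineq4[of x y] that by (intro mult_left_mono) auto
    then have "exp (- \<mu> * ((x - y) \<bullet> perp (circ \<phi>))) \<le> exp (\<bar>\<mu>\<bar> * (norm x + 1))"
      using exp_weight_bound[of \<mu> "x - y" \<phi>] by (meson exp_le_cancel_iff order_trans)
    then show ?thesis unfolding abs_mult using M by (intro mult_mono) auto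
  qed
  have int: "integrable lborel ?\<Psi>"
  proof (rule Bochner_Integration.integrable_bound)
    show "integrable lborel (\<lambda>y. g y * (exp (\<bar>\<mu>\<bar> * (norm x + 1)) * M))"
      using supported_bounded_integrable[OF sb] by simp
    show "AE y in lborel. norm (?\<Psi> y) \<le> norm (g y * (exp (\<bar>\<mu>\<bar> * (norm x + 1)) * M))"
    proof (rule AE_I2)
      fix y
      show "norm (?\<Psi> y) \<le> norm (g y * (exp (\<bar>\<mu>\<bar> * (norm x + 1)) * M))"
      proof (cases "norm y \<le> 1")
        case True
        then show ?thesis using bound[OF True] M0 unfolding real_norm_def abs_mult[of "g y"]
          by (intro mult_left_mono) auto
      next
        case False
        then show ?thesis using sb by (simp add: supported_bounded_def)
      qed
    qed
  qed measurable
  have m: "(\<lambda>(s, t). ?y s t) \<in> lborel \<Otimes>\<^sub>M lborel \<rightarrow>\<^sub>M borel" by measurable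
  have m': "?\<Psi> \<in> borel_measurable borel" by measurable
  have int2: "integrable (lborel \<Otimes>\<^sub>M lborel) (\<lambda>p. ?\<Psi> (case p of (s, t) \<Rightarrow> ?y s t))"
    using int unfolding lborel_line_coordinates[of \<phi>, symmetric] integrable_distr_eq[OF m m'] .
  have inner: "(\<integral>t. ?\<Psi> (?y s t) \<partial>lborel) = weight \<mu> x k \<phi> s * radon \<mu> g (circ \<phi>) s" for s
  proof -
    have "?\<Psi> (?y s t) = weight \<mu> x k \<phi> s * (exp (\<mu> * t) * g (?y s t))" for t
      unfolding weight_def inner_diff_left inner_line_point right_diff_distrib exp_diff
      by (simp add: exp_minus field_simps)
    then show ?thesis unfolding radon_def by (simp only: integral_mult_right_zero)
  qed
  have "(\<integral>y. ?\<Psi> y \<partial>lborel) = (\<integral>p. ?\<Psi> (case p of (s, t) \<Rightarrow> ?y s t) \<partial>(lborel \<Otimes>\<^sub>M lborel))"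
    by (subst lborel_line_coordinates[of \<phi>, symmetric], rule integral_distr[OF m m'])
  also have "\<dots> = (\<integral>s. (\<integral>t. ?\<Psi> (?y s t) \<partial>lborel) \<partial>lborel)"
    using lborel_pair.integral_fst'[OF int2] by simp
  also have "\<dots> = (LBINT s:{-1..1}. weight \<mu> x k \<phi> s * radon \<mu> g (circ \<phi>) s)"
    unfolding inner set_lebesgue_integral_def
  proof (intro Bochner_Integration.integral_cong refl)
    fix s :: real
    show "weight \<mu> x k \<phi> s * radon \<mu> g (circ \<phi>) s = indicat_real {-1..1} s *\<^sub>R (weight \<mu> x k \<phi> s * radon \<mu> g (circ \<phi>) s)"
      using radon_outside[OF sb, of s \<mu> \<phi>] by (cases "\<bar>s\<bar> > 1") (auto simp: indicator_def abs_if split: if_splits)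
  qed
  finally show ?thesis by simp
qed

text \<open>The estimator with bandwidth \<open>\<delta>\<close> is unbiased for the frequency truncation at \<open>1 / \<delta>\<close>.\<close>

lemma mean_functional_kern:
  assumes sb: "supported_bounded L g" and d: "0 < \<delta>" "\<delta> \<le> 1"
  shows "mean_functional \<mu> g x (kern \<mu> \<delta>) = band_limited (1 / \<delta>) g x"
proof -
  have [measurable]: "g \<in> borel_measurable borel" using sb by (simp add: supported_bounded_def)
  note M = kern_bounds(1)[OF d, of \<mu>]
  let ?h = "\<lambda>\<phi> s. weight \<mu> x (kern \<mu> \<delta>) \<phi> s * radon \<mu> g (circ \<phi>) s"
  let ?e = "\<lambda>\<phi> y. exp (- \<mu> * ((x - y) \<bullet> perp (circ \<phi>))) * kern \<mu> \<delta> ((x - y) \<bullet> circ \<phi>)"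
  have "mean_functional \<mu> g x (kern \<mu> \<delta>) = (LBINT \<phi>:{0..2*pi}. (LBINT s:{-1..1}. ?h \<phi> s)) / (4 * pi)"
    unfolding mean_functional_def
    by (rule integral_unif_design[of ?h, OF _ weight_radon_integrable[OF sb _ M]]) measurable
  also have "(LBINT \<phi>:{0..2*pi}. (LBINT s:{-1..1}. ?h \<phi> s)) = (\<integral>\<phi>. (\<integral>y. indicator {0..2*pi} \<phi> * (g y * ?e \<phi> y) \<partial>lborel) \<partial>lborel)"
    unfolding set_lebesgue_integral_def[of _ "{0..2*pi}"] line_integral_of_weighted[OF sb kern_measurable M] by simp
  also have "\<dots> = (\<integral>y. (\<integral>\<phi>. indicator {0..2*pi} \<phi> * (g y * ?e \<phi> y) \<partial>lborel) \<partial>lborel)"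
  proof (rule lborel_pair.Fubini_integral[symmetric])
    let ?b = "exp (\<bar>\<mu>\<bar> * (norm x + 1)) * ((1 + \<mu>\<^sup>2) / \<delta>\<^sup>2) * L"
    have L: "L \<ge> 0" using sb unfolding supported_bounded_def by (meson abs_ge_zero order_trans)
    show "integrable (lborel \<Otimes>\<^sub>M lborel) (\<lambda>(\<phi>, y). indicator {0..2*pi} \<phi> * (g y * ?e \<phi> y))"
    proof (rule Bochner_Integration.integrable_bound)
      have "integrable (lborel :: (real \<times> (real^2)) measure) (\<lambda>p. indicator ({0..2*pi} \<times> cball 0 1) p *\<^sub>R ?b)"
        by (rule borel_integrable_compact) (auto intro: compact_Times)
      then show "integrable (lborel \<Otimes>\<^sub>M lborel) (\<lambda>p :: real \<times> (real^2). indicator ({0..2*pi} \<times> cball 0 1) p *\<^sub>R ?b)"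
        by (simp only: lborel_prod)
      show "AE p in lborel \<Otimes>\<^sub>M lborel. norm (case p of (\<phi>, y) \<Rightarrow> indicator {0..2*pi} \<phi> * (g y * ?e \<phi> y)) \<le> norm (indicator ({0..2*pi} \<times> cball 0 1) p *\<^sub>R ?b)"
      proof (rule AE_I2)
        fix p :: "real \<times> (real^2)"
        obtain \<phi> y where p: "p = (\<phi>, y)" by (cases p)
        show "norm (case p of (\<phi>, y) \<Rightarrow> indicator {0..2*pi} \<phi> * (g y * ?e \<phi> y)) \<le> norm (indicator ({0..2*pi} \<times> cball 0 1) p *\<^sub>R ?b)"
        proof (cases "norm y \<le> 1")
          case True
          have "\<bar>\<mu>\<bar> * norm (x - y) \<le> \<bar>\<mu>\<bar> * (norm x + 1)"
            using norm_triangle_ineq4[of x y] True by (intro mult_left_mono) auto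
          then have "exp (- \<mu> * ((x - y) \<bullet> perp (circ \<phi>))) \<le> exp (\<bar>\<mu>\<bar> * (norm x + 1))"
            using exp_weight_bound[of \<mu> "x - y" \<phi>] by (meson exp_le_cancel_iff order_trans)
          then have "\<bar>?e \<phi> y\<bar> \<le> exp (\<bar>\<mu>\<bar> * (norm x + 1)) * ((1 + \<mu>\<^sup>2) / \<delta>\<^sup>2)"
            unfolding abs_mult using M by (intro mult_mono) auto
          then have "\<bar>?e \<phi> y\<bar> * \<bar>g y\<bar> \<le> ?b"
            using sb unfolding supported_bounded_def by (intro mult_mono) auto
          then have "\<bar>g y * ?e \<phi> y\<bar> \<le> ?b" unfolding abs_mult[of "g y"] mult.commute[of "\<bar>g y\<bar>"] .
          then have "\<bar>g y * ?e \<phi> y\<bar> \<le> \<bar>?b\<bar>" by (rule order_trans[OF _ abs_ge_self])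
          then show ?thesis using True by (auto simp: p indicator_def)
        next
          case False
          then show ?thesis using sb by (simp add: p supported_bounded_def)
        qed
      qed
    qed measurable
  qed
  also have "\<dots> = (\<integral>y. g y * (LBINT \<phi>:{0..2*pi}. ?e \<phi> y) \<partial>lborel)"
    unfolding set_lebesgue_integral_def by (simp add: mult.left_commute)
  finally show ?thesis unfolding band_limited_kern[OF sb d(1), where \<mu>=\<mu>] .
qed

section \<open>Exponential moments\<close>

text \<open>Completing the square.\<close>

lemma gaussian_mgf:
  assumes "\<sigma> > 0"
  shows "(\<integral>\<^sup>+e. ennreal (exp (a * (c + e))) \<partial>noise \<sigma>) = ennreal (exp (a * c + a\<^sup>2 * \<sigma>\<^sup>2 / 2))"
proof -
  have "ennreal (normal_density 0 \<sigma> e) * ennreal (exp (a * (c + e))) = ennreal (exp (a * c + a\<^sup>2 * \<sigma>\<^sup>2 / 2)) * ennreal (normal_density (a * \<sigma>\<^sup>2) \<sigma> e)" for e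
  proof -
    have "- (e - 0)\<^sup>2 / (2 * \<sigma>\<^sup>2) + a * (c + e) = (a * c + a\<^sup>2 * \<sigma>\<^sup>2 / 2) + - (e - a * \<sigma>\<^sup>2)\<^sup>2 / (2 * \<sigma>\<^sup>2)"
      using assms by (simp add: field_simps power2_eq_square)
    then have "exp (- (e - 0)\<^sup>2 / (2 * \<sigma>\<^sup>2)) * exp (a * (c + e)) = exp (a * c + a\<^sup>2 * \<sigma>\<^sup>2 / 2) * exp (- (e - a * \<sigma>\<^sup>2)\<^sup>2 / (2 * \<sigma>\<^sup>2))"
      by (simp only: exp_add[symmetric])
    then have "normal_density 0 \<sigma> e * exp (a * (c + e)) = exp (a * c + a\<^sup>2 * \<sigma>\<^sup>2 / 2) * normal_density (a * \<sigma>\<^sup>2) \<sigma> e"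
      unfolding normal_density_def by (simp only: mult.assoc mult.left_commute)
    then show ?thesis by (simp only: ennreal_mult[symmetric] normal_density_nonneg exp_ge_zero)
  qed
  then have "(\<integral>\<^sup>+e. ennreal (exp (a * (c + e))) \<partial>noise \<sigma>) = (\<integral>\<^sup>+e. ennreal (exp (a * c + a\<^sup>2 * \<sigma>\<^sup>2 / 2)) * ennreal (normal_density (a * \<sigma>\<^sup>2) \<sigma> e) \<partial>lborel)"
    unfolding noise_def by (subst nn_integral_density) auto
  also have "\<dots> = ennreal (exp (a * c + a\<^sup>2 * \<sigma>\<^sup>2 / 2)) * (\<integral>\<^sup>+e. ennreal (normal_density (a * \<sigma>\<^sup>2) \<sigma> e) \<partial>lborel)"
    by (rule nn_integral_cmult) simp
  also have "(\<integral>\<^sup>+e. ennreal (normal_density (a * \<sigma>\<^sup>2) \<sigma> e) \<partial>lborel) = 1"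
    using prob_space.emeasure_space_1[OF prob_space_normal_density[OF assms, of "a * \<sigma>\<^sup>2"]]
    by (simp add: emeasure_density)
  finally show ?thesis by simp
qed

lemma exp_le_quadratic: 
  fixes u :: real assumes "\<bar>u\<bar> \<le> 1" shows "exp u \<le> 1 + u + u\<^sup>2"
proof (cases "0 \<le> u")
  case True
  then show ?thesis using exp_bound[of u] assms by simp
next
  case False
  have "1 - u \<le> exp (- u)" using exp_ge_add_one_self[of "- u"] by simp
  then have "exp u * (1 - u) \<le> exp u * exp (- u)" by (intro mult_left_mono) auto
  then have "exp u * (1 - u) \<le> 1" by (simp add: exp_minus_inverse)
  also have "1 \<le> (1 + u + u\<^sup>2) * (1 - u)"
  proof -
    have "0 \<le> u\<^sup>2 * (- u)" using False by (intro mult_nonneg_nonneg) auto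
    then show ?thesis by (simp add: algebra_simps power2_eq_square)
  qed
  finally show ?thesis using False by (simp add: mult_le_cancel_right)
qed

definition radon_sup :: "real \<Rightarrow> real \<Rightarrow> real" where
  "radon_sup \<mu> L = 2 * L * exp \<bar>\<mu>\<bar>"

definition weight_sup :: "real \<Rightarrow> real^2 \<Rightarrow> real" where
  "weight_sup \<mu> x = exp (\<bar>\<mu>\<bar> * norm x)"

text \<open>The exponential moment bounds below hold for exponents up to \<open>n\<close> divided by this constant and by the
  supremum of the kernel.\<close>

definition mgf_range :: "real \<Rightarrow> real \<Rightarrow> real \<Rightarrow> real^2 \<Rightarrow> real" where
  "mgf_range \<mu> \<sigma> L x = weight_sup \<mu> x * (1 + radon_sup \<mu> L + \<sigma>\<^sup>2 / 2)"

text \<open>The variance factor in the exponential moment bounds, relative to the squared \<open>L\<^sup>2\<close> norm of the kernel.\<close>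

definition mgf_const :: "real \<Rightarrow> real \<Rightarrow> real \<Rightarrow> real^2 \<Rightarrow> real" where
  "mgf_const \<mu> \<sigma> L x = (\<sigma>\<^sup>2 / 2 + (radon_sup \<mu> L + \<sigma>\<^sup>2 / 2)\<^sup>2) * ((weight_sup \<mu> x)\<^sup>2 / 2)"

text \<open>Given the design point, the exponential moment over the Gaussian noise is the exponential of a quadratic
  in the weight. In the admissible range of \<open>c\<close> this exponent is at most one in absolute value, so the
  exponential is bounded by its quadratic expansion, whose expectation is computed term by term.\<close>

lemma observation_mgf:
  assumes \<sigma>: "\<sigma> > 0" and L: "L > 0" and sb: "supported_bounded L g" and km [measurable]: "k \<in> borel_measurable borel" and M: "\<And>u. \<bar>k u\<bar> \<le> M"
    and k2: "integrable lborel (\<lambda>u. (k u)\<^sup>2)" and c: "\<bar>c\<bar> * (M * mgf_range \<mu> \<sigma> L x) \<le> 1"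
  shows "(\<integral>\<^sup>+p. (\<integral>\<^sup>+e. ennreal (exp (c * (weight \<mu> x k (fst p) (snd p) * (radon \<mu> g (circ (fst p)) (snd p) + e)))) \<partial>noise \<sigma>) \<partial>unif_design)
    \<le> ennreal (exp (c * mean_functional \<mu> g x k + c\<^sup>2 * mgf_const \<mu> \<sigma> L x * (LBINT u. (k u)\<^sup>2)))"
proof -
  have gm [measurable]: "g \<in> borel_measurable borel" using sb by (simp add: supported_bounded_def)
  interpret prob_space unif_design by (rule prob_space_unif_design)
  define A where "A = radon_sup \<mu> L"
  define q where "q = weight_sup \<mu> x"
  define W where "W p = weight \<mu> x k (fst p) (snd p)" for p
  define T where "T p = radon \<mu> g (circ (fst p)) (snd p)" for p
  define I where "I = (LBINT u. (k u)\<^sup>2)"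
  define K where "K = \<sigma>\<^sup>2 / 2 + (A + \<sigma>\<^sup>2 / 2)\<^sup>2"
  have [measurable]: "W \<in> borel_measurable unif_design" "T \<in> borel_measurable unif_design"
    unfolding W_def[abs_def] T_def[abs_def] by measurable
  have A: "A > 0" using L by (simp add: A_def radon_sup_def)
  have q: "q > 0" by (simp add: q_def weight_sup_def)
  have M0: "M \<ge> 0" using M[of 0] by linarith
  have K0: "K > 0" using A \<sigma> by (simp add: K_def add_pos_nonneg)
  have T: "\<bar>T p\<bar> \<le> A" for p using radon_bound[OF sb] by (simp add: T_def A_def radon_sup_def)
  have W: "\<bar>W p\<bar> \<le> q * M" for p using weight_bound[of k M, OF M] by (simp add: W_def q_def weight_sup_def)
  have cW: "\<bar>c * W p\<bar> * (1 + A + \<sigma>\<^sup>2 / 2) \<le> 1" for p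
  proof -
    have "\<bar>c * W p\<bar> * (1 + A + \<sigma>\<^sup>2 / 2) \<le> (\<bar>c\<bar> * (q * M)) * (1 + A + \<sigma>\<^sup>2 / 2)"
      unfolding abs_mult using W A by (intro mult_right_mono mult_left_mono) auto
    also have "\<dots> = \<bar>c\<bar> * (M * mgf_range \<mu> \<sigma> L x)" by (simp add: mgf_range_def q_def A_def)
    finally show ?thesis using c by simp
  qed
  define v where "v p = 1 + c * (W p * T p) + c\<^sup>2 * K * (W p)\<^sup>2" for p
  have pw: "exp (c * W p * T p + (c * W p)\<^sup>2 * \<sigma>\<^sup>2 / 2) \<le> v p" for p
  proof -
    define y where "y = \<bar>c * W p\<bar>"
    define u where "u = c * W p * T p + (c * W p)\<^sup>2 * \<sigma>\<^sup>2 / 2"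
    have y0: "y \<ge> 0" by (simp add: y_def)
    have yb: "y * (1 + A + \<sigma>\<^sup>2 / 2) \<le> 1" using cW by (simp add: y_def)
    have "y * 1 \<le> y * (1 + A + \<sigma>\<^sup>2 / 2)" using y0 A by (intro mult_left_mono) auto
    then have y1: "y \<le> 1" using yb by simp
    have y2: "y\<^sup>2 \<le> y" using y0 y1 by (simp add: power2_eq_square mult_left_le)
    have "\<bar>u\<bar> \<le> y * \<bar>T p\<bar> + y\<^sup>2 * (\<sigma>\<^sup>2 / 2)"
    proof -
      have "\<bar>u\<bar> \<le> \<bar>c * W p * T p\<bar> + \<bar>(c * W p)\<^sup>2 * \<sigma>\<^sup>2 / 2\<bar>" unfolding u_def by (rule abs_triangle_ineq)
      moreover have "\<bar>c * W p * T p\<bar> = y * \<bar>T p\<bar>" unfolding y_def by (rule abs_mult)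
      moreover have y2e: "(c * W p)\<^sup>2 = y\<^sup>2" by (simp add: y_def)
      have "\<bar>(c * W p)\<^sup>2 * \<sigma>\<^sup>2 / 2\<bar> = y\<^sup>2 * (\<sigma>\<^sup>2 / 2)" unfolding y2e by simp
      ultimately show ?thesis by linarith
    qed
    also have "\<dots> \<le> y * A + y * (\<sigma>\<^sup>2 / 2)"
      using T y0 y2 by (intro add_mono mult_left_mono mult_right_mono) auto
    finally have u1: "\<bar>u\<bar> \<le> y * (A + \<sigma>\<^sup>2 / 2)" by (simp add: algebra_simps)
    also have "\<dots> \<le> y * (1 + A + \<sigma>\<^sup>2 / 2)" using y0 by (intro mult_left_mono) auto
    finally have "\<bar>u\<bar> \<le> 1" using yb by simp
    then have "exp u \<le> 1 + u + u\<^sup>2" by (rule exp_le_quadratic)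
    also have "u\<^sup>2 \<le> (y * (A + \<sigma>\<^sup>2 / 2))\<^sup>2"
      using power_mono[OF u1, of 2] by simp
    also have "1 + u + (y * (A + \<sigma>\<^sup>2 / 2))\<^sup>2 = v p"
      unfolding u_def v_def K_def power_mult_distrib by (simp add: y_def power_mult_distrib algebra_simps)
    finally show ?thesis unfolding u_def by simp
  qed
  have W2: "integrable unif_design (\<lambda>p. (W p)\<^sup>2)"
    by (rule integrable_const_bound[where B="(q * M)\<^sup>2"]) (use W in \<open>auto intro!: AE_I2 power2_le_iff_abs_le[THEN iffD2] mult_nonneg_nonneg M0 less_imp_le[OF q]\<close>)
  have WT: "integrable unif_design (\<lambda>p. W p * T p)"
    unfolding W_def T_def by (rule weight_radon_integrable[OF sb km M])
  have W2_le: "(\<integral>p. (W p)\<^sup>2 \<partial>unif_design) \<le> q\<^sup>2 / 2 * I"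
  proof -
    have I0: "I \<ge> 0" unfolding I_def by (rule Bochner_Integration.integral_nonneg) auto
    have "ennreal (\<integral>p. (W p)\<^sup>2 \<partial>unif_design) = (\<integral>\<^sup>+p. ennreal ((W p)\<^sup>2) \<partial>unif_design)"
      by (rule nn_integral_eq_integral[OF W2, symmetric]) auto
    also have "\<dots> \<le> ennreal (q\<^sup>2 / 2 * I)"
      unfolding W_def q_def weight_sup_def I_def by (rule weight_square_integral[OF km k2])
    finally show ?thesis using I0 by (simp add: ennreal_le_iff)
  qed
  have v_int: "integrable unif_design v" unfolding v_def[abs_def] using W2 WT by simp
  have v_eq: "(\<integral>p. v p \<partial>unif_design) = 1 + c * mean_functional \<mu> g x k + c\<^sup>2 * K * (\<integral>p. (W p)\<^sup>2 \<partial>unif_design)"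
    unfolding v_def using W2 WT by (simp add: prob_space mean_functional_def W_def T_def)
  have "(\<integral>\<^sup>+p. (\<integral>\<^sup>+e. ennreal (exp (c * (W p * (T p + e)))) \<partial>noise \<sigma>) \<partial>unif_design) = (\<integral>\<^sup>+p. ennreal (exp (c * W p * T p + (c * W p)\<^sup>2 * \<sigma>\<^sup>2 / 2)) \<partial>unif_design)"
    unfolding mult.assoc[symmetric, of c] gaussian_mgf[OF \<sigma>] ..
  also have "\<dots> \<le> (\<integral>\<^sup>+p. ennreal (v p) \<partial>unif_design)" by (intro nn_integral_mono ennreal_leI pw)
  also have "\<dots> = ennreal (\<integral>p. v p \<partial>unif_design)"
    by (rule nn_integral_eq_integral[OF v_int]) (use pw in \<open>auto intro!: AE_I2 intro: order_trans[OF exp_ge_zero]\<close>)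
  also have "\<dots> \<le> ennreal (exp (c * mean_functional \<mu> g x k + c\<^sup>2 * mgf_const \<mu> \<sigma> L x * I))"
  proof (rule ennreal_leI)
    have "c\<^sup>2 * K * (\<integral>p. (W p)\<^sup>2 \<partial>unif_design) \<le> c\<^sup>2 * K * (q\<^sup>2 / 2 * I)"
      using W2_le K0 by (intro mult_left_mono) auto
    also have "\<dots> = c\<^sup>2 * mgf_const \<mu> \<sigma> L x * I" by (simp add: mgf_const_def K_def A_def q_def)
    finally have "(\<integral>p. v p \<partial>unif_design) \<le> 1 + (c * mean_functional \<mu> g x k + c\<^sup>2 * mgf_const \<mu> \<sigma> L x * I)"
      unfolding v_eq by simp
    also have "\<dots> \<le> exp (c * mean_functional \<mu> g x k + c\<^sup>2 * mgf_const \<mu> \<sigma> L x * I)" by (rule exp_ge_add_one_self)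
    finally show "(\<integral>p. v p \<partial>unif_design) \<le> exp (c * mean_functional \<mu> g x k + c\<^sup>2 * mgf_const \<mu> \<sigma> L x * I)" .
  qed
  finally show ?thesis unfolding W_def T_def I_def .
qed

definition score :: "real \<Rightarrow> real^2 \<Rightarrow> (real \<Rightarrow> real) \<Rightarrow> (real^2) \<times> real \<times> real \<Rightarrow> real" where
  "score \<mu> x k z = (case z of (\<theta>, s, Y) \<Rightarrow> exp (- \<mu> * (x \<bullet> perp \<theta>)) * k (x \<bullet> \<theta> - s) * Y)"

lemma score_measurable [measurable (raw)]:
  assumes [measurable]: "k \<in> borel_measurable borel" and f: "f \<in> M \<rightarrow>\<^sub>M borel"
  shows "(\<lambda>z. score \<mu> x k (f z)) \<in> borel_measurable M"
proof (rule measurable_compose[OF f])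
  show "score \<mu> x k \<in> borel_measurable borel"
    unfolding score_def[abs_def] borel_prod[symmetric] by measurable
qed

text \<open>The law of the sample depends on \<open>f\<close> only through a bounded Borel version \<open>g\<close> of it.\<close>

locale observation =
  fixes \<mu> \<sigma> L :: real and f g :: "real^2 \<Rightarrow> real"
  assumes sigma_pos: "\<sigma> > 0" and L_pos: "L > 0" and sb: "supported_bounded L g" and ae: "AE y in lborel. f y = g y"
begin

lemma g_measurable [measurable]: "g \<in> borel_measurable borel" using sb by (simp add: supported_bounded_def)

lemma obs_map_measurable: "(\<lambda>((\<phi>, s), e). (circ \<phi>, s, radon \<mu> g (circ \<phi>) s + e)) \<in> unif_design \<Otimes>\<^sub>M noise \<sigma> \<rightarrow>\<^sub>M borel"
  unfolding borel_prod[symmetric] case_prod_beta' by measurable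

lemma prob_space_obs: "prob_space (obs_law \<mu> \<sigma> f)"
proof -
  interpret N: prob_space "noise \<sigma>" by (rule prob_space_noise[OF sigma_pos])
  interpret U: prob_space unif_design by (rule prob_space_unif_design)
  interpret P: pair_prob_space unif_design "noise \<sigma>" ..
  show ?thesis unfolding obs_law_eq[OF sigma_pos sb ae]
    by (rule P.prob_space_distr[OF obs_map_measurable])
qed

lemma sets_obs_law [measurable_cong]: "sets (obs_law \<mu> \<sigma> f) = sets borel"
  by (simp add: obs_law_def)

lemma score_mgf:
  assumes km [measurable]: "k \<in> borel_measurable borel" and M: "\<And>u. \<bar>k u\<bar> \<le> M"
    and k2: "integrable lborel (\<lambda>u. (k u)\<^sup>2)" and c: "\<bar>c\<bar> * (M * mgf_range \<mu> \<sigma> L x) \<le> 1"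
  shows "(\<integral>\<^sup>+z. ennreal (exp (c * score \<mu> x k z)) \<partial>obs_law \<mu> \<sigma> f) \<le>
    ennreal (exp (c * mean_functional \<mu> g x k + c\<^sup>2 * mgf_const \<mu> \<sigma> L x * (LBINT u. (k u)\<^sup>2)))"
proof -
  interpret N: prob_space "noise \<sigma>" by (rule prob_space_noise[OF sigma_pos])
  let ?h = "\<lambda>z. ennreal (exp (c * score \<mu> x k z))"
  let ?m = "\<lambda>((\<phi>, s), e). (circ \<phi>, s, radon \<mu> g (circ \<phi>) s + e)"
  have mh: "?h \<in> borel_measurable borel" by measurable
  have "(\<integral>\<^sup>+z. ?h z \<partial>obs_law \<mu> \<sigma> f) = (\<integral>\<^sup>+p. ?h (?m p) \<partial>(unif_design \<Otimes>\<^sub>M noise \<sigma>))"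
    unfolding obs_law_eq[OF sigma_pos sb ae] by (rule nn_integral_distr[OF obs_map_measurable]) (use mh in simp)
  also have "\<dots> = (\<integral>\<^sup>+p. (\<integral>\<^sup>+e. ?h (?m (p, e)) \<partial>noise \<sigma>) \<partial>unif_design)"
    by (rule N.nn_integral_fst[symmetric]) (rule measurable_compose[OF obs_map_measurable mh])
  also have "\<dots> = (\<integral>\<^sup>+p. (\<integral>\<^sup>+e. ennreal (exp (c * (weight \<mu> x k (fst p) (snd p) * (radon \<mu> g (circ (fst p)) (snd p) + e)))) \<partial>noise \<sigma>) \<partial>unif_design)"
    by (intro nn_integral_cong) (auto simp: score_def weight_def split_beta)
  also have "\<dots> \<le> ennreal (exp (c * mean_functional \<mu> g x k + c\<^sup>2 * mgf_const \<mu> \<sigma> L x * (LBINT u. (k u)\<^sup>2)))"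
    by (rule observation_mgf[OF sigma_pos L_pos sb km M k2 c])
  finally show ?thesis .
qed

end

definition linear_estimator :: "real \<Rightarrow> nat \<Rightarrow> (real \<Rightarrow> real) \<Rightarrow> real^2 \<Rightarrow> (nat \<Rightarrow> (real^2) \<times> real \<times> real) \<Rightarrow> real" where
  "linear_estimator \<mu> n k x \<omega> = (1 / real n) * (\<Sum>i=1..n. score \<mu> x k (\<omega> i))"

lemma fbar_eq_linear: "fbar \<mu> n \<delta> x = linear_estimator \<mu> n (kern \<mu> \<delta>) x"
  by (simp add: fbar_def linear_estimator_def score_def fun_eq_iff)

lemma linear_estimator_diff:
  "linear_estimator \<mu> n k x \<omega> - linear_estimator \<mu> n k' x \<omega> = linear_estimator \<mu> n (\<lambda>u. k u - k' u) x \<omega>"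
  unfolding linear_estimator_def right_diff_distrib[symmetric] sum_subtractf[symmetric]
  by (intro arg_cong2[where f="(*)"] sum.cong refl) (simp add: score_def split_beta algebra_simps)

context observation begin

abbreviation "S n \<equiv> sample_law \<mu> \<sigma> f n"

lemma prob_space_sample: "prob_space (S n)"
  unfolding sample_law_def by (intro prob_space_PiM prob_space_obs)

lemma score_component_measurable:
  assumes "k \<in> borel_measurable borel" "i \<in> {1..n}"
  shows "(\<lambda>\<omega>. score \<mu> x k (\<omega> i)) \<in> borel_measurable (Pi\<^sub>M {1..n} (\<lambda>_. obs_law \<mu> \<sigma> f))"
proof (rule score_measurable[OF assms(1)])
  have "(\<lambda>\<omega>. \<omega> i) \<in> Pi\<^sub>M {1..n} (\<lambda>_. obs_law \<mu> \<sigma> f) \<rightarrow>\<^sub>M obs_law \<mu> \<sigma> f"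
    by (rule measurable_component_singleton[OF assms(2)])
  then show "(\<lambda>\<omega>. \<omega> i) \<in> Pi\<^sub>M {1..n} (\<lambda>_. obs_law \<mu> \<sigma> f) \<rightarrow>\<^sub>M borel"
    by (simp only: measurable_cong_sets[OF refl sets_obs_law])
qed

lemma linear_estimator_measurable:
  assumes "k \<in> borel_measurable borel"
  shows "linear_estimator \<mu> n k x \<in> borel_measurable (S n)"
  unfolding linear_estimator_def[abs_def] sample_law_def
  by (intro borel_measurable_times borel_measurable_const borel_measurable_sum score_component_measurable assms)

text \<open>Independence turns the bound for one observation with exponent \<open>c / n\<close> into its \<open>n\<close>-th power.\<close>

lemma linear_estimator_mgf:
  assumes n: "n \<ge> 1" and km [measurable]: "k \<in> borel_measurable borel" and M: "\<And>u. \<bar>k u\<bar> \<le> M"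
    and k2: "integrable lborel (\<lambda>u. (k u)\<^sup>2)" and c: "\<bar>c\<bar> * (M * mgf_range \<mu> \<sigma> L x) \<le> real n"
  shows "(\<integral>\<^sup>+\<omega>. ennreal (exp (c * (linear_estimator \<mu> n k x \<omega> - mean_functional \<mu> g x k))) \<partial>S n) \<le>
    ennreal (exp (c\<^sup>2 * mgf_const \<mu> \<sigma> L x * (LBINT u. (k u)\<^sup>2) / real n))"
proof -
  interpret O: prob_space "obs_law \<mu> \<sigma> f" by (rule prob_space_obs)
  interpret PS: product_sigma_finite "\<lambda>_::nat. obs_law \<mu> \<sigma> f" by unfold_locales
  let ?m = "mean_functional \<mu> g x k" and ?I = "LBINT u. (k u)\<^sup>2" and ?K = "mgf_const \<mu> \<sigma> L x"
  let ?d = "c / real n"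
  have d: "\<bar>?d\<bar> * (M * mgf_range \<mu> \<sigma> L x) \<le> 1" using c n by (simp add: divide_le_eq)
  have e: "ennreal (exp (c * (linear_estimator \<mu> n k x \<omega> - ?m))) = ennreal (exp (- c * ?m)) * (\<Prod>i\<in>{1..n}. ennreal (exp (?d * score \<mu> x k (\<omega> i))))" for \<omega>
  proof -
    have "c * (linear_estimator \<mu> n k x \<omega> - ?m) = - c * ?m + (\<Sum>i\<in>{1..n}. ?d * score \<mu> x k (\<omega> i))"
      unfolding linear_estimator_def sum_distrib_left[symmetric] by (simp add: right_diff_distrib)
    then have "exp (c * (linear_estimator \<mu> n k x \<omega> - ?m)) = exp (- c * ?m) * (\<Prod>i\<in>{1..n}. exp (?d * score \<mu> x k (\<omega> i)))"
      by (simp only: exp_add exp_sum finite_atLeastAtMost)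
    then show ?thesis by (simp only: ennreal_mult[OF exp_ge_zero prod_nonneg[OF exp_ge_zero]] prod_ennreal[OF exp_ge_zero])
  qed
  let ?P = "\<integral>\<^sup>+\<omega>. (\<Prod>i\<in>{1..n}. ennreal (exp (?d * score \<mu> x k (\<omega> i)))) \<partial>S n"
  have "?P = (\<Prod>i\<in>{1..n}. (\<integral>\<^sup>+z. ennreal (exp (?d * score \<mu> x k z)) \<partial>obs_law \<mu> \<sigma> f))"
    unfolding sample_law_def
  proof (rule PS.product_nn_integral_prod)
    have "(\<lambda>z. ennreal (exp (?d * score \<mu> x k z))) \<in> borel_measurable borel" by measurable
    then show "(\<lambda>z. ennreal (exp (?d * score \<mu> x k z))) \<in> borel_measurable (obs_law \<mu> \<sigma> f)"
      by (simp only: measurable_cong_sets[OF sets_obs_law refl])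
  qed simp
  also have "\<dots> = (\<integral>\<^sup>+z. ennreal (exp (?d * score \<mu> x k z)) \<partial>obs_law \<mu> \<sigma> f) ^ n"
    by (simp only: prod_constant card_atLeastAtMost diff_Suc_1)
  also have "\<dots> \<le> ennreal (exp (?d * ?m + ?d\<^sup>2 * ?K * ?I)) ^ n"
    by (rule power_mono[OF score_mgf[OF km M k2 d] zero_le])
  also have "\<dots> = ennreal (exp (?d * ?m + ?d\<^sup>2 * ?K * ?I) ^ n)"
    by (rule ennreal_power) (rule exp_ge_zero)
  also have "\<dots> = ennreal (exp (real n * (?d * ?m + ?d\<^sup>2 * ?K * ?I)))"
    by (simp only: exp_of_nat_mult)
  finally have P: "?P \<le> ennreal (exp (real n * (?d * ?m + ?d\<^sup>2 * ?K * ?I)))" .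
  have "(\<integral>\<^sup>+\<omega>. ennreal (exp (c * (linear_estimator \<mu> n k x \<omega> - ?m))) \<partial>S n) = ennreal (exp (- c * ?m)) * ?P"
    unfolding e sample_law_def
  proof (rule nn_integral_cmult, rule borel_measurable_prod_ennreal)
    fix i assume i: "i \<in> {1..n}"
    show "(\<lambda>\<omega>. ennreal (exp (?d * score \<mu> x k (\<omega> i)))) \<in> borel_measurable (Pi\<^sub>M {1..n} (\<lambda>_. obs_law \<mu> \<sigma> f))"
      by (rule measurable_compose[OF score_component_measurable[OF km i], of "\<lambda>y. ennreal (exp (?d * y))"]) measurable
  qed
  also have "\<dots> \<le> ennreal (exp (- c * ?m)) * ennreal (exp (real n * (?d * ?m + ?d\<^sup>2 * ?K * ?I)))"
    by (rule mult_left_mono[OF P zero_le])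
  also have "\<dots> = ennreal (exp (- c * ?m + real n * (?d * ?m + ?d\<^sup>2 * ?K * ?I)))"
    unfolding exp_add by (rule ennreal_mult[symmetric]) (rule exp_ge_zero)+
  also have "- c * ?m + real n * (?d * ?m + ?d\<^sup>2 * ?K * ?I) = c\<^sup>2 * ?K * ?I / real n"
  proof -
    have nd: "real n * ?d = c" using n by simp
    have "real n * (?d * ?m + ?d\<^sup>2 * ?K * ?I) = (real n * ?d) * ?m + (real n * ?d) * ?d * ?K * ?I"
      by (simp only: power2_eq_square distrib_left mult.assoc)
    then show ?thesis unfolding nd by (simp add: power2_eq_square)
  qed
  finally show ?thesis .
qed

end

section \<open>Moments and deviations of the estimators\<close>

text \<open>The odd terms of the two Taylor expansions cancel.\<close>

lemma even_power_le_exp_sum: "(y::real)\<^sup>2 \<le> exp y + exp (- y)" "(y::real) ^ 4 \<le> 12 * (exp y + exp (- y))"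
proof -
  obtain t where t: "exp y = (\<Sum>m<6. y ^ m / fact m) + exp t / fact 6 * y ^ 6" using Maclaurin_exp_le[of y 6] by blast
  obtain u where u: "exp (- y) = (\<Sum>m<6. (- y) ^ m / fact m) + exp u / fact 6 * (- y) ^ 6" using Maclaurin_exp_le[of "- y" 6] by blast
  have p: "(\<Sum>m<6. y ^ m / fact m) + (\<Sum>m<6. (- y) ^ m / fact m) = 2 + y ^ 2 + y ^ 4 / 12"
    by (simp add: eval_nat_numeral fact_numeral lessThan_Suc field_simps)
  have "0 \<le> exp t / fact 6 * y ^ 6" "0 \<le> exp u / fact 6 * (- y) ^ 6"
    by (intro mult_nonneg_nonneg divide_nonneg_nonneg zero_le_even_power; simp)+
  then have "2 + y ^ 2 + y ^ 4 / 12 \<le> exp y + exp (- y)" unfolding t u p[symmetric] by linarith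
  moreover have "0 \<le> y ^ 2" "0 \<le> y ^ 4" by (simp_all add: zero_le_even_power)
  moreover have "c \<le> 12 * X" if "2 + b + c / 12 \<le> X" "0 \<le> b" for b c X :: real
    using that by linarith
  ultimately show "y\<^sup>2 \<le> exp y + exp (- y)" "y ^ 4 \<le> 12 * (exp y + exp (- y))" by (linarith, blast)
qed

lemma mgf_range_pos: "L > 0 \<Longrightarrow> mgf_range \<mu> \<sigma> L x > 0"
  unfolding mgf_range_def weight_sup_def radon_sup_def
  by (intro mult_pos_pos add_pos_nonneg) auto

lemma mgf_const_nonneg: "mgf_const \<mu> \<sigma> L x \<ge> 0"
  unfolding mgf_const_def by (intro mult_nonneg_nonneg add_nonneg_nonneg) auto

context observation begin

definition dev :: "nat \<Rightarrow> real^2 \<Rightarrow> (real \<Rightarrow> real) \<Rightarrow> (nat \<Rightarrow> (real^2) \<times> real \<times> real) \<Rightarrow> real" where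
  "dev n x k \<omega> = linear_estimator \<mu> n k x \<omega> - mean_functional \<mu> g x k"

lemma dev_measurable:
  assumes "k \<in> borel_measurable borel" shows "dev n x k \<in> borel_measurable (S n)"
  unfolding dev_def[abs_def] by (intro borel_measurable_diff linear_estimator_measurable assms borel_measurable_const)

lemma dev_exp_sum:
  assumes n: "n \<ge> 1" and km: "k \<in> borel_measurable borel" and M: "\<And>u. \<bar>k u\<bar> \<le> M"
    and k2: "integrable lborel (\<lambda>u. (k u)\<^sup>2)" and c: "0 \<le> c" "c * (M * mgf_range \<mu> \<sigma> L x) \<le> real n"
  shows "(\<integral>\<^sup>+\<omega>. ennreal (exp (c * dev n x k \<omega>) + exp (- (c * dev n x k \<omega>))) \<partial>S n) \<le>
    ennreal (2 * exp (c\<^sup>2 * mgf_const \<mu> \<sigma> L x * (LBINT u. (k u)\<^sup>2) / real n))"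
proof -
  let ?E = "exp (c\<^sup>2 * mgf_const \<mu> \<sigma> L x * (LBINT u. (k u)\<^sup>2) / real n)"
  note [measurable] = dev_measurable[OF km]
  have 1: "(\<integral>\<^sup>+\<omega>. ennreal (exp (c * dev n x k \<omega>)) \<partial>S n) \<le> ennreal ?E"
    unfolding dev_def by (rule linear_estimator_mgf[OF n km M k2]) (use c in simp)
  have "(\<integral>\<^sup>+\<omega>. ennreal (exp ((- c) * dev n x k \<omega>)) \<partial>S n) \<le> ennreal (exp ((- c)\<^sup>2 * mgf_const \<mu> \<sigma> L x * (LBINT u. (k u)\<^sup>2) / real n))"
    unfolding dev_def by (rule linear_estimator_mgf[OF n km M k2]) (use c in simp)
  then have 2: "(\<integral>\<^sup>+\<omega>. ennreal (exp (- (c * dev n x k \<omega>))) \<partial>S n) \<le> ennreal ?E"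
    by (simp only: mult_minus_left power2_minus)
  have "(\<integral>\<^sup>+\<omega>. ennreal (exp (c * dev n x k \<omega>) + exp (- (c * dev n x k \<omega>))) \<partial>S n) =
    (\<integral>\<^sup>+\<omega>. ennreal (exp (c * dev n x k \<omega>)) + ennreal (exp (- (c * dev n x k \<omega>))) \<partial>S n)"
    by (simp only: ennreal_plus exp_ge_zero)
  also have "\<dots> = (\<integral>\<^sup>+\<omega>. ennreal (exp (c * dev n x k \<omega>)) \<partial>S n) + (\<integral>\<^sup>+\<omega>. ennreal (exp (- (c * dev n x k \<omega>))) \<partial>S n)"
    by (rule nn_integral_add) measurable
  also have "\<dots> \<le> ennreal ?E + ennreal ?E" by (rule add_mono[OF 1 2])
  also have "\<dots> = ennreal (2 * ?E)" by (simp only: ennreal_plus[symmetric] exp_ge_zero mult_2)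
  finally show ?thesis .
qed

text \<open>This form covers moments, where \<open>h\<close> is an even power, and tail probabilities, where \<open>h\<close> is an indicator.\<close>

lemma nn_integral_dev_le:
  assumes n: "n \<ge> 1" and km: "k \<in> borel_measurable borel" and M: "\<And>u. \<bar>k u\<bar> \<le> M"
    and k2: "integrable lborel (\<lambda>u. (k u)\<^sup>2)" and c: "0 \<le> c" "c * (M * mgf_range \<mu> \<sigma> L x) \<le> real n"
    and r: "0 \<le> r" and h: "\<And>y. h y \<le> r * (exp (c * y) + exp (- (c * y)))"
  shows "(\<integral>\<^sup>+\<omega>. ennreal (h (dev n x k \<omega>)) \<partial>S n) \<le>
    ennreal (r * (2 * exp (c\<^sup>2 * mgf_const \<mu> \<sigma> L x * (LBINT u. (k u)\<^sup>2) / real n)))"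
proof -
  note [measurable] = dev_measurable[OF km]
  have "(\<integral>\<^sup>+\<omega>. ennreal (h (dev n x k \<omega>)) \<partial>S n) \<le> (\<integral>\<^sup>+\<omega>. ennreal (r * (exp (c * dev n x k \<omega>) + exp (- (c * dev n x k \<omega>)))) \<partial>S n)"
    by (intro nn_integral_mono ennreal_leI h)
  also have "\<dots> = (\<integral>\<^sup>+\<omega>. ennreal r * ennreal (exp (c * dev n x k \<omega>) + exp (- (c * dev n x k \<omega>))) \<partial>S n)"
    by (simp only: ennreal_mult[OF r add_nonneg_nonneg[OF exp_ge_zero exp_ge_zero]])
  also have "\<dots> = ennreal r * (\<integral>\<^sup>+\<omega>. ennreal (exp (c * dev n x k \<omega>) + exp (- (c * dev n x k \<omega>))) \<partial>S n)"
    by (rule nn_integral_cmult) measurable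
  also have "\<dots> \<le> ennreal r * ennreal (2 * exp (c\<^sup>2 * mgf_const \<mu> \<sigma> L x * (LBINT u. (k u)\<^sup>2) / real n))"
    by (rule mult_left_mono[OF dev_exp_sum[OF n km M k2 c] zero_le])
  also have "\<dots> = ennreal (r * (2 * exp (c\<^sup>2 * mgf_const \<mu> \<sigma> L x * (LBINT u. (k u)\<^sup>2) / real n)))"
    by (rule ennreal_mult[symmetric]) (use r in auto)
  finally show ?thesis .
qed

text \<open>The constant that makes the exponent \<open>scale x * sqrt (n \<delta>\<^sup>3)\<close> admissible for the kernel of bandwidth \<open>\<delta>\<close>,
  provided that \<open>n \<delta> \<ge> 1\<close>.\<close>

definition scale :: "real^2 \<Rightarrow> real" where
  "scale x = 1 / ((1 + \<mu>\<^sup>2) * mgf_range \<mu> \<sigma> L x)"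

definition moment_const :: "real^2 \<Rightarrow> real" where
  "moment_const x = 2 * exp ((scale x)\<^sup>2 * mgf_const \<mu> \<sigma> L x * (20 * (1 + \<mu>\<^sup>2)\<^sup>2))"

lemma scale_pos: "scale x > 0"
proof -
  have "1 + \<mu>\<^sup>2 > 0" by (rule add_pos_nonneg) auto
  then show ?thesis unfolding scale_def using mgf_range_pos[OF L_pos, of \<mu> \<sigma> x] by (intro divide_pos_pos mult_pos_pos) auto
qed

lemma scale_mult: "scale x * ((1 + \<mu>\<^sup>2) * mgf_range \<mu> \<sigma> L x) = 1"
proof -
  have "1 + \<mu>\<^sup>2 > 0" by (rule add_pos_nonneg) auto
  then show ?thesis unfolding scale_def using mgf_range_pos[OF L_pos, of \<mu> \<sigma> x] by simp
qed

text \<open>The deviation of the estimator is sub-Gaussian at its natural scale \<open>(n \<delta>\<^sup>3) powr (- 1 / 2)\<close>. The condition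
  \<open>n \<delta> \<ge> 1\<close> ensures that this scale lies in the range of the exponential moment bound.\<close>

lemma fbar_moments:
  assumes d: "0 < \<delta>" "\<delta> \<le> 1" and nd: "real n * \<delta> \<ge> 1"
  shows "(\<integral>\<^sup>+\<omega>. ennreal ((dev n x (kern \<mu> \<delta>) \<omega>)\<^sup>2) \<partial>S n) \<le> ennreal (moment_const x / (scale x)\<^sup>2 * (1 / (real n * \<delta> ^ 3)))"
    and "(\<integral>\<^sup>+\<omega>. ennreal ((dev n x (kern \<mu> \<delta>) \<omega>) ^ 4) \<partial>S n) \<le> ennreal (12 * moment_const x / (scale x) ^ 4 * (1 / (real n * \<delta> ^ 3))\<^sup>2)"
proof -
  have n: "n \<ge> 1" using nd d by (cases n) auto
  then have n0: "real n > 0" by simp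
  have a: "1 + \<mu>\<^sup>2 > 0" by (rule add_pos_nonneg) auto
  define v where "v = real n * \<delta> ^ 3"
  have v: "v > 0" unfolding v_def using n0 d by simp
  (* The Chernoff exponent is the inverse of the standard deviation, up to a constant. *)
  define c where "c = scale x * sqrt v"
  have c0: "c > 0" using scale_pos v by (simp add: c_def)
  have c2: "c\<^sup>2 = (scale x)\<^sup>2 * v" using v by (simp add: c_def power_mult_distrib)
  have c4: "c ^ 4 = (scale x) ^ 4 * v\<^sup>2"
    using c2 power_mult[of c 2 2] power_mult[of "scale x" 2 2] by (simp add: power_mult_distrib)
  have "sqrt v \<le> real n * \<delta>\<^sup>2"
  proof (rule real_le_lsqrt)
    have "v * 1 \<le> v * (real n * \<delta>)" using nd v by (intro mult_left_mono) auto
    also have "\<dots> = (real n * \<delta>\<^sup>2)\<^sup>2" by (simp add: v_def power2_eq_square power3_eq_cube)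
    finally show "v \<le> (real n * \<delta>\<^sup>2)\<^sup>2" by simp
  qed (use v n0 in auto)
  then have "c * ((1 + \<mu>\<^sup>2) / \<delta>\<^sup>2 * mgf_range \<mu> \<sigma> L x) \<le> scale x * (real n * \<delta>\<^sup>2) * ((1 + \<mu>\<^sup>2) / \<delta>\<^sup>2 * mgf_range \<mu> \<sigma> L x)"
    unfolding c_def using scale_pos[of x] mgf_range_pos[OF L_pos, of \<mu> \<sigma> x] a
    by (intro mult_right_mono mult_left_mono mult_nonneg_nonneg divide_nonneg_nonneg) auto
  also have "\<dots> = real n * (scale x * ((1 + \<mu>\<^sup>2) * mgf_range \<mu> \<sigma> L x))" using d by simp
  also have "\<dots> = real n" unfolding scale_mult by simp
  finally have cM: "c * ((1 + \<mu>\<^sup>2) / \<delta>\<^sup>2 * mgf_range \<mu> \<sigma> L x) \<le> real n" .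
  let ?I = "LBINT u. (kern \<mu> \<delta> u)\<^sup>2"
  have "c\<^sup>2 * mgf_const \<mu> \<sigma> L x * ?I / real n \<le> c\<^sup>2 * mgf_const \<mu> \<sigma> L x * (20 * (1 + \<mu>\<^sup>2)\<^sup>2 / \<delta> ^ 3) / real n"
    using kern_bounds(3)[OF d, of \<mu>] mgf_const_nonneg[of \<mu> \<sigma> L x] n0
    by (intro divide_right_mono mult_left_mono mult_nonneg_nonneg) auto
  also have "\<dots> = (scale x)\<^sup>2 * mgf_const \<mu> \<sigma> L x * (20 * (1 + \<mu>\<^sup>2)\<^sup>2)"
    unfolding c2 v_def using n0 d by simp
  finally have E: "2 * exp (c\<^sup>2 * mgf_const \<mu> \<sigma> L x * ?I / real n) \<le> moment_const x"
    unfolding moment_const_def by simp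
  note dl = nn_integral_dev_le[OF n kern_measurable kern_bounds(1)[OF d] kern_bounds(2)[OF d] less_imp_le[OF c0] cM]
  have "(\<integral>\<^sup>+\<omega>. ennreal ((dev n x (kern \<mu> \<delta>) \<omega>)\<^sup>2) \<partial>S n) \<le> ennreal (1 / c\<^sup>2 * (2 * exp (c\<^sup>2 * mgf_const \<mu> \<sigma> L x * ?I / real n)))"
  proof (rule dl[where h="\<lambda>y. y\<^sup>2"])
    show "y\<^sup>2 \<le> 1 / c\<^sup>2 * (exp (c * y) + exp (- (c * y)))" for y
      using even_power_le_exp_sum(1)[of "c * y"] c0 by (simp add: power_mult_distrib field_simps)
  qed (use c0 in auto)
  also have "\<dots> \<le> ennreal (1 / c\<^sup>2 * moment_const x)" by (intro ennreal_leI mult_left_mono E) auto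
  also have "1 / c\<^sup>2 * moment_const x = moment_const x / (scale x)\<^sup>2 * (1 / (real n * \<delta> ^ 3))" by (simp add: c2 v_def)
  finally show "(\<integral>\<^sup>+\<omega>. ennreal ((dev n x (kern \<mu> \<delta>) \<omega>)\<^sup>2) \<partial>S n) \<le> ennreal (moment_const x / (scale x)\<^sup>2 * (1 / (real n * \<delta> ^ 3)))" .
  have "(\<integral>\<^sup>+\<omega>. ennreal ((dev n x (kern \<mu> \<delta>) \<omega>) ^ 4) \<partial>S n) \<le> ennreal (12 / c ^ 4 * (2 * exp (c\<^sup>2 * mgf_const \<mu> \<sigma> L x * ?I / real n)))"
  proof (rule dl[where h="\<lambda>y. y ^ 4"])
    show "y ^ 4 \<le> 12 / c ^ 4 * (exp (c * y) + exp (- (c * y)))" for y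
    proof -
      have "c ^ 4 * y ^ 4 \<le> 12 * (exp (c * y) + exp (- (c * y)))"
        using even_power_le_exp_sum(2)[of "c * y"] by (simp only: power_mult_distrib)
      moreover have "c ^ 4 > 0" using c0 by simp
      ultimately show ?thesis by (simp add: pos_le_divide_eq mult.commute)
    qed
  qed (use c0 in auto)
  also have "\<dots> \<le> ennreal (12 / c ^ 4 * moment_const x)" using c0 by (intro ennreal_leI mult_left_mono E) auto
  also have "12 / c ^ 4 * moment_const x = 12 * moment_const x / (scale x) ^ 4 * (1 / (real n * \<delta> ^ 3))\<^sup>2"
    by (simp add: c4 v_def power_divide)
  finally show "(\<integral>\<^sup>+\<omega>. ennreal ((dev n x (kern \<mu> \<delta>) \<omega>) ^ 4) \<partial>S n) \<le> ennreal (12 * moment_const x / (scale x) ^ 4 * (1 / (real n * \<delta> ^ 3))\<^sup>2)" .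
qed

text \<open>The counterpart of \<^term>\<open>scale x\<close> for differences of kernels. The square root comes from the lower bound on
  their \<open>L\<^sup>2\<close> norm.\<close>

definition dev_scale :: "real^2 \<Rightarrow> real" where
  "dev_scale x = scale x / sqrt (256 * (1 + \<mu>\<^sup>2))"

text \<open>With \<open>l = ln (1 / \<eta>)\<close> the threshold is at least \<open>sqrt (D2 l)\<close> times the root of \<^const>\<open>var2\<close>. A Chernoff bound whose exponent
  is proportional to \<open>sqrt l\<close> then yields \<open>exp (- p l) = \<eta> powr p\<close>, where \<open>p\<close> grows with \<open>D2\<close>. The exponent is admissible
  because \<open>l \<le> n \<eta>\<close>. The hypothesis on \<open>D2\<close> is what makes \<open>p\<close> at least 11.\<close>

lemma kern_diff_deviation:
  assumes e: "0 < \<eta>" "\<eta> \<le> \<delta> / 2" and d: "\<delta> \<le> 1" and l: "ln (1 / \<eta>) \<le> real n * \<eta>" and c2: "c2 > 0"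
    and D: "((11 + (dev_scale x)\<^sup>2 * mgf_const \<mu> \<sigma> L x) / dev_scale x)\<^sup>2 / c2 \<le> D2"
  shows "(\<integral>\<^sup>+\<omega>. indicator {\<omega>. \<bar>dev n x (\<lambda>u. kern \<mu> \<delta> u - kern \<mu> \<eta> u) \<omega>\<bar> > sqrt (var2 \<mu> c2 n \<delta> \<eta>) * lam D2 \<eta>} \<omega> \<partial>S n) \<le> ennreal (2 * \<eta> ^ 11)"
proof -
  let ?k = "\<lambda>u. kern \<mu> \<delta> u - kern \<mu> \<eta> u"
  define I where "I = (LBINT u. (?k u)\<^sup>2)"
  define l where "l = ln (1 / \<eta>)"
  define \<tau> where "\<tau> = dev_scale x"
  define K where "K = mgf_const \<mu> \<sigma> L x"
  define R where "R = mgf_range \<mu> \<sigma> L x"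
  define A where "A = 1 + \<mu>\<^sup>2"
  have d0: "\<eta> \<le> \<delta>" "\<eta> \<le> 1" "\<eta> < 1" using e d by auto
  have A: "A > 0" unfolding A_def by (rule add_pos_nonneg) auto
  have R: "R > 0" unfolding R_def by (rule mgf_range_pos[OF L_pos])
  have \<tau>: "\<tau> > 0" unfolding \<tau>_def dev_scale_def using scale_pos[of x] A by (simp add: A_def)
  have l0: "l > 0" unfolding l_def using e d0 by simp
  have n: "n \<ge> 1"
  proof (rule ccontr)
    assume "\<not> n \<ge> 1" then have "n = 0" by simp
    then show False using l l0 by (simp add: l_def)
  qed
  then have n0: "real n > 0" by simp
  have I_low: "1 / (256 * A) / \<eta> ^ 3 \<le> I" unfolding I_def A_def by (rule kern_diff_lower[OF e d])
  have "0 < 1 / (256 * A) / \<eta> ^ 3" using A e by simp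
  then have I0: "I > 0" using I_low by linarith
  (* The exponent that is optimal for the threshold, up to the constant \<tau>, which keeps it admissible. *)
  define c where "c = \<tau> * sqrt (real n * l / I)"
  have c0: "c > 0" unfolding c_def using \<tau> n0 l0 I0 by simp
  have c2': "c\<^sup>2 = \<tau>\<^sup>2 * (real n * l / I)" unfolding c_def using n0 l0 I0 by (simp add: power_mult_distrib)
  have cM: "c * (A / \<eta>\<^sup>2 * R) \<le> real n"
  proof (rule power2_le_imp_le)
    have "1 \<le> I * (256 * A * \<eta> ^ 3)" using I_low A e by (simp add: divide_le_eq mult.commute mult.left_commute)
    then have "1 / I \<le> 256 * A * \<eta> ^ 3" using I0 by (simp add: divide_le_eq mult.commute)
    then have "\<tau>\<^sup>2 * (real n * l * (1 / I)) * (A / \<eta>\<^sup>2 * R)\<^sup>2 \<le> \<tau>\<^sup>2 * (real n * (real n * \<eta>) * (256 * A * \<eta> ^ 3)) * (A / \<eta>\<^sup>2 * R)\<^sup>2"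
      using l l0 n0 I0 by (intro mult_right_mono mult_left_mono mult_mono) (auto simp: l_def)
    also have "\<dots> = (real n)\<^sup>2 * ((\<tau>\<^sup>2 * (256 * A)) * (A * R)\<^sup>2)"
      using e by (simp add: power_mult_distrib power_divide power2_eq_square power3_eq_cube)
    also have "\<tau>\<^sup>2 * (256 * A) = (scale x)\<^sup>2" using A by (simp add: \<tau>_def dev_scale_def power_divide A_def)
    also have "(scale x)\<^sup>2 * (A * R)\<^sup>2 = 1" unfolding power_mult_distrib[symmetric] A_def R_def scale_mult by simp
    finally show "(c * (A / \<eta>\<^sup>2 * R))\<^sup>2 \<le> (real n)\<^sup>2" unfolding power_mult_distrib[of c] c2' by simp
  qed simp
  define t where "t = sqrt (var2 \<mu> c2 n \<delta> \<eta>) * lam D2 \<eta>"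
  have D2: "\<tau> * sqrt (c2 * D2) \<ge> 11 + \<tau>\<^sup>2 * K"
  proof -
    have z: "0 \<le> 11 + \<tau>\<^sup>2 * K" unfolding K_def using mgf_const_nonneg[of \<mu> \<sigma> L x] by simp
    have "((11 + \<tau>\<^sup>2 * K) / \<tau>)\<^sup>2 \<le> c2 * D2" using D c2 by (simp add: \<tau>_def K_def divide_le_eq mult.commute)
    then have "(11 + \<tau>\<^sup>2 * K) / \<tau> \<le> sqrt (c2 * D2)" by (rule real_le_rsqrt)
    then show ?thesis using \<tau> by (simp add: divide_le_eq mult.commute)
  qed
  have ct: "c * t \<ge> (11 + \<tau>\<^sup>2 * K) * l"
  proof -
    have v: "var2 \<mu> c2 n \<delta> \<eta> = c2 * I / real n" by (simp add: var2_def I_def)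
    have "sqrt (real n * l / I) * (sqrt (c2 * I / real n) * sqrt (D2 * l)) = sqrt (c2 * D2) * l"
    proof -
      have "(real n * l / I) * ((c2 * I / real n) * (D2 * l)) = (c2 * D2) * l\<^sup>2"
        using n0 I0 by (simp add: power2_eq_square)
      then have "sqrt ((real n * l / I) * ((c2 * I / real n) * (D2 * l))) = sqrt ((c2 * D2) * l\<^sup>2)" by simp
      then show ?thesis using l0 by (simp only: real_sqrt_mult) simp
    qed
    then have "\<tau> * sqrt (c2 * D2) * l = c * (sqrt (c2 * I / real n) * sqrt (D2 * l))"
      unfolding c_def by (simp only: mult.assoc)
    also have "\<dots> \<le> c * t"
      unfolding t_def v lam_def l_def[symmetric] using c0 c2 I0 n0 by (intro mult_left_mono) auto
    finally have "\<tau> * sqrt (c2 * D2) * l \<le> c * t" .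
    moreover have "(11 + \<tau>\<^sup>2 * K) * l \<le> \<tau> * sqrt (c2 * D2) * l" using D2 l0 by (intro mult_right_mono) auto
    ultimately show ?thesis by linarith
  qed
  let ?h = "\<lambda>y::real. if \<bar>y\<bar> > t then 1 else 0 :: real"
  have "(\<integral>\<^sup>+\<omega>. indicator {\<omega>. \<bar>dev n x ?k \<omega>\<bar> > t} \<omega> \<partial>S n) = (\<integral>\<^sup>+\<omega>. ennreal (?h (dev n x ?k \<omega>)) \<partial>S n)"
    by (intro nn_integral_cong) (auto simp: indicator_def)
  also have "\<dots> \<le> ennreal (exp (- (c * t)) * (2 * exp (c\<^sup>2 * mgf_const \<mu> \<sigma> L x * (LBINT u. (?k u)\<^sup>2) / real n)))"
  proof (rule nn_integral_dev_le[OF n])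
    show "?k \<in> borel_measurable borel" by measurable
    show "\<bar>?k u\<bar> \<le> A / \<eta>\<^sup>2" for u unfolding A_def by (rule kern_diff_bounds(1)[OF e(1) d0(1) d])
    show "integrable lborel (\<lambda>u. (?k u)\<^sup>2)" by (rule kern_diff_bounds(2)[OF e(1) d0(1) d])
    show "0 \<le> c" using c0 by simp
    show "c * (A / \<eta>\<^sup>2 * mgf_range \<mu> \<sigma> L x) \<le> real n" using cM unfolding R_def .
    show "0 \<le> exp (- (c * t))" by simp
    fix y :: real
    show "?h y \<le> exp (- (c * t)) * (exp (c * y) + exp (- (c * y)))"
    proof (cases "\<bar>y\<bar> > t")
      case True
      have "c * t \<le> c * \<bar>y\<bar>" using True c0 by (intro mult_left_mono) auto
      then have "exp (c * t) \<le> exp (c * \<bar>y\<bar>)" by simp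
      also have "\<dots> \<le> exp (c * y) + exp (- (c * y))" by (cases "y \<ge> 0") (auto intro: add_increasing add_increasing2)
      finally have "exp (- (c * t)) * exp (c * t) \<le> exp (- (c * t)) * (exp (c * y) + exp (- (c * y)))" by (intro mult_left_mono) auto
      then show ?thesis using True by (simp add: exp_add[symmetric])
    next
      case False
      then show ?thesis by (simp add: add_nonneg_nonneg)
    qed
  qed
  also have "\<dots> \<le> ennreal (2 * \<eta> ^ 11)"
  proof (rule ennreal_leI)
    have "c\<^sup>2 * mgf_const \<mu> \<sigma> L x * (LBINT u. (?k u)\<^sup>2) / real n = \<tau>\<^sup>2 * K * l"
      unfolding c2' I_def[symmetric] K_def[symmetric] using I0 n0 by simp
    then have "exp (- (c * t)) * (2 * exp (c\<^sup>2 * mgf_const \<mu> \<sigma> L x * (LBINT u. (?k u)\<^sup>2) / real n)) = 2 * exp (- (c * t) + \<tau>\<^sup>2 * K * l)"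
      by (simp only: exp_add mult.left_commute)
    also have "\<dots> \<le> 2 * exp (- (11 * l))" using ct by (simp add: algebra_simps)
    also have "exp (- (11 * l)) = \<eta> ^ 11"
    proof -
      have "- (11 * l) = real 11 * ln \<eta>" unfolding l_def using e by (simp add: ln_div)
      then have "exp (- (11 * l)) = exp (ln \<eta>) ^ 11" by (simp only: exp_of_nat_mult)
      then show ?thesis using e by simp
    qed
    finally show "exp (- (c * t)) * (2 * exp (c\<^sup>2 * mgf_const \<mu> \<sigma> L x * (LBINT u. (?k u)\<^sup>2) / real n)) \<le> 2 * \<eta> ^ 11" .
  qed
  finally show ?thesis unfolding t_def .
qed

end

section \<open>The grid and the selection rule\<close>

lemma grid_pos: "n \<ge> 3 \<Longrightarrow> \<delta> \<in> grid a n \<Longrightarrow> 0 < \<delta>"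
proof -
  assume n: "n \<ge> 3" and d: "\<delta> \<in> grid a n"
  have "0 < ln (real n) / real n" using n by simp
  then show "0 < \<delta>" using d unfolding grid_def by auto
qed

lemma ln_nat_ge_1: "n \<ge> 3 \<Longrightarrow> 1 \<le> ln (real n)"
proof -
  assume "n \<ge> 3"
  then have "exp 1 \<le> real n" using exp_le by linarith
  then show ?thesis using \<open>n \<ge> 3\<close> by (simp add: ln_ge_iff)
qed

lemma grid_bounds:
  assumes n: "n \<ge> 3" and d: "\<delta> \<in> grid a n"
  shows "0 < \<delta>" "\<delta> \<le> 1" "ln (real n) \<le> real n * \<delta>" "1 \<le> real n * \<delta>" "ln (1 / \<delta>) \<le> ln (real n)"
proof -
  show d0: "0 < \<delta>" by (rule grid_pos[OF n d])
  show "\<delta> \<le> 1" using d unfolding grid_def by auto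
  have "ln (real n) / real n \<le> \<delta>" using d unfolding grid_def by auto
  then show 1: "ln (real n) \<le> real n * \<delta>" using n by (simp add: divide_le_eq mult.commute)
  then show 2: "1 \<le> real n * \<delta>" using ln_nat_ge_1[OF n] by linarith
  then have "1 / \<delta> \<le> real n" using d0 by (simp add: divide_le_eq)
  then show "ln (1 / \<delta>) \<le> ln (real n)" using d0 n by (intro ln_mono) auto
qed

lemma grid_subset:
  assumes n: "n \<ge> 3" and a: "a \<ge> 2"
  shows "grid a n \<subseteq> (\<lambda>j. 1 / a ^ j) ` {..n}"
proof
  fix \<delta> assume d: "\<delta> \<in> grid a n"
  then obtain j where j: "\<delta> = 1 / a ^ j" unfolding grid_def by auto
  have "1 \<le> real n * (1 / a ^ j)" using grid_bounds(4)[OF n d] j by simp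
  then have "a ^ j \<le> real n" using a by (simp add: le_divide_eq)
  moreover have "2 ^ j \<le> a ^ j" using a by (intro power_mono) auto
  moreover have "real j \<le> 2 ^ j" using less_exp[of j] by (metis less_imp_le of_nat_le_iff of_nat_numeral of_nat_power)
  ultimately have "j \<le> n" by (metis of_nat_le_iff order_trans)
  then show "\<delta> \<in> (\<lambda>j. 1 / a ^ j) ` {..n}" using j by auto
qed

lemma finite_grid: "n \<ge> 3 \<Longrightarrow> a \<ge> 2 \<Longrightarrow> finite (grid a n)"
  by (rule finite_subset[OF grid_subset]) auto

lemma sum_grid_le:
  assumes n: "n \<ge> 3" and a: "a \<ge> 2" and G: "G \<subseteq> grid a n"
  shows "(\<Sum>\<delta>\<in>G. \<delta>) \<le> 2"
proof -
  have a0: "a > 0" using a by simp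
  have "(\<Sum>\<delta>\<in>G. \<delta>) \<le> (\<Sum>\<delta>\<in>(\<lambda>j. 1 / a ^ j) ` {..n}. \<delta>)"
    using G grid_subset[OF n a] a0 by (intro sum_mono2) auto
  also have "\<dots> \<le> (\<Sum>j\<le>n. 1 / a ^ j)"
    using sum_image_le[of "{..n}" "\<lambda>x. x" "\<lambda>j. 1 / a ^ j"] a0 by (simp add: comp_def)
  also have "\<dots> \<le> (\<Sum>j\<le>n. (1 / 2) ^ j)"
  proof (rule sum_mono)
    fix j show "1 / a ^ j \<le> (1 / 2) ^ j"
      unfolding power_one_over using a by (intro divide_left_mono power_mono) auto
  qed
  also have "\<dots> \<le> 2"
    by (subst atMost_atLeast0, subst sum_gp) (simp add: field_simps)
  finally show ?thesis .
qed

lemma grid_gap: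
  assumes a: "a \<ge> 2" and d: "\<delta> \<in> grid a n" "\<eta> \<in> grid a n" and lt: "\<eta> < \<delta>"
  shows "a * \<eta> \<le> \<delta>" "a * \<eta> \<in> grid a n"
proof -
  obtain i j where ij: "\<delta> = 1 / a ^ i" "\<eta> = 1 / a ^ j" using d unfolding grid_def by auto
  have "a ^ i < a ^ j" using lt a unfolding ij by (simp add: divide_less_cancel frac_less2 field_simps)
  then have "i < j" using a by (simp add: power_strict_increasing_iff)
  then obtain k where k: "j = Suc k" "i \<le> k" by (cases j) auto
  have e: "a * \<eta> = 1 / a ^ k" unfolding ij k using a by simp
  show le: "a * \<eta> \<le> \<delta>" unfolding e unfolding ij(1) using a k by (intro divide_left_mono power_increasing) auto
  have "0 < \<eta>" using a ij by simp
  then have "\<eta> \<le> a * \<eta>" using a by simp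
  then show "a * \<eta> \<in> grid a n" using d le e unfolding grid_def by (auto intro: exI[of _ k])
qed

text \<open>The deterministic part of the argument. If the selected bandwidth is at least \<open>\<delta>\<^sub>0\<close>, the selection rule compares
  it with \<open>\<delta>\<^sub>0\<close> directly. If it is some \<open>\<delta> < \<delta>\<^sub>0\<close>, then the next grid point \<open>a * \<delta>\<close> was rejected, which is a bad event;
  in that case the squared error is at most \<open>w \<delta> / 2\<close> times its own square plus \<open>1 / (2 * w \<delta>)\<close> for any positive weight.
  The weight separates the size of the error from the probability of the bad event.\<close>

lemma adaptive_error_split:
  fixes F :: "real \<Rightarrow> real" and \<psi> :: "real \<Rightarrow> real \<Rightarrow> real" and m :: "real \<Rightarrow> real"
  assumes G: "finite G" "\<delta>\<^sub>0 \<in> G" and pos: "\<And>\<delta>. \<delta> \<in> G \<Longrightarrow> 0 < \<delta>"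
    and step: "\<And>\<delta>. \<delta> \<in> G \<Longrightarrow> \<delta> < \<delta>\<^sub>0 \<Longrightarrow> a * \<delta> \<in> G \<and> a * \<delta> \<le> \<delta>\<^sub>0" and a: "a > 1"
    and psi: "\<And>\<delta> \<eta>. \<delta> \<in> G \<Longrightarrow> \<eta> \<in> G \<Longrightarrow> \<eta> \<le> \<delta> \<Longrightarrow> 0 \<le> \<psi> \<delta> \<eta>"
    and psi0: "\<And>\<delta>. \<delta> \<in> G \<Longrightarrow> \<delta>\<^sub>0 \<le> \<delta> \<Longrightarrow> \<psi> \<delta> \<delta>\<^sub>0 \<le> \<Psi>"
    and w: "\<And>\<delta>. \<delta> \<in> G \<Longrightarrow> 0 < w \<delta>"
    and bad: "\<And>\<delta> \<eta>. \<delta> \<in> G \<Longrightarrow> \<eta> \<in> G \<Longrightarrow> \<eta> < \<delta> \<Longrightarrow> \<delta> \<le> \<delta>\<^sub>0 \<Longrightarrow> \<bar>F \<delta> - F \<eta>\<bar> > \<psi> \<delta> \<eta> \<Longrightarrow> 1 \<le> B \<delta> \<eta>"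
    and B0: "\<And>\<delta> \<eta>. 0 \<le> B \<delta> \<eta>"
  defines "h \<equiv> Max {\<delta> \<in> G. \<forall>\<eta>\<in>G. \<eta> \<le> \<delta> \<longrightarrow> \<bar>F \<delta> - F \<eta>\<bar> \<le> \<psi> \<delta> \<eta>}"
  shows "(F h - y)\<^sup>2 \<le> 2 * \<Psi>\<^sup>2 + 2 * (F \<delta>\<^sub>0 - y)\<^sup>2 +
    (\<Sum>\<delta>\<in>{\<delta>\<in>G. \<delta> < \<delta>\<^sub>0}. w \<delta> / 2 * (F \<delta> - y) ^ 4 + 1 / (2 * w \<delta>) * (\<Sum>\<eta>\<in>{\<eta>\<in>G. \<eta> < a * \<delta>}. B (a * \<delta>) \<eta>))"
proof -
  let ?A = "{\<delta> \<in> G. \<forall>\<eta>\<in>G. \<eta> \<le> \<delta> \<longrightarrow> \<bar>F \<delta> - F \<eta>\<bar> \<le> \<psi> \<delta> \<eta>}"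
  let ?t = "\<lambda>\<delta>. w \<delta> / 2 * (F \<delta> - y) ^ 4 + 1 / (2 * w \<delta>) * (\<Sum>\<eta>\<in>{\<eta>\<in>G. \<eta> < a * \<delta>}. B (a * \<delta>) \<eta>)"
  have fin: "finite ?A" using G by simp
  have "Min G \<in> G" using G by (intro Min_in) auto
  moreover have "\<bar>F (Min G) - F \<eta>\<bar> \<le> \<psi> (Min G) \<eta>" if "\<eta> \<in> G" "\<eta> \<le> Min G" for \<eta>
  proof -
    have "\<eta> = Min G" using Min_le[OF G(1) that(1)] that(2) by simp
    then show ?thesis using psi[OF that(1) that(1)] by simp
  qed
  ultimately have "Min G \<in> ?A" by blast
  then have ne: "?A \<noteq> {}" by blast
  have hA: "h \<in> ?A" unfolding h_def by (rule Max_in[OF fin ne])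
  then have hG: "h \<in> G" by simp
  have t0: "0 \<le> ?t \<delta>" if "\<delta> \<in> G" for \<delta>
    using w[OF that] B0 by (intro add_nonneg_nonneg mult_nonneg_nonneg sum_nonneg) (auto simp: zero_le_even_power)
  show ?thesis
  proof (cases "\<delta>\<^sub>0 \<le> h")
    case True
    have "\<bar>F h - F \<delta>\<^sub>0\<bar> \<le> \<Psi>" using hA G(2) True psi0[OF hG True] by force
    then have "(F h - F \<delta>\<^sub>0)\<^sup>2 \<le> \<Psi>\<^sup>2" by (metis abs_ge_zero power2_abs power_mono)
    moreover have "(F h - y)\<^sup>2 \<le> 2 * (F h - F \<delta>\<^sub>0)\<^sup>2 + 2 * (F \<delta>\<^sub>0 - y)\<^sup>2"
    proof -
      have "0 \<le> ((F h - F \<delta>\<^sub>0) - (F \<delta>\<^sub>0 - y))\<^sup>2" by simp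
      then show ?thesis by (simp add: power2_eq_square algebra_simps)
    qed
    moreover have "0 \<le> (\<Sum>\<delta>\<in>{\<delta>\<in>G. \<delta> < \<delta>\<^sub>0}. ?t \<delta>)" by (rule sum_nonneg) (use t0 in auto)
    ultimately show ?thesis by linarith
  next
    case False
    then have lt: "h < \<delta>\<^sub>0" by simp
    have ah: "a * h \<in> G" "a * h \<le> \<delta>\<^sub>0" using step[OF hG lt] by auto
    have "h < a * h" using pos[OF hG] a by simp
    have "a * h \<notin> ?A"
    proof
      assume "a * h \<in> ?A"
      then have "a * h \<le> h" unfolding h_def by (rule Max_ge[OF fin])
      then show False using \<open>h < a * h\<close> by simp
    qed
    then obtain \<eta> where \<eta>: "\<eta> \<in> G" "\<eta> \<le> a * h" "\<bar>F (a * h) - F \<eta>\<bar> > \<psi> (a * h) \<eta>" using ah by (auto simp: not_le)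
    (* A bandwidth is never rejected because of itself, as the threshold is nonnegative. *)
    have "\<eta> \<noteq> a * h" using \<eta> psi[OF ah(1) ah(1)] by auto
    then have \<eta>lt: "\<eta> < a * h" using \<eta> by simp
    have "1 \<le> B (a * h) \<eta>" by (rule bad[OF ah(1) \<eta>(1) \<eta>lt ah(2) \<eta>(3)])
    also have "\<dots> \<le> (\<Sum>\<eta>\<in>{\<eta>\<in>G. \<eta> < a * h}. B (a * h) \<eta>)"
      by (rule member_le_sum) (use \<eta> \<eta>lt G B0 in auto)
    finally have one: "1 \<le> (\<Sum>\<eta>\<in>{\<eta>\<in>G. \<eta> < a * h}. B (a * h) \<eta>)" .
    have wh: "w h > 0" by (rule w[OF hG])
    (* This is 2 u \<le> u\<^sup>2 + 1 with u = w h * (F h - y)\<^sup>2, divided by 2 * w h. *)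
    have "(F h - y)\<^sup>2 \<le> w h / 2 * (F h - y) ^ 4 + 1 / (2 * w h) * 1"
    proof -
      have "0 \<le> (w h * (F h - y)\<^sup>2 - 1)\<^sup>2" by simp
      then have "2 * w h * (F h - y)\<^sup>2 \<le> (w h)\<^sup>2 * ((F h - y)\<^sup>2)\<^sup>2 + 1" by (simp add: power2_eq_square algebra_simps)
      moreover have "((F h - y)\<^sup>2)\<^sup>2 = (F h - y) ^ 4" by (simp add: power_mult[symmetric])
      ultimately have "2 * w h * (F h - y)\<^sup>2 \<le> 2 * w h * (w h / 2 * (F h - y) ^ 4 + 1 / (2 * w h) * 1)"
        using wh by (simp add: distrib_left power2_eq_square)
      then show ?thesis using wh by (simp only: mult_le_cancel_left_pos[of "2 * w h"] mult_pos_pos zero_less_numeral)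
    qed
    also have "\<dots> \<le> ?t h" using one wh by (intro add_left_mono mult_left_mono) auto
    also have "\<dots> \<le> (\<Sum>\<delta>\<in>{\<delta>\<in>G. \<delta> < \<delta>\<^sub>0}. ?t \<delta>)"
      by (rule member_le_sum) (use hG lt t0 G in auto)
    finally show ?thesis by (smt (verit) zero_le_power2)
  qed
qed


section \<open>The risk of the adaptive estimator\<close>

lemma lam_bounds: "1 \<le> lam D2 \<delta>" "0 < lam D2 \<delta>"
  by (auto simp: lam_def intro: less_le_trans[OF zero_less_one])

lemma lam_sq: 
  assumes "0 \<le> D2" "0 < \<delta>" "\<delta> \<le> 1"
  shows "(lam D2 \<delta>)\<^sup>2 = max 1 (D2 * ln (1 / \<delta>))"
proof -
  have "0 \<le> D2 * ln (1 / \<delta>)" using assms by (intro mult_nonneg_nonneg) auto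
  then show ?thesis unfolding lam_def by (auto simp: max_def)
qed

lemma lam_fourth:
  assumes "0 \<le> D2" "0 < \<delta>" "\<delta> \<le> 1"
  shows "(lam D2 \<delta>) ^ 4 \<le> (1 + D2\<^sup>2) / \<delta>\<^sup>2"
proof -
  let ?l = "ln (1 / \<delta>)"
  have l: "0 \<le> ?l" "?l \<le> 1 / \<delta>" using assms ln_add_one_self_le_self[of "1 / \<delta> - 1"] by auto
  have one: "1 \<le> (1 / \<delta>)\<^sup>2" using assms by (intro one_le_power) simp
  have "(lam D2 \<delta>) ^ 4 = ((lam D2 \<delta>)\<^sup>2)\<^sup>2" by simp
  also have "\<dots> = (max 1 (D2 * ?l))\<^sup>2" unfolding lam_sq[OF assms] ..
  also have "\<dots> \<le> 1 + (D2 * ?l)\<^sup>2" by (simp add: max_def)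
  also have "(D2 * ?l)\<^sup>2 \<le> (D2 * (1 / \<delta>))\<^sup>2" using l assms by (intro power_mono mult_left_mono mult_nonneg_nonneg) auto
  also have "1 + (D2 * (1 / \<delta>))\<^sup>2 \<le> (1 / \<delta>)\<^sup>2 + (D2 * (1 / \<delta>))\<^sup>2" using one by simp
  also have "\<dots> = (1 + D2\<^sup>2) / \<delta>\<^sup>2" by (simp add: power_mult_distrib power_divide add_divide_distrib)
  finally show ?thesis by simp
qed

lemma lam_antimono: 
  assumes "0 \<le> D2" "0 < \<eta>" "\<eta> \<le> \<delta>" shows "lam D2 \<delta> \<le> lam D2 \<eta>"
proof -
  have "ln (1 / \<delta>) \<le> ln (1 / \<eta>)" using assms by (intro ln_mono divide_left_mono) auto
  then show ?thesis unfolding lam_def using assms(1) by (intro max.mono order_refl real_sqrt_le_mono mult_left_mono)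
qed

lemma var1_eq: "var1 c1 n \<delta> = c1 * (1 / (real n * \<delta> ^ 3))"
  by (simp add: var1_def)

lemma thresh_nonneg: "0 \<le> thresh \<mu> c1 c2 D2 n \<delta> \<eta>" if "c1 > 0" "c2 > 0" "\<delta> > 0"
  unfolding thresh_def var1_eq var2_def using that lam_bounds(2)[of D2 \<delta>] lam_bounds(2)[of D2 \<eta>]
  by (intro add_nonneg_nonneg mult_nonneg_nonneg real_sqrt_ge_zero divide_nonneg_nonneg Bochner_Integration.integral_nonneg) auto

definition thresh_const :: "real \<Rightarrow> real \<Rightarrow> real \<Rightarrow> real" where
  "thresh_const \<mu> c1 c2 = sqrt c1 + sqrt (c2 * (20 * (1 + \<mu>\<^sup>2)\<^sup>2))"

lemma thresh_le:
  assumes c: "c1 > 0" "c2 > 0" and D2: "0 \<le> D2" and e: "0 < \<eta>" "\<eta> \<le> \<delta>" "\<delta> \<le> 1" and n: "n \<ge> 1"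
  shows "thresh \<mu> c1 c2 D2 n \<delta> \<eta> \<le> thresh_const \<mu> c1 c2 * (sqrt (1 / (real n * \<eta> ^ 3)) * lam D2 \<eta>)"
proof -
  let ?v = "1 / (real n * \<eta> ^ 3)"
  have n0: "real n > 0" using n by simp
  have "1 / (real n * \<delta> ^ 3) \<le> ?v" using e n0 by (intro divide_left_mono mult_left_mono power_mono) auto
  then have "var1 c1 n \<delta> \<le> c1 * ?v" unfolding var1_eq using c by (intro mult_left_mono) auto
  then have 1: "sqrt (var1 c1 n \<delta>) \<le> sqrt c1 * sqrt ?v" by (simp only: real_sqrt_mult[symmetric] real_sqrt_le_mono)
  have "var2 \<mu> c2 n \<delta> \<eta> \<le> c2 / real n * (20 * (1 + \<mu>\<^sup>2)\<^sup>2 / \<eta> ^ 3)"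
    unfolding var2_def using kern_diff_bounds(3)[OF e, of \<mu>] c n0 by (intro mult_left_mono) auto
  also have "\<dots> = (c2 * (20 * (1 + \<mu>\<^sup>2)\<^sup>2)) * ?v" by simp
  finally have 2: "sqrt (var2 \<mu> c2 n \<delta> \<eta>) \<le> sqrt (c2 * (20 * (1 + \<mu>\<^sup>2)\<^sup>2)) * sqrt ?v"
    by (simp only: real_sqrt_mult[symmetric] real_sqrt_le_mono)
  have "thresh \<mu> c1 c2 D2 n \<delta> \<eta> \<le> sqrt c1 * sqrt ?v * lam D2 \<eta> + sqrt (c2 * (20 * (1 + \<mu>\<^sup>2)\<^sup>2)) * sqrt ?v * lam D2 \<eta>"
    unfolding thresh_def using 1 2 lam_antimono[OF D2 e(1,2)] lam_bounds(2)[of D2] c e n0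
    by (intro add_mono mult_mono mult_right_mono mult_nonneg_nonneg) (auto intro: less_imp_le)
  also have "\<dots> = thresh_const \<mu> c1 c2 * (sqrt ?v * lam D2 \<eta>)" unfolding thresh_const_def by (simp only: distrib_right mult.assoc)
  finally show ?thesis .
qed

text \<open>The first summand of \<^const>\<open>thresh\<close>.\<close>

definition noise_level :: "real \<Rightarrow> real \<Rightarrow> nat \<Rightarrow> real \<Rightarrow> real" where
  "noise_level c1 D2 n \<delta> = sqrt (var1 c1 n \<delta>) * lam D2 \<delta>"

lemma noise_level_nonneg: "0 < c1 \<Longrightarrow> 0 < \<delta> \<Longrightarrow> 0 \<le> noise_level c1 D2 n \<delta>"
  unfolding noise_level_def var1_eq using lam_bounds(2)[of D2 \<delta>] by (intro mult_nonneg_nonneg) auto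

lemma noise_level_sq: "0 < c1 \<Longrightarrow> 0 < \<delta> \<Longrightarrow> (noise_level c1 D2 n \<delta>)\<^sup>2 = c1 * ((lam D2 \<delta>)\<^sup>2 * (1 / (real n * \<delta> ^ 3)))"
  unfolding noise_level_def var1_eq power_mult_distrib by (subst real_sqrt_pow2) (auto simp: mult_ac)

lemma two_term_power_bounds:
  fixes p q r :: real assumes q: "\<bar>q\<bar> \<le> r / 2"
  shows "(p + q)\<^sup>2 \<le> 2 * p\<^sup>2 + r\<^sup>2 / 2" "(p + q) ^ 4 \<le> 8 * p ^ 4 + r ^ 4 / 2"
proof -
  have s: "(u + v)\<^sup>2 \<le> 2 * u\<^sup>2 + 2 * v\<^sup>2" for u v :: real
    using zero_le_power2[of "u - v"] by (simp add: power2_eq_square algebra_simps)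
  have "q\<^sup>2 \<le> (r / 2)\<^sup>2" using power_mono[OF q abs_ge_zero, of 2] by simp
  then show "(p + q)\<^sup>2 \<le> 2 * p\<^sup>2 + r\<^sup>2 / 2" using s[of p q] by (simp add: power_divide)
  have "((p + q)\<^sup>2)\<^sup>2 \<le> (2 * p\<^sup>2 + 2 * q\<^sup>2)\<^sup>2" by (intro power_mono s) auto
  also have "\<dots> \<le> 2 * (2 * p\<^sup>2)\<^sup>2 + 2 * (2 * q\<^sup>2)\<^sup>2" by (rule s)
  finally have "(p + q) ^ 4 \<le> 8 * p ^ 4 + 8 * q ^ 4" by (simp add: power_mult_distrib power_mult[symmetric])
  moreover have "q ^ 4 \<le> (r / 2) ^ 4" using power_mono[OF q abs_ge_zero, of 4] by (simp add: power_even_abs)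
  ultimately show "(p + q) ^ 4 \<le> 8 * p ^ 4 + r ^ 4 / 2" by (simp add: power_divide)
qed

context observation begin

definition risk_const :: "real^2 \<Rightarrow> real \<Rightarrow> real \<Rightarrow> real" where
  "risk_const x c1 c2 = 2 * (thresh_const \<mu> c1 c2)\<^sup>2 + 4 * (moment_const x / (scale x)\<^sup>2) + c1"

definition remainder_const :: "real^2 \<Rightarrow> real \<Rightarrow> real \<Rightarrow> real \<Rightarrow> real" where
  "remainder_const x a c1 D2 = 4 * (12 * moment_const x / (scale x) ^ 4) + c1\<^sup>2 * (1 + D2\<^sup>2) / 4 + 2 * a ^ 10"

lemma fbar_centered: "fbar \<mu> n \<delta> x \<omega> = dev n x (kern \<mu> \<delta>) \<omega> + mean_functional \<mu> g x (kern \<mu> \<delta>)"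
  by (simp add: dev_def fbar_eq_linear)

lemma fbar_diff_centered:
  assumes "0 < \<delta>" "\<delta> \<le> 1" "0 < \<eta>" "\<eta> \<le> 1"
  shows "fbar \<mu> n \<delta> x \<omega> - fbar \<mu> n \<eta> x \<omega> = dev n x (\<lambda>u. kern \<mu> \<delta> u - kern \<mu> \<eta> u) \<omega> +
    (mean_functional \<mu> g x (kern \<mu> \<delta>) - mean_functional \<mu> g x (kern \<mu> \<eta>))"
  unfolding dev_def fbar_eq_linear linear_estimator_diff
    mean_functional_diff[OF sb kern_measurable kern_bounds(1)[OF assms(1,2)] kern_measurable kern_bounds(1)[OF assms(3,4)]] by simp

text \<open>The part of the threshold that is left after the bias is accounted for does not cover the deviation.\<close>

definition bad_event :: "nat \<Rightarrow> real^2 \<Rightarrow> real \<Rightarrow> real \<Rightarrow> real \<Rightarrow> real \<Rightarrow> (nat \<Rightarrow> (real^2) \<times> real \<times> real) set" where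
  "bad_event n x c2 D2 \<delta> \<eta> =
    {\<omega>. \<bar>dev n x (\<lambda>u. kern \<mu> \<delta> u - kern \<mu> \<eta> u) \<omega>\<bar> > sqrt (var2 \<mu> c2 n \<delta> \<eta>) * lam D2 \<eta>}"

text \<open>The contribution of selecting the too small bandwidth \<open>\<delta>\<close>, with the weight \<open>n \<delta> ^ 9\<close>. The fourth power of the error is
  of order \<open>n\<^sup>-\<^sup>2 \<delta>\<^sup>-\<^sup>8\<close> once logarithms are absorbed, and the bad events have total probability of order \<open>\<delta> ^ 10\<close>. With this
  weight both parts are of order \<open>\<delta> / n\<close>.\<close>

definition undershoot_term :: "nat \<Rightarrow> real^2 \<Rightarrow> real \<Rightarrow> real \<Rightarrow> real \<Rightarrow> real \<Rightarrow> real \<Rightarrow> (nat \<Rightarrow> (real^2) \<times> real \<times> real) \<Rightarrow> real" where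
  "undershoot_term n x a c1 c2 D2 \<delta> \<omega> =
    real n * \<delta> ^ 9 * noise_level c1 D2 n \<delta> ^ 4 / 4 + 4 * (real n * \<delta> ^ 9) * dev n x (kern \<mu> \<delta>) \<omega> ^ 4 +
    1 / (2 * (real n * \<delta> ^ 9)) * (\<Sum>\<eta>\<in>{\<eta>\<in>grid a n. \<eta> < a * \<delta>}. indicator (bad_event n x c2 D2 (a * \<delta>) \<eta>) \<omega>)"

text \<open>Below \<open>\<delta>\<^sub>0\<close> the bias of two estimators together does not exceed the noise level of the larger bandwidth, so a
  rejection there can only be caused by a deviation.\<close>

lemma adaptive_error_pointwise:
  assumes n: "n \<ge> 3" and a: "a \<ge> 2" and c: "c1 > 0" "c2 > 0" and D2: "0 \<le> D2" and d0: "\<delta>\<^sub>0 \<in> grid a n"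
    and bias: "\<And>\<delta>. \<delta> \<in> grid a n \<Longrightarrow> \<bar>mean_functional \<mu> g x (kern \<mu> \<delta>) - y\<bar> \<le> b * \<delta> powr (\<beta> - 1)"
    and b: "b \<ge> 0" "\<beta> > 1"
    and small: "\<And>\<delta>. \<delta> \<in> grid a n \<Longrightarrow> \<delta> \<le> \<delta>\<^sub>0 \<Longrightarrow> 2 * (b * \<delta> powr (\<beta> - 1)) \<le> noise_level c1 D2 n \<delta>"
  shows "(fstar \<mu> a c1 c2 D2 n x \<omega> - y)\<^sup>2 \<le>
    2 * (thresh_const \<mu> c1 c2 * (sqrt (1 / (real n * \<delta>\<^sub>0 ^ 3)) * lam D2 \<delta>\<^sub>0))\<^sup>2 + (noise_level c1 D2 n \<delta>\<^sub>0)\<^sup>2 +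
    4 * (dev n x (kern \<mu> \<delta>\<^sub>0) \<omega>)\<^sup>2 + (\<Sum>\<delta>\<in>{\<delta>\<in>grid a n. \<delta> < \<delta>\<^sub>0}. undershoot_term n x a c1 c2 D2 \<delta> \<omega>)"
proof -
  let ?G = "grid a n" and ?v = "noise_level c1 D2 n" and ?Z = "\<lambda>\<delta>. dev n x (kern \<mu> \<delta>) \<omega>"
  note G = grid_bounds[OF n]
  have n0: "real n > 0" "n \<ge> 1" using n by auto
  define m where "m \<delta> = mean_functional \<mu> g x (kern \<mu> \<delta>)" for \<delta>
  define w where "w \<delta> = real n * \<delta> ^ 9" for \<delta>
  define \<Psi> where "\<Psi> = thresh_const \<mu> c1 c2 * (sqrt (1 / (real n * \<delta>\<^sub>0 ^ 3)) * lam D2 \<delta>\<^sub>0)"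
  let ?f = "\<lambda>\<delta>. fbar \<mu> n \<delta> x \<omega>" and ?B = "\<lambda>\<delta> \<eta>. indicator (bad_event n x c2 D2 \<delta> \<eta>) \<omega> :: real"
  have w: "0 < w \<delta>" if "\<delta> \<in> ?G" for \<delta> unfolding w_def using n0 G(1)[OF that] by simp
  have half: "\<bar>m \<eta> - y\<bar> \<le> ?v \<delta> / 2" if "\<delta> \<in> ?G" "\<delta> \<le> \<delta>\<^sub>0" "\<eta> \<in> ?G" "\<eta> \<le> \<delta>" for \<delta> \<eta>
  proof -
    have "\<eta> powr (\<beta> - 1) \<le> \<delta> powr (\<beta> - 1)" using that G(1)[OF that(3)] b by (intro powr_mono2) auto
    then have "b * \<eta> powr (\<beta> - 1) \<le> b * \<delta> powr (\<beta> - 1)" using b by (intro mult_left_mono) auto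
    then show ?thesis using bias[of \<eta>] small[of \<delta>] that unfolding m_def by linarith
  qed
  have err: "?f \<delta> - y = ?Z \<delta> + (m \<delta> - y)" for \<delta> by (simp add: fbar_centered m_def)
  have step: "a * \<delta> \<in> ?G \<and> a * \<delta> \<le> \<delta>\<^sub>0" if "\<delta> \<in> ?G" "\<delta> < \<delta>\<^sub>0" for \<delta>
    using grid_gap[OF a d0, of \<delta>] that by auto
  have "(fstar \<mu> a c1 c2 D2 n x \<omega> - y)\<^sup>2 \<le> 2 * \<Psi>\<^sup>2 + 2 * (?f \<delta>\<^sub>0 - y)\<^sup>2 +
    (\<Sum>\<delta>\<in>{\<delta>\<in>?G. \<delta> < \<delta>\<^sub>0}. w \<delta> / 2 * (?f \<delta> - y) ^ 4 + 1 / (2 * w \<delta>) * (\<Sum>\<eta>\<in>{\<eta>\<in>?G. \<eta> < a * \<delta>}. ?B (a * \<delta>) \<eta>))"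
    unfolding fstar_def adapt_bw_def
  proof (rule adaptive_error_split[where F="?f" and \<psi>="thresh \<mu> c1 c2 D2 n" and B="?B", OF finite_grid[OF n a] d0])
    fix \<delta> assume \<delta>: "\<delta> \<in> ?G"
    show "0 < \<delta>" by (rule G(1)[OF \<delta>])
    show "0 < w \<delta>" by (rule w[OF \<delta>])
    show "thresh \<mu> c1 c2 D2 n \<delta> \<delta>\<^sub>0 \<le> \<Psi>" if "\<delta>\<^sub>0 \<le> \<delta>"
      unfolding \<Psi>_def by (rule thresh_le[OF c D2 G(1)[OF d0] that G(2)[OF \<delta>] n0(2)])
    fix \<eta> assume \<eta>: "\<eta> \<in> ?G"
    show "0 \<le> thresh \<mu> c1 c2 D2 n \<delta> \<eta>" by (rule thresh_nonneg[OF c G(1)[OF \<delta>]])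
    assume lt: "\<eta> < \<delta>" and le: "\<delta> \<le> \<delta>\<^sub>0" and big: "thresh \<mu> c1 c2 D2 n \<delta> \<eta> < \<bar>?f \<delta> - ?f \<eta>\<bar>"
    have "\<bar>m \<delta> - m \<eta>\<bar> \<le> ?v \<delta>" using half[OF \<delta> le \<delta>] half[OF \<delta> le \<eta> less_imp_le[OF lt]] by linarith
    then have "\<omega> \<in> bad_event n x c2 D2 \<delta> \<eta>"
      using big unfolding fbar_diff_centered[OF G(1,2)[OF \<delta>] G(1,2)[OF \<eta>]] m_def[symmetric] thresh_def noise_level_def[symmetric] bad_event_def
      by (simp only: mem_Collect_eq)
    then show "1 \<le> ?B \<delta> \<eta>" by simp
  qed (use step a in auto)
  moreover have "(\<Sum>\<delta>\<in>{\<delta>\<in>?G. \<delta> < \<delta>\<^sub>0}. w \<delta> / 2 * (?f \<delta> - y) ^ 4 + 1 / (2 * w \<delta>) * (\<Sum>\<eta>\<in>{\<eta>\<in>?G. \<eta> < a * \<delta>}. ?B (a * \<delta>) \<eta>)) \<le>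
    (\<Sum>\<delta>\<in>{\<delta>\<in>?G. \<delta> < \<delta>\<^sub>0}. undershoot_term n x a c1 c2 D2 \<delta> \<omega>)"
  proof (rule sum_mono)
    fix \<delta> assume "\<delta> \<in> {\<delta>\<in>?G. \<delta> < \<delta>\<^sub>0}"
    then have \<delta>: "\<delta> \<in> ?G" "\<delta> \<le> \<delta>\<^sub>0" by auto
    have "w \<delta> / 2 * (?f \<delta> - y) ^ 4 \<le> w \<delta> / 2 * (8 * ?Z \<delta> ^ 4 + ?v \<delta> ^ 4 / 2)"
      unfolding err using two_term_power_bounds(2)[OF half[OF \<delta> \<delta>(1) order_refl]] w[OF \<delta>(1)] by (intro mult_left_mono) auto
    also have "\<dots> = w \<delta> * ?v \<delta> ^ 4 / 4 + 4 * w \<delta> * ?Z \<delta> ^ 4" by (simp add: algebra_simps)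
    finally show "w \<delta> / 2 * (?f \<delta> - y) ^ 4 + 1 / (2 * w \<delta>) * (\<Sum>\<eta>\<in>{\<eta>\<in>?G. \<eta> < a * \<delta>}. ?B (a * \<delta>) \<eta>) \<le> undershoot_term n x a c1 c2 D2 \<delta> \<omega>"
      unfolding undershoot_term_def w_def by (rule add_right_mono)
  qed
  moreover have "(?f \<delta>\<^sub>0 - y)\<^sup>2 \<le> 2 * (?Z \<delta>\<^sub>0)\<^sup>2 + (?v \<delta>\<^sub>0)\<^sup>2 / 2"
    unfolding err by (rule two_term_power_bounds(1)[OF half[OF d0 order_refl d0 order_refl]])
  ultimately show ?thesis unfolding \<Psi>_def by linarith
qed

lemma undershoot_term_expectation:
  assumes n: "n \<ge> 3" and a: "a \<ge> 2" and c: "c1 > 0" "c2 > 0" and D2: "0 \<le> D2"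
    and D: "((11 + (dev_scale x)\<^sup>2 * mgf_const \<mu> \<sigma> L x) / dev_scale x)\<^sup>2 / c2 \<le> D2"
    and \<delta>: "\<delta> \<in> grid a n" and aG: "a * \<delta> \<in> grid a n"
  shows "\<And>\<omega>. 0 \<le> undershoot_term n x a c1 c2 D2 \<delta> \<omega>"
    and "(\<lambda>\<omega>. ennreal (undershoot_term n x a c1 c2 D2 \<delta> \<omega>)) \<in> borel_measurable (S n)"
    and "(\<integral>\<^sup>+\<omega>. ennreal (undershoot_term n x a c1 c2 D2 \<delta> \<omega>) \<partial>S n) \<le> ennreal (remainder_const x a c1 D2 * \<delta> / real n)"
proof -
  interpret P: prob_space "S n" by (rule prob_space_sample)
  let ?G = "grid a n" and ?v = "noise_level c1 D2 n" and ?Z = "\<lambda>\<omega>. dev n x (kern \<mu> \<delta>) \<omega>" and ?w = "real n * \<delta> ^ 9"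
  let ?H = "{\<eta>\<in>?G. \<eta> < a * \<delta>}" and ?Bad = "bad_event n x c2 D2 (a * \<delta>)"
  let ?Q4 = "12 * moment_const x / (scale x) ^ 4" and ?Rem = "remainder_const x a c1 D2"
  note g = grid_bounds[OF n]
  have G: "0 < \<delta>" "\<delta> \<le> 1" "ln (1 / \<delta>) \<le> real n * \<delta>" "1 \<le> real n * \<delta>" if "\<delta> \<in> ?G" for \<delta>
    using g[OF that] by auto
  note d = G(1)[OF \<delta>] G(2)[OF \<delta>]
  have n0: "real n > 0" "n \<ge> 1" using n by auto
  have w0: "0 < ?w" using n0 d by simp
  have Q4: "0 \<le> ?Q4" unfolding moment_const_def using scale_pos[of x] by simp
  have meas_Z: "?Z \<in> borel_measurable (S n)" by (rule dev_measurable[OF kern_measurable])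
  have meas_B: "(\<lambda>\<omega>. indicator (?Bad \<eta>) \<omega> :: ennreal) \<in> borel_measurable (S n)" for \<eta>
  proof -
    let ?k = "\<lambda>u. kern \<mu> (a * \<delta>) u - kern \<mu> \<eta> u" and ?t = "sqrt (var2 \<mu> c2 n (a * \<delta>) \<eta>) * lam D2 \<eta>"
    have d: "dev n x ?k \<in> borel_measurable (S n)" by (rule dev_measurable) measurable
    have "(\<lambda>y::real. indicator {y. \<bar>y\<bar> > ?t} y :: ennreal) \<in> borel_measurable borel" by measurable
    from measurable_compose[OF d this] show ?thesis unfolding bad_event_def by (simp add: indicator_def)
  qed
  have meas_pow: "(\<lambda>\<omega>. ennreal (?Z \<omega> ^ p)) \<in> borel_measurable (S n)" for p
    by (rule measurable_compose[OF borel_measurable_power[OF meas_Z] measurable_ennreal])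
  have meas_Zp: "(\<lambda>\<omega>. r * ennreal (?Z \<omega> ^ p)) \<in> borel_measurable (S n)" for p r
    by (rule borel_measurable_times_ennreal[OF borel_measurable_const meas_pow])
  have meas_Bs: "(\<lambda>\<omega>. r * (\<Sum>\<eta>\<in>H. indicator (?Bad \<eta>) \<omega> :: ennreal)) \<in> borel_measurable (S n)" for r H
    by (rule borel_measurable_times_ennreal[OF borel_measurable_const borel_measurable_sum[OF meas_B]])
  let ?eT = "\<lambda>\<omega>. ennreal (?w * ?v \<delta> ^ 4 / 4) + ennreal (4 * ?w) * ennreal (?Z \<omega> ^ 4) + ennreal (1 / (2 * ?w)) * (\<Sum>\<eta>\<in>?H. indicator (?Bad \<eta>) \<omega>)"
  have nonneg: "0 \<le> undershoot_term n x a c1 c2 D2 \<delta> \<omega>" and eT: "ennreal (undershoot_term n x a c1 c2 D2 \<delta> \<omega>) = ?eT \<omega>" for \<omega>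
  proof -
    let ?ind = "\<Sum>\<eta>\<in>?H. (indicator (?Bad \<eta>) \<omega> :: real)"
    have i: "ennreal ?ind = (\<Sum>\<eta>\<in>?H. indicator (?Bad \<eta>) \<omega>)"
      by (subst sum_ennreal[symmetric]) (auto simp: ennreal_indicator)
    have nn: "0 \<le> ?w * ?v \<delta> ^ 4 / 4" "0 \<le> 4 * ?w" "0 \<le> ?Z \<omega> ^ 4" "0 \<le> 1 / (2 * ?w)" "0 \<le> ?ind"
      using w0 d by (auto intro!: sum_nonneg simp: zero_le_even_power)
    show "0 \<le> undershoot_term n x a c1 c2 D2 \<delta> \<omega>"
      unfolding undershoot_term_def by (intro add_nonneg_nonneg mult_nonneg_nonneg nn)
    show "ennreal (undershoot_term n x a c1 c2 D2 \<delta> \<omega>) = ?eT \<omega>"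
      unfolding undershoot_term_def i[symmetric] ennreal_mult[OF nn(2,3), symmetric] ennreal_mult[OF nn(4,5), symmetric]
      by (simp only: ennreal_plus add_nonneg_nonneg mult_nonneg_nonneg nn)
  qed
  show "\<And>\<omega>. 0 \<le> undershoot_term n x a c1 c2 D2 \<delta> \<omega>" by (rule nonneg)
  show "(\<lambda>\<omega>. ennreal (undershoot_term n x a c1 c2 D2 \<delta> \<omega>)) \<in> borel_measurable (S n)"
    unfolding eT by (intro borel_measurable_add borel_measurable_const meas_Zp meas_Bs)
  have Jeq: "(\<integral>\<^sup>+\<omega>. ?eT \<omega> \<partial>S n) = ennreal (?w * ?v \<delta> ^ 4 / 4) + ennreal (4 * ?w) * (\<integral>\<^sup>+\<omega>. ennreal (?Z \<omega> ^ 4) \<partial>S n)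
     + ennreal (1 / (2 * ?w)) * (\<Sum>\<eta>\<in>?H. \<integral>\<^sup>+\<omega>. indicator (?Bad \<eta>) \<omega> \<partial>S n)"
    unfolding nn_integral_add[OF borel_measurable_add[OF borel_measurable_const meas_Zp] meas_Bs]
      nn_integral_add[OF borel_measurable_const meas_Zp] nn_integral_cmult[OF meas_pow]
      nn_integral_cmult[OF borel_measurable_sum[OF meas_B]] nn_integral_sum[OF meas_B]
    by (simp add: P.emeasure_space_1)
  have t1: "?w * ?v \<delta> ^ 4 / 4 \<le> c1\<^sup>2 * (1 + D2\<^sup>2) / 4 * \<delta> / real n"
  proof -
    have "?v \<delta> ^ 4 = ((?v \<delta>)\<^sup>2)\<^sup>2" by simp
    also have "\<dots> = c1\<^sup>2 * (1 / (real n * \<delta> ^ 3))\<^sup>2 * (lam D2 \<delta>) ^ 4"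
      unfolding noise_level_sq[OF c(1) d(1)] power_mult_distrib by (simp add: mult_ac)
    also have "\<dots> \<le> c1\<^sup>2 * (1 / (real n * \<delta> ^ 3))\<^sup>2 * ((1 + D2\<^sup>2) / \<delta>\<^sup>2)"
      by (intro mult_left_mono lam_fourth[OF D2 d]) auto
    finally have "?w * ?v \<delta> ^ 4 / 4 \<le> ?w * (c1\<^sup>2 * (1 / (real n * \<delta> ^ 3))\<^sup>2 * ((1 + D2\<^sup>2) / \<delta>\<^sup>2)) / 4"
      using w0 by (intro divide_right_mono mult_left_mono) auto
    also have "\<dots> = c1\<^sup>2 * (1 + D2\<^sup>2) / 4 * \<delta> / real n"
      using n0 d by (simp add: power_mult_distrib power_divide eval_nat_numeral mult_ac)
    finally show ?thesis .
  qed
  have "ennreal (4 * ?w) * (\<integral>\<^sup>+\<omega>. ennreal ((?Z \<omega>) ^ 4) \<partial>S n) \<le> ennreal (4 * ?w) * ennreal (?Q4 * (1 / (real n * \<delta> ^ 3))\<^sup>2)"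
    by (rule mult_left_mono[OF fbar_moments(2)[OF d G(4)[OF \<delta>]] zero_le])
  also have "\<dots> = ennreal (4 * ?w * (?Q4 * (1 / (real n * \<delta> ^ 3))\<^sup>2))"
    by (rule ennreal_mult[symmetric, OF _ mult_nonneg_nonneg[OF Q4 zero_le_power2]]) (use w0 in simp)
  also have "\<dots> \<le> ennreal (4 * ?Q4 * \<delta> / real n)"
  proof (rule ennreal_leI)
    have "4 * ?w * (?Q4 * (1 / (real n * \<delta> ^ 3))\<^sup>2) = 4 * ?Q4 * \<delta> ^ 3 / real n"
      using n0 d by (simp add: power_mult_distrib power_divide eval_nat_numeral mult_ac)
    also have "\<dots> \<le> 4 * ?Q4 * \<delta> / real n"
      using n0 d Q4 power_decreasing[of 1 3 \<delta>] by (intro divide_right_mono mult_left_mono) auto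
    finally show "4 * ?w * (?Q4 * (1 / (real n * \<delta> ^ 3))\<^sup>2) \<le> 4 * ?Q4 * \<delta> / real n" .
  qed
  finally have t2: "ennreal (4 * ?w) * (\<integral>\<^sup>+\<omega>. ennreal ((?Z \<omega>) ^ 4) \<partial>S n) \<le> ennreal (4 * ?Q4 * \<delta> / real n)" .
  have "(\<Sum>\<eta>\<in>?H. \<integral>\<^sup>+\<omega>. indicator (?Bad \<eta>) \<omega> \<partial>S n) \<le> (\<Sum>\<eta>\<in>?H. ennreal (2 * (a * \<delta>) ^ 10 * \<eta>))"
  proof (rule sum_mono)
    fix \<eta> assume "\<eta> \<in> ?H"
    then have \<eta>: "\<eta> \<in> ?G" "\<eta> < a * \<delta>" by auto
    have gap: "a * \<eta> \<le> a * \<delta>" by (rule grid_gap(1)[OF a aG \<eta>(1) \<eta>(2)])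
    have "2 * \<eta> \<le> a * \<eta>" using a G(1)[OF \<eta>(1)] by (intro mult_right_mono) auto
    then have e: "\<eta> \<le> a * \<delta> / 2" using gap by linarith
    have "(\<integral>\<^sup>+\<omega>. indicator (?Bad \<eta>) \<omega> \<partial>S n) \<le> ennreal (2 * \<eta> ^ 11)"
      unfolding bad_event_def by (rule kern_diff_deviation[OF G(1)[OF \<eta>(1)] e G(2)[OF aG] G(3)[OF \<eta>(1)] c(2) D])
    also have "\<dots> \<le> ennreal (2 * (a * \<delta>) ^ 10 * \<eta>)"
    proof (rule ennreal_leI)
      have "\<eta> ^ 10 * \<eta> \<le> (a * \<delta>) ^ 10 * \<eta>" using \<eta>(2) G(1)[OF \<eta>(1)] by (intro mult_right_mono power_mono) auto
      then show "2 * \<eta> ^ 11 \<le> 2 * (a * \<delta>) ^ 10 * \<eta>" by (simp add: power_Suc2[symmetric])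
    qed
    finally show "(\<integral>\<^sup>+\<omega>. indicator (?Bad \<eta>) \<omega> \<partial>S n) \<le> ennreal (2 * (a * \<delta>) ^ 10 * \<eta>)" .
  qed
  also have "\<dots> = ennreal (\<Sum>\<eta>\<in>?H. 2 * (a * \<delta>) ^ 10 * \<eta>)"
  proof (rule sum_ennreal)
    fix \<eta> assume "\<eta> \<in> ?H"
    then show "0 \<le> 2 * (a * \<delta>) ^ 10 * \<eta>" using G(1)[of \<eta>] by (intro mult_nonneg_nonneg zero_le_even_power) auto
  qed
  also have "\<dots> \<le> ennreal (4 * (a * \<delta>) ^ 10)"
  proof (rule ennreal_leI)
    have "(\<Sum>\<eta>\<in>?H. 2 * (a * \<delta>) ^ 10 * \<eta>) = 2 * (a * \<delta>) ^ 10 * (\<Sum>\<eta>\<in>?H. \<eta>)"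
      by (rule sum_distrib_left[symmetric])
    also have "\<dots> \<le> 2 * (a * \<delta>) ^ 10 * 2"
      by (intro mult_left_mono sum_grid_le[OF n a]) (auto simp: zero_le_even_power)
    finally show "(\<Sum>\<eta>\<in>?H. 2 * (a * \<delta>) ^ 10 * \<eta>) \<le> 4 * (a * \<delta>) ^ 10" by simp
  qed
  finally have "ennreal (1 / (2 * ?w)) * (\<Sum>\<eta>\<in>?H. \<integral>\<^sup>+\<omega>. indicator (?Bad \<eta>) \<omega> \<partial>S n) \<le> ennreal (1 / (2 * ?w)) * ennreal (4 * (a * \<delta>) ^ 10)"
    by (rule mult_left_mono[OF _ zero_le])
  also have "\<dots> = ennreal (1 / (2 * ?w) * (4 * (a * \<delta>) ^ 10))"
    by (rule ennreal_mult[symmetric]) (use w0 in \<open>auto simp: zero_le_even_power\<close>)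
  also have "1 / (2 * ?w) * (4 * (a * \<delta>) ^ 10) = 2 * a ^ 10 * \<delta> / real n"
    using n0 d by (simp add: power_mult_distrib eval_nat_numeral)
  finally have t3: "ennreal (1 / (2 * ?w)) * (\<Sum>\<eta>\<in>?H. \<integral>\<^sup>+\<omega>. indicator (?Bad \<eta>) \<omega> \<partial>S n) \<le> ennreal (2 * a ^ 10 * \<delta> / real n)" .
  have nn: "0 \<le> c1\<^sup>2 * (1 + D2\<^sup>2) / 4 * \<delta> / real n" "0 \<le> 4 * ?Q4 * \<delta> / real n" "0 \<le> 2 * a ^ 10 * \<delta> / real n"
  proof -
    have p: "0 \<le> \<delta>" "0 \<le> real n" "(0::real) \<le> 4" using d n0 by auto
    show "0 \<le> c1\<^sup>2 * (1 + D2\<^sup>2) / 4 * \<delta> / real n" "0 \<le> 2 * a ^ 10 * \<delta> / real n"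
      using p by (auto intro!: divide_nonneg_nonneg mult_nonneg_nonneg add_nonneg_nonneg simp: zero_le_even_power)
    show "0 \<le> 4 * ?Q4 * \<delta> / real n"
      by (rule divide_nonneg_nonneg[OF mult_nonneg_nonneg[OF mult_nonneg_nonneg[OF p(3) Q4] p(1)] p(2)])
  qed
  have "(\<integral>\<^sup>+\<omega>. ?eT \<omega> \<partial>S n) \<le> ennreal (c1\<^sup>2 * (1 + D2\<^sup>2) / 4 * \<delta> / real n) + ennreal (4 * ?Q4 * \<delta> / real n) + ennreal (2 * a ^ 10 * \<delta> / real n)"
    unfolding Jeq by (intro add_mono ennreal_leI[OF t1] t2 t3)
  also have "\<dots> = ennreal (c1\<^sup>2 * (1 + D2\<^sup>2) / 4 * \<delta> / real n + 4 * ?Q4 * \<delta> / real n + 2 * a ^ 10 * \<delta> / real n)"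
    by (simp only: ennreal_plus nn add_nonneg_nonneg)
  also have "c1\<^sup>2 * (1 + D2\<^sup>2) / 4 * \<delta> / real n + 4 * ?Q4 * \<delta> / real n + 2 * a ^ 10 * \<delta> / real n = ?Rem * \<delta> / real n"
    unfolding remainder_const_def by (simp only: add_divide_distrib[symmetric] distrib_right[symmetric]) (simp add: add.commute add.left_commute)
  finally show "(\<integral>\<^sup>+\<omega>. ennreal (undershoot_term n x a c1 c2 D2 \<delta> \<omega>) \<partial>S n) \<le> ennreal (?Rem * \<delta> / real n)" unfolding eT .
qed

text \<open>The terms for too small bandwidths are of order \<open>\<delta> / n\<close>, and the grid is geometric, so together they cost only
  \<open>1 / n\<close>. What remains is of the order of the squared threshold at \<open>\<delta>\<^sub>0\<close>.\<close>

lemma adaptive_risk: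
  assumes n: "n \<ge> 3" and a: "a \<ge> 2" and c: "c1 > 0" "c2 > 0" and D2: "0 \<le> D2"
    and D: "((11 + (dev_scale x)\<^sup>2 * mgf_const \<mu> \<sigma> L x) / dev_scale x)\<^sup>2 / c2 \<le> D2"
    and d0: "\<delta>\<^sub>0 \<in> grid a n"
    and bias: "\<And>\<delta>. \<delta> \<in> grid a n \<Longrightarrow> \<bar>mean_functional \<mu> g x (kern \<mu> \<delta>) - y\<bar> \<le> b * \<delta> powr (\<beta> - 1)"
    and b: "b \<ge> 0" "\<beta> > 1"
    and small: "\<And>\<delta>. \<delta> \<in> grid a n \<Longrightarrow> \<delta> \<le> \<delta>\<^sub>0 \<Longrightarrow> 2 * (b * \<delta> powr (\<beta> - 1)) \<le> noise_level c1 D2 n \<delta>"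
  shows "(\<integral>\<^sup>+\<omega>. ennreal ((fstar \<mu> a c1 c2 D2 n x \<omega> - y)\<^sup>2) \<partial>S n) \<le>
    ennreal (risk_const x c1 c2 * ((lam D2 \<delta>\<^sub>0)\<^sup>2 * (1 / (real n * \<delta>\<^sub>0 ^ 3))) + 2 * remainder_const x a c1 D2 / real n)"
proof -
  interpret P: prob_space "S n" by (rule prob_space_sample)
  note G = grid_bounds[OF n]
  have n0: "real n > 0" using n by simp
  let ?D = "{\<delta>\<in>grid a n. \<delta> < \<delta>\<^sub>0}" and ?T = "undershoot_term n x a c1 c2 D2" and ?Z = "dev n x (kern \<mu> \<delta>\<^sub>0)" and ?Rem = "remainder_const x a c1 D2"
  define A0 where "A0 = 2 * (thresh_const \<mu> c1 c2 * (sqrt (1 / (real n * \<delta>\<^sub>0 ^ 3)) * lam D2 \<delta>\<^sub>0))\<^sup>2 + (noise_level c1 D2 n \<delta>\<^sub>0)\<^sup>2"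
  have T: "\<And>\<omega>. 0 \<le> ?T \<delta> \<omega>" "(\<lambda>\<omega>. ennreal (?T \<delta> \<omega>)) \<in> borel_measurable (S n)" "(\<integral>\<^sup>+\<omega>. ennreal (?T \<delta> \<omega>) \<partial>S n) \<le> ennreal (?Rem * \<delta> / real n)"
    if "\<delta> \<in> ?D" for \<delta>
  proof -
    have \<delta>: "\<delta> \<in> grid a n" "a * \<delta> \<in> grid a n" using that grid_gap(2)[OF a d0, of \<delta>] by auto
    show "\<And>\<omega>. 0 \<le> ?T \<delta> \<omega>" "(\<lambda>\<omega>. ennreal (?T \<delta> \<omega>)) \<in> borel_measurable (S n)" "(\<integral>\<^sup>+\<omega>. ennreal (?T \<delta> \<omega>) \<partial>S n) \<le> ennreal (?Rem * \<delta> / real n)"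
      by (rule undershoot_term_expectation[OF n a c D2 D \<delta>])+
  qed
  have A0: "0 \<le> A0" unfolding A0_def by (intro add_nonneg_nonneg) auto
  have pw: "ennreal ((fstar \<mu> a c1 c2 D2 n x \<omega> - y)\<^sup>2) \<le> ennreal A0 + ennreal 4 * ennreal ((?Z \<omega>)\<^sup>2) + (\<Sum>\<delta>\<in>?D. ennreal (?T \<delta> \<omega>))" for \<omega>
  proof -
    have "ennreal ((fstar \<mu> a c1 c2 D2 n x \<omega> - y)\<^sup>2) \<le> ennreal (A0 + 4 * (?Z \<omega>)\<^sup>2 + (\<Sum>\<delta>\<in>?D. ?T \<delta> \<omega>))"
      unfolding A0_def by (rule ennreal_leI[OF adaptive_error_pointwise[OF n a c D2 d0 bias b small]])
    also have "\<dots> = ennreal (A0 + 4 * (?Z \<omega>)\<^sup>2) + ennreal (\<Sum>\<delta>\<in>?D. ?T \<delta> \<omega>)"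
      by (rule ennreal_plus) (use A0 in \<open>simp, intro sum_nonneg T(1)\<close>)
    also have "ennreal (A0 + 4 * (?Z \<omega>)\<^sup>2) = ennreal A0 + ennreal (4 * (?Z \<omega>)\<^sup>2)" by (rule ennreal_plus[OF A0]) simp
    also have "ennreal (4 * (?Z \<omega>)\<^sup>2) = ennreal 4 * ennreal ((?Z \<omega>)\<^sup>2)" by (rule ennreal_mult) auto
    also have "ennreal (\<Sum>\<delta>\<in>?D. ?T \<delta> \<omega>) = (\<Sum>\<delta>\<in>?D. ennreal (?T \<delta> \<omega>))" by (rule sum_ennreal[symmetric]) (rule T(1))
    finally show ?thesis .
  qed
  have meas_sq: "(\<lambda>\<omega>. ennreal ((?Z \<omega>)\<^sup>2)) \<in> borel_measurable (S n)"
    by (rule measurable_compose[OF borel_measurable_power[OF dev_measurable[OF kern_measurable]] measurable_ennreal])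
  note meas_4 = borel_measurable_times_ennreal[OF borel_measurable_const meas_sq]
  have "(\<integral>\<^sup>+\<omega>. ennreal ((fstar \<mu> a c1 c2 D2 n x \<omega> - y)\<^sup>2) \<partial>S n) \<le> (\<integral>\<^sup>+\<omega>. ennreal A0 + ennreal 4 * ennreal ((?Z \<omega>)\<^sup>2) + (\<Sum>\<delta>\<in>?D. ennreal (?T \<delta> \<omega>)) \<partial>S n)"
    by (rule nn_integral_mono[OF pw])
  also have "\<dots> = (\<integral>\<^sup>+\<omega>. ennreal A0 + ennreal 4 * ennreal ((?Z \<omega>)\<^sup>2) \<partial>S n) + (\<integral>\<^sup>+\<omega>. (\<Sum>\<delta>\<in>?D. ennreal (?T \<delta> \<omega>)) \<partial>S n)"
    by (intro nn_integral_add borel_measurable_sum T(2) borel_measurable_add borel_measurable_const meas_4)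
  also have "(\<integral>\<^sup>+\<omega>. (\<Sum>\<delta>\<in>?D. ennreal (?T \<delta> \<omega>)) \<partial>S n) = (\<Sum>\<delta>\<in>?D. \<integral>\<^sup>+\<omega>. ennreal (?T \<delta> \<omega>) \<partial>S n)" by (rule nn_integral_sum[OF T(2)])
  also have "(\<integral>\<^sup>+\<omega>. ennreal A0 + ennreal 4 * ennreal ((?Z \<omega>)\<^sup>2) \<partial>S n) = ennreal A0 + ennreal 4 * (\<integral>\<^sup>+\<omega>. ennreal ((?Z \<omega>)\<^sup>2) \<partial>S n)"
    unfolding nn_integral_add[OF borel_measurable_const meas_4] nn_integral_cmult[OF meas_sq]
    by (simp add: P.emeasure_space_1)
  finally have bound: "(\<integral>\<^sup>+\<omega>. ennreal ((fstar \<mu> a c1 c2 D2 n x \<omega> - y)\<^sup>2) \<partial>S n) \<le>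
    ennreal A0 + ennreal 4 * (\<integral>\<^sup>+\<omega>. ennreal ((?Z \<omega>)\<^sup>2) \<partial>S n) + (\<Sum>\<delta>\<in>?D. \<integral>\<^sup>+\<omega>. ennreal (?T \<delta> \<omega>) \<partial>S n)" .
  let ?u = "1 / (real n * \<delta>\<^sub>0 ^ 3)" and ?Q2 = "moment_const x / (scale x)\<^sup>2" and ?\<Lambda> = "(lam D2 \<delta>\<^sub>0)\<^sup>2"
  have u: "0 < ?u" using n0 G(1)[OF d0] by simp
  have Q2: "0 \<le> ?Q2" unfolding moment_const_def by simp
  have \<Lambda>: "1 \<le> ?\<Lambda>" using lam_bounds(1)[of D2 \<delta>\<^sub>0] by (intro one_le_power)
  have Rem0: "0 \<le> ?Rem" unfolding remainder_const_def moment_const_def using scale_pos[of x]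
    by (intro add_nonneg_nonneg) (auto simp: zero_le_even_power)
  have sumJ: "(\<Sum>\<delta>\<in>?D. \<integral>\<^sup>+\<omega>. ennreal (?T \<delta> \<omega>) \<partial>S n) \<le> ennreal (2 * ?Rem / real n)"
  proof -
    have "(\<Sum>\<delta>\<in>?D. \<integral>\<^sup>+\<omega>. ennreal (?T \<delta> \<omega>) \<partial>S n) \<le> (\<Sum>\<delta>\<in>?D. ennreal (?Rem * \<delta> / real n))" by (rule sum_mono[OF T(3)])
    also have "\<dots> = ennreal (\<Sum>\<delta>\<in>?D. ?Rem * \<delta> / real n)"
    proof (rule sum_ennreal)
      fix \<delta> assume "\<delta> \<in> ?D" then show "0 \<le> ?Rem * \<delta> / real n" using G(1)[of \<delta> a] Rem0 n0 by simp
    qed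
    also have "(\<Sum>\<delta>\<in>?D. ?Rem * \<delta> / real n) = ?Rem / real n * (\<Sum>\<delta>\<in>?D. \<delta>)" by (simp add: sum_distrib_left)
    also have "ennreal (?Rem / real n * (\<Sum>\<delta>\<in>?D. \<delta>)) \<le> ennreal (?Rem / real n * 2)"
      using Rem0 n0 by (intro ennreal_leI mult_left_mono sum_grid_le[OF n a]) auto
    finally show ?thesis by (simp add: mult.commute)
  qed
  have "ennreal A0 + ennreal 4 * (\<integral>\<^sup>+\<omega>. ennreal ((?Z \<omega>)\<^sup>2) \<partial>S n) + (\<Sum>\<delta>\<in>?D. \<integral>\<^sup>+\<omega>. ennreal (?T \<delta> \<omega>) \<partial>S n) \<le>
     ennreal A0 + ennreal 4 * ennreal (?Q2 * ?u) + ennreal (2 * ?Rem / real n)"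
    by (intro add_mono order_refl mult_left_mono sumJ fbar_moments(1) G(1,2,4)[OF d0] zero_le)
  also have "\<dots> = ennreal (A0 + 4 * (?Q2 * ?u) + 2 * ?Rem / real n)"
  proof -
    have X: "0 \<le> ?Q2 * ?u" by (rule mult_nonneg_nonneg[OF Q2 less_imp_le[OF u]])
    then have X4: "0 \<le> 4 * (?Q2 * ?u)" by (rule mult_nonneg_nonneg[OF zero_le_numeral])
    have Y: "0 \<le> 2 * ?Rem / real n" using Rem0 n0 by simp
    have "ennreal 4 * ennreal (?Q2 * ?u) = ennreal (4 * (?Q2 * ?u))"
      by (rule ennreal_mult[OF zero_le_numeral X, symmetric])
    then show ?thesis by (simp only: ennreal_plus[OF add_nonneg_nonneg[OF A0 X4] Y] ennreal_plus[OF A0 X4])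
  qed
  also have "\<dots> \<le> ennreal (risk_const x c1 c2 * (?\<Lambda> * ?u) + 2 * ?Rem / real n)"
  proof (intro ennreal_leI add_right_mono)
    have A0_eq: "A0 = 2 * ((thresh_const \<mu> c1 c2)\<^sup>2 * (?\<Lambda> * ?u)) + c1 * (?\<Lambda> * ?u)"
      unfolding A0_def noise_level_sq[OF c(1) G(1)[OF d0]] power_mult_distrib using u by (subst real_sqrt_pow2) auto
    have "1 * ?u \<le> ?\<Lambda> * ?u" using \<Lambda> u by (intro mult_right_mono) auto
    then have "4 * (?Q2 * ?u) \<le> 4 * (?Q2 * (?\<Lambda> * ?u))" using Q2 by (intro mult_left_mono) auto
    then have "A0 + 4 * (?Q2 * ?u) \<le> 2 * ((thresh_const \<mu> c1 c2)\<^sup>2 * (?\<Lambda> * ?u)) + c1 * (?\<Lambda> * ?u) + 4 * (?Q2 * (?\<Lambda> * ?u))"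
      unfolding A0_eq by (intro add_left_mono)
    also have "\<dots> = risk_const x c1 c2 * (?\<Lambda> * ?u)" unfolding risk_const_def by (simp only: distrib_right mult.assoc add.assoc add.commute add.left_commute)
    finally show "A0 + 4 * (?Q2 * ?u) \<le> risk_const x c1 c2 * (?\<Lambda> * ?u)" .
  qed
  finally show ?thesis by (rule order_trans[OF bound])
qed

end

section \<open>The rate of convergence\<close>

lemma ln_le_half: "y > 0 \<Longrightarrow> ln y \<le> y / 2" for y :: real
proof -
  assume y: "y > 0"
  have "ln (y / 2) \<le> y / 2 - 1" using y by (intro ln_le_minus_one) simp
  moreover have "ln (y / 2) = ln y - ln 2" using y by (simp add: ln_div)
  moreover have "ln 2 < (1::real)" by (rule ln_2_less_1)
  ultimately show ?thesis by linarith
qed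

definition rate :: "nat \<Rightarrow> real" where "rate n = ln (real n) / real n"

lemma rate_bounds: 
  assumes n: "n \<ge> 3" shows "0 < rate n" "rate n \<le> 1" "1 / real n \<le> rate n"
proof -
  have l: "1 \<le> ln (real n)" by (rule ln_nat_ge_1[OF n])
  have n0: "real n > 0" using n by simp
  show "0 < rate n" unfolding rate_def using l n0 by (intro divide_pos_pos) linarith+
  have "ln (real n) \<le> real n" using ln_le_minus_one[OF n0] by simp
  then show "rate n \<le> 1" unfolding rate_def using n0 by simp
  show "1 / real n \<le> rate n" unfolding rate_def using l n0 by (intro divide_right_mono) auto
qed

lemma powr_grid_point:
  fixes a h :: real
  assumes a: "a \<ge> 2" and h: "0 < h" "h \<le> 1"
  obtains j :: nat where "1 / a ^ j \<le> h" "h / a < 1 / a ^ j"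
proof -
  have a0: "a > 0" "1 / a < 1" "1 / a > 0" using a by auto
  obtain N where "(1 / a) ^ N < h" using real_arch_pow_inv[OF h(1) a0(2)] by blast
  then have ex: "1 / a ^ N \<le> h" by (simp add: power_one_over)
  (* The largest point of the geometric grid that does not exceed h. *)
  define j where "j = (LEAST j. 1 / a ^ j \<le> h)"
  have j: "1 / a ^ j \<le> h" unfolding j_def by (rule LeastI[of "\<lambda>j. 1 / a ^ j \<le> h", OF ex])
  have "h / a < 1 / a ^ j"
  proof (cases j)
    case 0
    have "h < a" using h a by linarith
    then show ?thesis using 0 a0 by simp
  next
    case (Suc k)
    then have "\<not> 1 / a ^ k \<le> h" unfolding j_def by (intro not_less_Least) simp
    then have "h / a < (1 / a ^ k) / a" using a0 by (intro divide_strict_right_mono) auto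
    then show ?thesis using Suc by (simp add: mult.commute)
  qed
  with j show ?thesis by (rule that)
qed

text \<open>Up to constants the inequality says \<open>\<delta> powr (2 * \<beta> + 1) \<le> ln (1 / \<delta>) / n\<close>. For \<open>\<delta>\<close> up to a small multiple of
  \<open>rate n powr \<gamma>\<close> the left-hand side is at most a small multiple of \<open>ln n / n\<close>, and \<open>ln (1 / \<delta>)\<close> is at least
  \<open>\<gamma> / 2 * ln n\<close>.\<close>

lemma bias_below_threshold:
  assumes b: "b > 0" and \<beta>: "\<beta> > 1" and c1: "c1 > 0" and D2: "D2 > 0" and n: "n \<ge> 3"
    and \<gamma>: "\<gamma> = 1 / (2 * \<beta> + 1)" and \<kappa>: "0 < \<kappa>" "\<kappa> \<le> 1" "\<kappa> powr (2 * \<beta> + 1) \<le> c1 * D2 * \<gamma> / (8 * b\<^sup>2)"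
    and d: "0 < \<delta>" "\<delta> \<le> \<kappa> * rate n powr \<gamma>" "\<delta> \<le> 1"
  shows "2 * (b * \<delta> powr (\<beta> - 1)) \<le> noise_level c1 D2 n \<delta>"
proof -
  let ?\<rho> = "rate n" and ?l = "ln (real n)"
  note \<rho> = rate_bounds[OF n]
  have n0: "real n > 0" using n by simp
  have l1: "1 \<le> ?l" by (rule ln_nat_ge_1[OF n])
  have \<gamma>0: "0 < \<gamma>" unfolding \<gamma> using \<beta> by simp
  have \<gamma>\<beta>: "\<gamma> * (2 * \<beta> + 1) = 1" unfolding \<gamma> using \<beta> by simp
  have lnd: "\<gamma> * ?l / 2 \<le> ln (1 / \<delta>)"
  proof -
    have "\<delta> \<le> 1 * ?\<rho> powr \<gamma>" using d(2) \<kappa> \<rho> by (meson mult_right_mono order_trans powr_ge_zero)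
    then have "ln \<delta> \<le> ln (?\<rho> powr \<gamma>)" using d by (intro ln_mono) auto
    also have "\<dots> = \<gamma> * ln ?\<rho>" using \<rho> by (simp add: ln_powr)
    also have "ln ?\<rho> = ln ?l - ?l" unfolding rate_def using l1 n0 by (simp add: ln_div)
    also have "\<gamma> * (ln ?l - ?l) \<le> \<gamma> * (?l / 2 - ?l)" using ln_le_half[of ?l] l1 \<gamma>0 by (intro mult_left_mono) auto
    finally have "ln \<delta> \<le> - (\<gamma> * ?l / 2)" by (simp add: algebra_simps)
    then show ?thesis using d by (simp add: ln_div)
  qed
  have "\<delta> powr (2 * \<beta> + 1) \<le> (\<kappa> * ?\<rho> powr \<gamma>) powr (2 * \<beta> + 1)" using d \<beta> by (intro powr_mono2) auto
  also have "\<dots> = \<kappa> powr (2 * \<beta> + 1) * ?\<rho>" using \<kappa> \<rho> by (simp add: powr_mult powr_powr \<gamma>\<beta>)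
  also have "\<dots> \<le> c1 * D2 * \<gamma> / (8 * b\<^sup>2) * ?\<rho>" using \<kappa>(3) \<rho> by (intro mult_right_mono) auto
  finally have "4 * b\<^sup>2 * \<delta> powr (2 * \<beta> + 1) \<le> 4 * b\<^sup>2 * (c1 * D2 * \<gamma> / (8 * b\<^sup>2) * ?\<rho>)" by (intro mult_left_mono) auto
  also have "\<dots> = c1 * D2 * (\<gamma> * ?l / 2) / real n" using b by (simp add: rate_def)
  also have "\<dots> \<le> c1 * D2 * ln (1 / \<delta>) / real n" using lnd c1 D2 n0 by (intro divide_right_mono mult_left_mono) auto
  finally have main: "4 * b\<^sup>2 * \<delta> powr (2 * \<beta> + 1) \<le> c1 * D2 * ln (1 / \<delta>) / real n" .
  have p: "(\<delta> powr (\<beta> - 1))\<^sup>2 = \<delta> powr (2 * \<beta> + 1) / \<delta> ^ 3"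
  proof -
    have "(\<delta> powr (\<beta> - 1))\<^sup>2 = \<delta> powr (\<beta> - 1) * \<delta> powr (\<beta> - 1)" by (simp add: power2_eq_square)
    also have "\<dots> = \<delta> powr ((2 * \<beta> + 1) - 3)" by (simp add: powr_add[symmetric])
    also have "\<dots> = \<delta> powr (2 * \<beta> + 1) / \<delta> powr 3" by (rule powr_diff)
    also have "\<delta> powr 3 = \<delta> ^ 3" using d by (simp add: powr_numeral)
    finally show ?thesis .
  qed
  have v0: "0 \<le> var1 c1 n \<delta>" unfolding var1_eq using c1 n0 d by simp
  show ?thesis unfolding noise_level_def
  proof (rule power2_le_imp_le)
    have "(2 * (b * \<delta> powr (\<beta> - 1)))\<^sup>2 = (4 * b\<^sup>2 * \<delta> powr (2 * \<beta> + 1)) / \<delta> ^ 3"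
      unfolding power_mult_distrib p by simp
    also have "\<dots> \<le> (c1 * D2 * ln (1 / \<delta>) / real n) / \<delta> ^ 3" using main d by (intro divide_right_mono) auto
    also have "\<dots> = var1 c1 n \<delta> * (D2 * ln (1 / \<delta>))" unfolding var1_eq by simp
    also have "\<dots> \<le> var1 c1 n \<delta> * (lam D2 \<delta>)\<^sup>2" using v0 by (intro mult_left_mono) (simp_all add: lam_sq[OF less_imp_le[OF D2] d(1,3)])
    also have "\<dots> = (sqrt (var1 c1 n \<delta>) * lam D2 \<delta>)\<^sup>2" unfolding power_mult_distrib using v0 by simp
    finally show "(2 * (b * \<delta> powr (\<beta> - 1)))\<^sup>2 \<le> (sqrt (var1 c1 n \<delta>) * lam D2 \<delta>)\<^sup>2" .
    show "0 \<le> sqrt (var1 c1 n \<delta>) * lam D2 \<delta>" using v0 lam_bounds(2)[of D2 \<delta>] by simp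
  qed
qed

text \<open>At a bandwidth of at least the order \<open>rate n powr \<gamma>\<close> the squared threshold is at most of order
  \<open>rate n * rate n powr (- 3 * \<gamma>)\<close>, and \<open>1 - 3 * \<gamma>\<close> is the exponent of the theorem.\<close>

lemma risk_rate:
  assumes n: "n \<ge> 3" and D2: "0 \<le> D2" and \<beta>: "\<beta> > 1" and \<gamma>: "\<gamma> = 1 / (2 * \<beta> + 1)" and \<kappa>: "0 < \<kappa>" and a: "a > 0"
    and d: "\<kappa> / a * rate n powr \<gamma> \<le> \<delta>" "\<delta> \<in> grid a n" and P: "0 \<le> P" and Q: "0 \<le> Q"
  shows "(real n / ln (real n)) powr ((2 * \<beta> - 2) / (2 * \<beta> + 1)) * (P * ((lam D2 \<delta>)\<^sup>2 * (1 / (real n * \<delta> ^ 3))) + Q / real n) \<le>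
    P * ((1 + D2) * (a / \<kappa>) ^ 3) + Q"
proof -
  let ?\<rho> = "rate n" and ?l = "ln (real n)" and ?e = "(2 * \<beta> - 2) / (2 * \<beta> + 1)"
  note \<rho> = rate_bounds[OF n]
  note g = grid_bounds[OF n d(2)]
  have n0: "real n > 0" using n by simp
  have l1: "1 \<le> ?l" by (rule ln_nat_ge_1[OF n])
  have e: "?e = 1 - 3 * \<gamma>" unfolding \<gamma> using \<beta> by (simp add: field_simps)
  have e01: "0 \<le> ?e" "?e \<le> 1" using \<beta> by (auto simp: divide_le_eq)
  have inv: "(real n / ?l) powr ?e = 1 / ?\<rho> powr ?e"
  proof -
    have "real n / ?l = 1 / ?\<rho>" by (simp add: rate_def)
    then show ?thesis using \<rho> by (simp add: powr_divide)
  qed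
  have lam2: "(lam D2 \<delta>)\<^sup>2 \<le> (1 + D2) * ?l"
  proof -
    have "D2 * ln (1 / \<delta>) \<le> D2 * ?l" using g(5) D2 by (intro mult_left_mono)
    moreover have "0 \<le> D2 * ?l" using D2 l1 by simp
    ultimately show ?thesis unfolding lam_sq[OF D2 g(1,2)] using l1 by (simp add: distrib_right max_def)
  qed
  have cube: "1 / (real n * \<delta> ^ 3) \<le> (a / \<kappa>) ^ 3 * ?\<rho> powr (- 3 * \<gamma>) / real n"
  proof -
    let ?h = "\<kappa> / a * ?\<rho> powr \<gamma>"
    have h: "0 < ?h" using \<kappa> a \<rho> by simp
    have "1 / (real n * \<delta> ^ 3) \<le> 1 / (real n * ?h ^ 3)" using h d(1) n0 g(1) \<kappa> a \<rho>(1) by (intro divide_left_mono mult_left_mono power_mono mult_pos_pos zero_less_power) auto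
    also have "\<dots> = (a / \<kappa>) ^ 3 * (1 / (?\<rho> powr \<gamma>) ^ 3) / real n" using \<kappa> a by (simp add: power_mult_distrib power_divide)
    also have "1 / (?\<rho> powr \<gamma>) ^ 3 = ?\<rho> powr (- 3 * \<gamma>)"
      using \<rho> by (simp add: powr_power powr_minus_divide mult.commute)
    finally show ?thesis .
  qed
  have "(lam D2 \<delta>)\<^sup>2 * (1 / (real n * \<delta> ^ 3)) \<le> ((1 + D2) * ?l) * ((a / \<kappa>) ^ 3 * ?\<rho> powr (- 3 * \<gamma>) / real n)"
    using lam2 cube D2 l1 g(1) n0 by (intro mult_mono) auto
  also have "\<dots> = (1 + D2) * (a / \<kappa>) ^ 3 * (?\<rho> * ?\<rho> powr (- 3 * \<gamma>))" by (simp add: rate_def)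
  also have "?\<rho> * ?\<rho> powr (- 3 * \<gamma>) = ?\<rho> powr ?e"
    unfolding e using \<rho>(1) powr_add[of ?\<rho> 1 "- 3 * \<gamma>"] by simp
  finally have 1: "(lam D2 \<delta>)\<^sup>2 * (1 / (real n * \<delta> ^ 3)) \<le> (1 + D2) * (a / \<kappa>) ^ 3 * ?\<rho> powr ?e" .
  have "1 / real n \<le> ?\<rho> powr 1" using \<rho> by simp
  also have "\<dots> \<le> ?\<rho> powr ?e" using \<rho> e01 by (intro powr_mono') auto
  finally have 2: "1 / real n \<le> ?\<rho> powr ?e" .
  have "P * ((lam D2 \<delta>)\<^sup>2 * (1 / (real n * \<delta> ^ 3))) + Q * (1 / real n) \<le> P * ((1 + D2) * (a / \<kappa>) ^ 3 * ?\<rho> powr ?e) + Q * ?\<rho> powr ?e"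
    using 1 2 P Q by (intro add_mono mult_left_mono)
  also have "\<dots> = (P * ((1 + D2) * (a / \<kappa>) ^ 3) + Q) * ?\<rho> powr ?e" by (simp only: distrib_right mult.assoc)
  finally have 3: "P * ((lam D2 \<delta>)\<^sup>2 * (1 / (real n * \<delta> ^ 3))) + Q / real n \<le> (P * ((1 + D2) * (a / \<kappa>) ^ 3) + Q) * ?\<rho> powr ?e" by simp
  have pe: "0 < ?\<rho> powr ?e" using \<rho> by simp
  show ?thesis unfolding inv using 3 pe by (simp add: divide_le_eq)
qed

lemma sobolev_observation:
  assumes "\<sigma> > 0" "L > 0" and C: "C > 0" and \<beta>: "\<beta> > 1" and f: "f \<in> sobolev_ball \<beta> C" "f \<in> bounded_class L" and x: "isCont f x"
  obtains g where "observation \<sigma> L f g" "\<And>\<mu> \<delta>. 0 < \<delta> \<Longrightarrow> \<delta> \<le> 1 \<Longrightarrow> \<bar>mean_functional \<mu> g x (kern \<mu> \<delta>) - f x\<bar> \<le> bias_const \<beta> C * \<delta> powr (\<beta> - 1)"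
proof -
  have fm: "f \<in> borel_measurable lebesgue" using f(1) by (auto simp: sobolev_ball_def)
  have supp: "f y = 0" if "norm y > 1" for y using f(2) that by (auto simp: bounded_class_def)
  have bd: "\<bar>f y\<bar> \<le> L" for y using f(2) by (auto simp: bounded_class_def)
  obtain g where g: "supported_bounded L g" "AE y in lborel. f y = g y" "isCont g x" "g x = f x"
    by (rule continuous_borel_version[OF fm supp bd x])
  have gm: "g \<in> borel_measurable borel" using g(1) by (simp add: supported_bounded_def)
  have "fourier f = borel_fourier g"
    unfolding borel_fourier_def by (rule ext) (rule fourier_cong_AE[OF g(2) gm])
  then have sob: "(\<integral>\<^sup>+\<xi>. ennreal ((1 + (norm \<xi>)\<^sup>2) powr \<beta> * (cmod (borel_fourier g \<xi>))\<^sup>2) \<partial>lborel) \<le> ennreal C"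
    using f(1) by (simp add: sobolev_ball_def)
  show ?thesis
  proof (rule that)
    show "observation \<sigma> L f g" using assms(1,2) g(1,2) by unfold_locales
    fix \<mu> \<delta> :: real assume d: "0 < \<delta>" "\<delta> \<le> 1"
    have p: "(1 / \<delta>) powr (1 - \<beta>) = \<delta> powr (\<beta> - 1)"
      using d powr_minus_divide[of \<delta> "1 - \<beta>"] by (simp add: powr_divide)
    have "1 \<le> 1 / \<delta>" using d by simp
    from band_limited_bias[OF \<beta> C this g(1,3) sob]
    show "\<bar>mean_functional \<mu> g x (kern \<mu> \<delta>) - f x\<bar> \<le> bias_const \<beta> C * \<delta> powr (\<beta> - 1)"
      unfolding mean_functional_kern[OF g(1) d] g(4) p .
  qed
qed

theorem theorem3:
  fixes L \<mu> \<sigma> a c1 c2 :: real and x :: "real^2"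
  assumes "L > 0" and "\<sigma> > 0" and "a \<ge> 2" and "c1 > 0" and "c2 > 0"
    and "\<And>f \<delta> n. f \<in> bounded_class L \<Longrightarrow> 0 < \<delta> \<Longrightarrow> \<delta> \<le> 1 \<Longrightarrow> n \<ge> 1 \<Longrightarrow>
      prob_space.variance (sample_law \<mu> \<sigma> f n) (fbar \<mu> n \<delta> x) \<le> var1 c1 n \<delta>"
    and "\<And>f \<delta> \<eta> n. f \<in> bounded_class L \<Longrightarrow> 0 < \<delta> \<Longrightarrow> \<delta> \<le> 1 \<Longrightarrow> 0 < \<eta> \<Longrightarrow> \<eta> \<le> 1 \<Longrightarrow> n \<ge> 1 \<Longrightarrow>
      prob_space.variance (sample_law \<mu> \<sigma> f n) (\<lambda>\<omega>. fbar \<mu> n \<delta> x \<omega> - fbar \<mu> n \<eta> x \<omega>)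
        \<le> var2 \<mu> c2 n \<delta> \<eta>"
  shows "\<exists>D0 \<ge> 20 * L\<^sup>2 / c1. \<forall>D2 \<ge> D0. \<forall>C > 0. \<forall>\<beta> > 1.
    limsup (\<lambda>n. SUP f \<in> {f \<in> sobolev_ball \<beta> C \<inter> bounded_class L. isCont f x}.
      ennreal ((real n / ln (real n)) powr ((2 * \<beta> - 2) / (2 * \<beta> + 1))) *
      (\<integral>\<^sup>+\<omega>. ennreal ((fstar \<mu> a c1 c2 D2 n x \<omega> - f x)\<^sup>2) \<partial>sample_law \<mu> \<sigma> f n)) < \<infinity>"
proof -
  (* For D2 above this bound each bad event has probability at most 2 \<eta> ^ 11. *)
  define E where "E = ((11 + (observation.dev_scale \<mu> \<sigma> L x)\<^sup>2 * mgf_const \<mu> \<sigma> L x) / observation.dev_scale \<mu> \<sigma> L x)\<^sup>2 / c2"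
  define D0 where "D0 = max (20 * L\<^sup>2 / c1) E"
  have D0: "20 * L\<^sup>2 / c1 \<le> D0" "E \<le> D0" "0 < D0" unfolding D0_def using assms(1,4) by (auto simp: less_max_iff_disj)
  show ?thesis
  proof (intro exI[of _ D0] conjI allI impI D0(1))
    fix D2 C \<beta> :: real assume D2: "D0 \<le> D2" and C: "0 < C" and \<beta>: "1 < \<beta>"
    have D2pos: "0 < D2" using D0(3) D2 by linarith
    define b where "b = bias_const \<beta> C"
    have b: "b > 0" unfolding b_def bias_const_def using C \<beta> by (simp add: add_pos_pos)
    define \<gamma> where "\<gamma> = 1 / (2 * \<beta> + 1)"
    have \<gamma>0: "0 < \<gamma>" "\<gamma> < 1" unfolding \<gamma>_def using \<beta> by auto
    define q where "q = c1 * D2 * \<gamma> / (8 * b\<^sup>2)"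
    have q: "q > 0" unfolding q_def using assms(4) D2pos \<gamma>0 b by simp
    (* Bandwidths up to \<kappa> * rate n powr \<gamma> have a bias below the noise level. *)
    define \<kappa> where "\<kappa> = min 1 (q powr \<gamma>)"
    have \<kappa>: "0 < \<kappa>" "\<kappa> \<le> 1" unfolding \<kappa>_def using q by auto
    have \<kappa>q: "\<kappa> powr (2 * \<beta> + 1) \<le> q"
    proof -
      have "\<kappa> powr (2 * \<beta> + 1) \<le> (q powr \<gamma>) powr (2 * \<beta> + 1)" using \<kappa> \<beta> by (intro powr_mono2) (auto simp: \<kappa>_def)
      also have "\<dots> = q" using q \<beta> by (simp add: powr_powr \<gamma>_def)
      finally show ?thesis .
    qed
    let ?P = "observation.risk_const \<mu> \<sigma> L x c1 c2" and ?Q = "2 * observation.remainder_const \<mu> \<sigma> L x a c1 D2"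
    define B where "B = ?P * ((1 + D2) * (a / \<kappa>) ^ 3) + ?Q"
    let ?r = "\<lambda>n. (real n / ln (real n)) powr ((2 * \<beta> - 2) / (2 * \<beta> + 1))"
    (* For large n the comparison bandwidth lies above the smallest admissible bandwidth. *)
    have ev: "\<forall>\<^sub>F n in sequentially. n \<ge> 3 \<and> a * rate n \<le> \<kappa> * rate n powr \<gamma>"
    proof (rule eventually_conj[OF eventually_ge_at_top])
      have "(\<lambda>n. rate n powr (1 - \<gamma>)) \<longlonglongrightarrow> 0"
        unfolding rate_def using \<gamma>0 by real_asymp
      then have "\<forall>\<^sub>F n in sequentially. rate n powr (1 - \<gamma>) < \<kappa> / a"
        using \<kappa> assms(3) by (intro order_tendstoD) auto
      then show "\<forall>\<^sub>F n in sequentially. a * rate n \<le> \<kappa> * rate n powr \<gamma>"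
        using eventually_ge_at_top[of 3]
      proof eventually_elim
        case (elim n)
        have \<rho>: "0 < rate n" using rate_bounds[OF elim(2)] by simp
        have "rate n = rate n powr (1 - \<gamma>) * rate n powr \<gamma>" using \<rho> by (simp add: powr_add[symmetric])
        also have "\<dots> \<le> \<kappa> / a * rate n powr \<gamma>" using elim by (intro mult_right_mono) auto
        finally show ?case using assms(3) by (simp add: pos_le_divide_eq mult.commute)
      qed
    qed
    have "\<forall>\<^sub>F n in sequentially. (SUP f \<in> {f \<in> sobolev_ball \<beta> C \<inter> bounded_class L. isCont f x}.
      ennreal (?r n) * (\<integral>\<^sup>+\<omega>. ennreal ((fstar \<mu> a c1 c2 D2 n x \<omega> - f x)\<^sup>2) \<partial>sample_law \<mu> \<sigma> f n)) \<le> ennreal B"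
      using ev
    proof eventually_elim
      case (elim n)
      then have n: "n \<ge> 3" and big: "a * rate n \<le> \<kappa> * rate n powr \<gamma>" by auto
      note \<rho> = rate_bounds[OF n]
      let ?h = "\<kappa> * rate n powr \<gamma>"
      have "rate n powr \<gamma> \<le> 1" using \<rho> \<gamma>0 by (intro powr_le1) auto
      then have h: "0 < ?h" "?h \<le> 1" using \<kappa> \<rho> by (auto intro: mult_le_one)
      obtain j :: nat where j: "1 / a ^ j \<le> ?h" "?h / a < 1 / a ^ j"
        by (rule powr_grid_point[OF assms(3) h])
      (* The comparison bandwidth depends on \<beta> and C, the estimator does not. *)
      define \<delta>\<^sub>0 where "\<delta>\<^sub>0 = 1 / a ^ j"
      have "rate n \<le> ?h / a" using big assms(3) by (simp add: pos_le_divide_eq mult.commute)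
      then have "rate n \<le> \<delta>\<^sub>0" using j(2) unfolding \<delta>\<^sub>0_def by linarith
      then have d0: "\<delta>\<^sub>0 \<in> grid a n" using j(1) h(2) unfolding grid_def \<delta>\<^sub>0_def rate_def by auto
      have d0low: "\<kappa> / a * rate n powr \<gamma> \<le> \<delta>\<^sub>0" using j(2) unfolding \<delta>\<^sub>0_def by simp
      show ?case
      proof (rule SUP_least)
        fix f assume f: "f \<in> {f \<in> sobolev_ball \<beta> C \<inter> bounded_class L. isCont f x}"
        obtain g where g: "observation \<sigma> L f g" 
          and bias: "\<And>\<mu> \<delta>. 0 < \<delta> \<Longrightarrow> \<delta> \<le> 1 \<Longrightarrow> \<bar>mean_functional \<mu> g x (kern \<mu> \<delta>) - f x\<bar> \<le> b * \<delta> powr (\<beta> - 1)"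
          unfolding b_def by (rule sobolev_observation[OF assms(2,1) C \<beta>, of f x]) (use f in auto)
        interpret observation \<mu> \<sigma> L f g by (rule g)
        let ?\<Lambda> = "(lam D2 \<delta>\<^sub>0)\<^sup>2 * (1 / (real n * \<delta>\<^sub>0 ^ 3))"
        have risk: "(\<integral>\<^sup>+\<omega>. ennreal ((fstar \<mu> a c1 c2 D2 n x \<omega> - f x)\<^sup>2) \<partial>S n) \<le> ennreal (?P * ?\<Lambda> + ?Q / real n)"
        proof (rule adaptive_risk[OF n assms(3-5) less_imp_le[OF D2pos] _ d0 _ less_imp_le[OF b] \<beta>])
          show "((11 + (dev_scale x)\<^sup>2 * mgf_const \<mu> \<sigma> L x) / dev_scale x)\<^sup>2 / c2 \<le> D2"
            using D0(2) D2 unfolding E_def by linarith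
          fix \<delta> assume \<delta>: "\<delta> \<in> grid a n"
          note gd = grid_bounds[OF n \<delta>]
          show "\<bar>mean_functional \<mu> g x (kern \<mu> \<delta>) - f x\<bar> \<le> b * \<delta> powr (\<beta> - 1)" by (rule bias[OF gd(1,2)])
          assume "\<delta> \<le> \<delta>\<^sub>0"
          then have "\<delta> \<le> ?h" using j(1) unfolding \<delta>\<^sub>0_def by linarith
          then show "2 * (b * \<delta> powr (\<beta> - 1)) \<le> noise_level c1 D2 n \<delta>"
            by (intro bias_below_threshold[OF b \<beta> assms(4) D2pos n \<gamma>_def \<kappa> \<kappa>q[unfolded q_def] gd(1) _ gd(2)])
        qed
        have P0: "0 \<le> ?P" unfolding risk_const_def moment_const_def using assms(4)
          by (intro add_nonneg_nonneg mult_nonneg_nonneg divide_nonneg_nonneg) auto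
        have Q0: "0 \<le> ?Q" unfolding remainder_const_def moment_const_def using scale_pos[of x]
          by (intro add_nonneg_nonneg mult_nonneg_nonneg divide_nonneg_nonneg) (auto simp: zero_le_even_power)
        have "ennreal (?r n) * (\<integral>\<^sup>+\<omega>. ennreal ((fstar \<mu> a c1 c2 D2 n x \<omega> - f x)\<^sup>2) \<partial>S n) \<le> ennreal (?r n) * ennreal (?P * ?\<Lambda> + ?Q / real n)"
          by (rule mult_left_mono[OF risk zero_le])
        also have "\<dots> = ennreal (?r n * (?P * ?\<Lambda> + ?Q / real n))"
          by (rule ennreal_mult[symmetric]) (use P0 Q0 grid_bounds(1)[OF n d0] in \<open>auto intro!: add_nonneg_nonneg mult_nonneg_nonneg divide_nonneg_nonneg\<close>)
        also have "\<dots> \<le> ennreal B" unfolding B_def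
          by (intro ennreal_leI risk_rate[OF n less_imp_le[OF D2pos] \<beta> \<gamma>_def \<kappa>(1) _ d0low d0 P0 Q0]) (use assms(3) in simp)
        finally show "ennreal (?r n) * (\<integral>\<^sup>+\<omega>. ennreal ((fstar \<mu> a c1 c2 D2 n x \<omega> - f x)\<^sup>2) \<partial>sample_law \<mu> \<sigma> f n) \<le> ennreal B" .
      qed
    qed
    then have "limsup (\<lambda>n. SUP f \<in> {f \<in> sobolev_ball \<beta> C \<inter> bounded_class L. isCont f x}.
      ennreal (?r n) * (\<integral>\<^sup>+\<omega>. ennreal ((fstar \<mu> a c1 c2 D2 n x \<omega> - f x)\<^sup>2) \<partial>sample_law \<mu> \<sigma> f n)) \<le> ennreal B"
      by (rule Limsup_bounded)
    then show "limsup (\<lambda>n. SUP f \<in> {f \<in> sobolev_ball \<beta> C \<inter> bounded_class L. isCont f x}.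
      ennreal (?r n) * (\<integral>\<^sup>+\<omega>. ennreal ((fstar \<mu> a c1 c2 D2 n x \<omega> - f x)\<^sup>2) \<partial>sample_law \<mu> \<sigma> f n)) < \<infinity>"
      using le_less_trans[OF _ ennreal_less_top] by simp
  qed
qed

end
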